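(* Let $m\ge1$ be an integer. For any $\delta\in\mathbb{C}$ satisfying $\mathrm{Re}\,\delta>-1/2$, the limiting point process, taken by $n\to\infty$, of the determinantal point processes $\mathscr{X}_n^{(m,\delta)}$ (that is, the determinantal point process on $\mathbb{D}$ with kernel $\lim_{n\to\infty}K_n^{(m,\delta)}(z,w)$ with respect to the reference measure $\mu^{(m,\delta)}$) is always $\mathscr{X}^{[m]}$ (equality in distribution), independent of $\delta$. Here $\mathscr{X}^{[m]}$ is the determinantal point process on the unit disc $\mathbb{D}$ with weighted Bergman kernel $$K^{[m]}(z,w)=\frac{1}{(1-z\overline w)^{m+1}}$$ with respect to the reference measure $d\mu^{[m]}(z)=\frac{m}{\pi}(1-|z|^2)^{m-1}d\sigma(z)$.
   Context: $\mathbb{D}=\{z\in\mathbb{C}:|z|<1\}$ and $\sigma$ is Lebesgue measure on $\mathbb{D}$. For $z\in\mathbb{D}$, $(1-z)^\delta=\exp(\delta\log(1-z))$ with the principal branch of the logarithm. Set $d\mu^{(m,\delta)}(z)=|(1-z)^{\delta}|^2(1-|z|^2)^{m-1}d\sigma(z)$ on $\mathbb{D}$, and let $\{P_k^{(m,\delta)}\}_{k=0}^{\infty}$ be the orthonormal polynomials obtained by applying Gram-Schmidt to $\{z^k\}_{k=0}^\infty$ in $L^2(\mathbb{D},\mu^{(m,\delta)})$. For $n\ge1$, $\mathscr{X}_n^{(m,\delta)}$ is the determinantal point process on $\mathbb{D}$ with kernel $$K_n^{(m,\delta)}(z,w)=\sum_{k=0}^{n-1}P_k^{(m,\delta)}(z)\overline{P_k^{(m,\delta)}(w)}$$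 with respect to the reference measure $\mu^{(m,\delta)}$. (It arises as the point process of eigenvalues of $[U_{i,j}]_{1\le i,j\le n}$ where $U$ is a random unitary matrix whose law on $\mathrm{U}(n+m)$ is the probability measure proportional to $|\det(I-U)^\delta|^2\,d\mu_{\mathrm{U}(n+m)}(U)$, with $\mu_{\mathrm{U}(n+m)}$ the Haar measure.) Convention: the limiting point process as $n\to\infty$ of determinantal point processes with kernels $\sum_{k=0}^{n-1}P_k(x)\overline{P_k(y)}$ with respect to a fixed reference measure is the determinantal point process with the limiting kernel $\sum_{k=0}^{\infty}P_k(x)\overline{P_k(y)}$ with respect to the same reference measure. Determinantal point process: let $E$ be a locally compact Polish space, $\mu$ a Radon measure on $E$ and $K:E\times E\to\mathbb{C}$ measurable. A point process $\mathscr{X}$ on $E$ is a random locally finite non-negative integer-valued measure on $E$; it is simple if almost surely every singleton has mass at most one. A simple point process $\mathscr{X}$ is determinantal with kernel $K$ with respect to the reference measure $\mu$ if for all $M\ge1$, all pairwise disjoint pre-compact Borel sets $\Delta_1,\dots,\Delta_M\subset E$ and all integers $n_1,\dots,n_M\geq 1$ with sum $\ell$, $$\mathbb{E}\Big[\prod_{k=1}^{M}\frac{\mathscr{X}(\Delta_k)!}{(\mathscr{X}(\Delta_k)-n_k)!}\Big]=\int_{\Delta_1^{n_1}\times\cdots\times\Delta_M^{n_M}}\det[K(x_i,x_j)]_{1\leq i,j\leq \ell}\,d\mu(x_1)\cdots d\mu(x_\ell),$$ where the factorial ratio on the left means $\prod_{i=0}^{n_k-1}(\mathscr{X}(\Delta_k)-i)$.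 *)

theory Defs
  imports "HOL-Probability.Probability" "Jordan_Normal_Form.Determinant"
begin

section \<open>Point processes\<close>

text \<open>
  The state space is a subset \<open>E\<close> of a Polish space, with its subspace topology. It is meant to be
  a locally compact Polish space, as is the case for every open \<open>E\<close> in the complex plane.
  The notions below only involve compact and Borel subsets of \<open>E\<close>.
\<close>

definition precompact_in :: "'a::topological_space set \<Rightarrow> 'a set \<Rightarrow> bool" where
  "precompact_in E A \<longleftrightarrow> (\<exists>C. compact C \<and> C \<subseteq> E \<and> A \<subseteq> C)"

text \<open>
  On a locally compact Polish space, a Borel measure that is finite on compact sets is
  automatically regular, so this is the usual notion of a Radon measure.
\<close>

definition radon_on :: "'a::polish_space set \<Rightarrow> 'a measure \<Rightarrow> bool" where
  "radon_on E \<mu> \<longleftrightarrow>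
     sets \<mu> = sets (restrict_space borel E) \<and>
     (\<forall>C. compact C \<longrightarrow> C \<subseteq> E \<longrightarrow> emeasure \<mu> C < \<infinity>)"

definition configurations :: "'a::polish_space set \<Rightarrow> 'a measure set" where
  "configurations E =
     {\<xi>. radon_on E \<xi> \<and> (\<forall>A \<in> sets \<xi>. emeasure \<xi> A = \<infinity> \<or> (\<exists>n::nat. emeasure \<xi> A = of_nat n))}"

text \<open>
  The \<open>\<sigma>\<close>-algebra on configurations is the smallest one making all evaluations measurable (compare
  \<^const>\<open>subprob_algebra\<close>).
\<close>

definition configuration_algebra :: "'a::polish_space set \<Rightarrow> 'a measure measure" where
  "configuration_algebra E =
     (SUP A \<in> sets (restrict_space borel E).
        vimage_algebra (configurations E) (\<lambda>\<xi>. emeasure \<xi> A) borel)"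

definition point_process ::
    "'a::polish_space set \<Rightarrow> 'w measure \<Rightarrow> ('w \<Rightarrow> 'a measure) \<Rightarrow> bool" where
  "point_process E M X \<longleftrightarrow> prob_space M \<and> X \<in> measurable M (configuration_algebra E)"

definition simple_point_process ::
    "'a::polish_space set \<Rightarrow> 'w measure \<Rightarrow> ('w \<Rightarrow> 'a measure) \<Rightarrow> bool" where
  "simple_point_process E M X \<longleftrightarrow>
     point_process E M X \<and> (AE \<omega> in M. \<forall>x\<in>E. emeasure (X \<omega>) {x} \<le> 1)"

section \<open>Determinantal point processes\<close>

text \<open>
  The list in which each \<open>\<Delta> k\<close> is repeated \<open>n k\<close> times, in the order \<open>k = 0, \<dots>, r - 1\<close>; its entries
  are the factors of \<open>\<Delta>\<^sub>1\<^bsup>n\<^sub>1\<^esup> \<times> \<dots> \<times> \<Delta>\<^sub>r\<^bsup>n\<^sub>r\<^esup>\<close> (with indices shifted by one).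
\<close>

definition blocks :: "nat \<Rightarrow> (nat \<Rightarrow> 'a set) \<Rightarrow> (nat \<Rightarrow> nat) \<Rightarrow> 'a set list" where
  "blocks r \<Delta> n = concat (map (\<lambda>k. replicate (n k) (\<Delta> k)) [0..<r])"

definition block_product :: "nat \<Rightarrow> (nat \<Rightarrow> 'a set) \<Rightarrow> (nat \<Rightarrow> nat) \<Rightarrow> (nat \<Rightarrow> 'a) set" where
  "block_product r \<Delta> n = (\<Pi>\<^sub>E i \<in> {..<\<Sum>k<r. n k}. blocks r \<Delta> n ! i)"

definition kernel_det :: "('a \<Rightarrow> 'a \<Rightarrow> complex) \<Rightarrow> nat \<Rightarrow> (nat \<Rightarrow> 'a) \<Rightarrow> complex" where
  "kernel_det K l x = Determinant.det (Matrix.mat l l (\<lambda>(i, j). K (x i) (x j)))"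

definition factorial_count :: "nat \<Rightarrow> (nat \<Rightarrow> 'a set) \<Rightarrow> (nat \<Rightarrow> nat) \<Rightarrow> 'a measure \<Rightarrow> real" where
  "factorial_count r \<Delta> n \<xi> = (\<Prod>k<r. \<Prod>i<n k. measure \<xi> (\<Delta> k) - real i)"

text \<open>
  Both sides of the moment identity are required to be integrable, since the Bochner integral of a
  non-integrable function is \<open>0\<close> by convention.
\<close>

definition determinantal ::
    "'a::polish_space set \<Rightarrow> 'w measure \<Rightarrow> ('w \<Rightarrow> 'a measure) \<Rightarrow>
     ('a \<Rightarrow> 'a \<Rightarrow> complex) \<Rightarrow> 'a measure \<Rightarrow> bool" where
  "determinantal E M X K \<mu> \<longleftrightarrow>
     radon_on E \<mu> \<and>
     (\<lambda>(x, y). K x y) \<in> borel_measurable (restrict_space borel E \<Otimes>\<^sub>M restrict_space borel E) \<and>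
     simple_point_process E M X \<and>
     (\<forall>r \<Delta> n.
        r \<ge> 1 \<longrightarrow>
        (\<forall>k<r. \<Delta> k \<in> sets (restrict_space borel E) \<and> precompact_in E (\<Delta> k)) \<longrightarrow>
        disjoint_family_on \<Delta> {..<r} \<longrightarrow>
        (\<forall>k<r. n k \<ge> 1) \<longrightarrow>
        (let l = (\<Sum>k<r. n k); \<mu>l = (\<Pi>\<^sub>M i\<in>{..<l}. \<mu>) in
           integrable M (\<lambda>\<omega>. factorial_count r \<Delta> n (X \<omega>)) \<and>
           set_integrable \<mu>l (block_product r \<Delta> n) (kernel_det K l) \<and>
           complex_of_real (\<integral>\<omega>. factorial_count r \<Delta> n (X \<omega>) \<partial>M) =
             (LINT x : block_product r \<Delta> n | \<mu>l. kernel_det K l x)))"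

section \<open>Orthonormal polynomials on the unit disc\<close>

abbreviation unit_disc :: "complex set" where
  "unit_disc \<equiv> ball 0 1"

definition L2_inner :: "complex measure \<Rightarrow> complex poly \<Rightarrow> complex poly \<Rightarrow> complex" where
  "L2_inner \<mu> p q = (\<integral>z. poly p z * cnj (poly q z) \<partial>\<mu>)"

definition L2_norm :: "complex measure \<Rightarrow> complex poly \<Rightarrow> real" where
  "L2_norm \<mu> p = sqrt (\<integral>z. (cmod (poly p z))\<^sup>2 \<partial>\<mu>)"

fun gram_schmidt_poly :: "complex measure \<Rightarrow> nat \<Rightarrow> complex poly" where
  "gram_schmidt_poly \<mu> k =
     (let q = Polynomial.monom 1 k -
            (\<Sum>j<k. Polynomial.smult (L2_inner \<mu> (Polynomial.monom 1 k) (gram_schmidt_poly \<mu> j)) (gram_schmidt_poly \<mu> j))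
      in Polynomial.smult (complex_of_real (1 / L2_norm \<mu> q)) q)"

declare gram_schmidt_poly.simps [simp del]

definition hp_measure :: "nat \<Rightarrow> complex \<Rightarrow> complex measure" where
  "hp_measure m \<delta> =
     density (restrict_space lborel unit_disc)
       (\<lambda>z. ennreal ((cmod ((1 - z) powr \<delta>))\<^sup>2 * (1 - (cmod z)\<^sup>2) ^ (m - 1)))"

definition hp_kernel :: "nat \<Rightarrow> complex \<Rightarrow> nat \<Rightarrow> complex \<Rightarrow> complex \<Rightarrow> complex" where
  "hp_kernel m \<delta> n z w =
     (\<Sum>k<n. poly (gram_schmidt_poly (hp_measure m \<delta>) k) z *
             cnj (poly (gram_schmidt_poly (hp_measure m \<delta>) k) w))"

definition hp_limit_kernel :: "nat \<Rightarrow> complex \<Rightarrow> complex \<Rightarrow> complex \<Rightarrow> complex" where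
  "hp_limit_kernel m \<delta> z w = lim (\<lambda>n. hp_kernel m \<delta> n z w)"

section \<open>The weighted Bergman kernel\<close>

definition bergman_measure :: "nat \<Rightarrow> complex measure" where
  "bergman_measure m =
     density (restrict_space lborel unit_disc)
       (\<lambda>z. ennreal (real m / pi * (1 - (cmod z)\<^sup>2) ^ (m - 1)))"

definition bergman_kernel :: "nat \<Rightarrow> complex \<Rightarrow> complex \<Rightarrow> complex" where
  "bergman_kernel m z w = 1 / (1 - z * cnj w) ^ (m + 1)"

end

theory Submission
  imports Defs "HOL-Complex_Analysis.Complex_Analysis" "Jordan_Normal_Form.Schur_Decomposition"
begin

text \<open>
  Write \<open>g z = (1 - z) powr \<delta>\<close>. Multiplication by the zero-free holomorphic function \<open>g\<close> maps the
  holomorphic functions in \<open>L\<^sup>2\<close> of \<^term>\<open>hp_measure m \<delta>\<close> isometrically, up to the constant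
  \<open>pi / m\<close>, to the Bergman space, whose reproducing kernel is \<^term>\<open>bergman_kernel m\<close>. Hence the
  former space has the reproducing kernel \<open>(m / pi) * bergman_kernel m z w / (g z * cnj (g w))\<close>.
  The kernels \<^term>\<open>hp_kernel m \<delta> n\<close> are the reproducing kernels of the polynomials of degree less
  than \<open>n\<close>; they converge to it provided polynomials are dense
  (\<open>gram_schmidt_kernel_tendsto\<close>, \<open>hp_kernel_tendsto\<close>). Density is proved by dilation: \<open>f (r z)\<close>
  is a uniform limit of polynomials on the disc, and it tends to \<open>f\<close> because the quotient
  \<open>g z / g (r z)\<close> is dominated uniformly in \<open>r\<close> (\<open>weight_dilation_bound\<close>), the dominating function
  being square-integrable for \<open>Re \<delta> > -1/2\<close>. The reproducing property of the Bergman kernel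
  (\<open>bergman_reproducing\<close>) follows from the orthogonality of monomials, which is the invariance of
  Lebesgue measure under rotations, and from the computation of their norms.

  So the limiting kernel is the Bergman kernel up to a factor \<open>h z * cnj (h w)\<close>, and the reference
  measures differ by exactly the factor \<open>\<bar>h\<bar>\<^sup>2\<close> that compensates this in every correlation measure.
  The two notions of determinantal process therefore coincide (\<open>determinantal_gauge\<close>), and \<open>\<delta>\<close>
  has disappeared from the second one.

  Equality in distribution requires that a determinantal process is determined by its kernel
  (\<open>determinantal_law_unique\<close>). The moment identities give all mixed binomial moments of the numbers
  of points in disjoint precompact sets. Determinants of positive semidefinite matrices are bounded
  by a geometric sequence (\<open>psd_det_bound\<close>), so these numbers have exponential moments of all
  orders, and the probability of prescribed numbers is recovered from the moments by inclusion and
  exclusion (\<open>prob_eq_of_binomial_moments\<close>). Events prescribing the numbers of points in finitely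
  many precompact sets, which may overlap, reduce to disjoint atoms (\<open>law_eq_of_disjoint_counts\<close>),
  are closed under intersection and generate the \<open>\<sigma>\<close>-algebra.
\<close>

section \<open>Rotations of the plane\<close>

lemma nn_integral_lborel_complex:
  fixes f :: "complex \<Rightarrow> ennreal"
  assumes [measurable]: "f \<in> borel_measurable borel"
  shows "(\<integral>\<^sup>+z. f z \<partial>lborel) = (\<integral>\<^sup>+y. \<integral>\<^sup>+x. f (Complex x y) \<partial>lborel \<partial>lborel)"
proof -
  have meas [measurable]: "(\<lambda>p. Complex (fst p) (snd p)) \<in> borel_measurable (lborel \<Otimes>\<^sub>M lborel)"
    by (simp add: Complex_eq)
  have eq: "lborel = distr (lborel \<Otimes>\<^sub>M lborel) borel (\<lambda>p. Complex (fst p) (snd p))"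
  proof (rule lborel_eqI)
    fix l u :: complex
    assume le: "\<And>b. b \<in> Basis \<Longrightarrow> l \<bullet> b \<le> u \<bullet> b"
    have le': "Re l \<le> Re u" "Im l \<le> Im u"
      using le[of 1] le[of \<i>] by (auto simp: Basis_complex_def)
    have "(\<lambda>p. Complex (fst p) (snd p)) -` box l u \<inter> space (lborel \<Otimes>\<^sub>M lborel)
        = {Re l<..<Re u} \<times> {Im l<..<Im u}"
      by (auto simp: in_box_complex_iff space_pair_measure)
    then show "emeasure (distr (lborel \<Otimes>\<^sub>M lborel) borel (\<lambda>p. Complex (fst p) (snd p))) (box l u)
        = (\<Prod>b\<in>Basis. (u - l) \<bullet> b)"
      using le' by (simp add: emeasure_distr lborel.emeasure_pair_measure_Times Basis_complex_def
          ennreal_mult)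
  qed simp
  have "(\<integral>\<^sup>+z. f z \<partial>lborel) = (\<integral>\<^sup>+p. f (Complex (fst p) (snd p)) \<partial>(lborel \<Otimes>\<^sub>M lborel))"
    by (subst eq) (simp add: nn_integral_distr)
  also have "\<dots> = (\<integral>\<^sup>+y. \<integral>\<^sup>+x. f (Complex x y) \<partial>lborel \<partial>lborel)"
    by (subst lborel_pair.nn_integral_snd[symmetric]) (simp_all add: Complex_eq case_prod_unfold)
  finally show ?thesis .
qed

lemma nn_integral_lborel_complex':
  fixes f :: "complex \<Rightarrow> ennreal"
  assumes [measurable]: "f \<in> borel_measurable borel"
  shows "(\<integral>\<^sup>+z. f z \<partial>lborel) = (\<integral>\<^sup>+x. \<integral>\<^sup>+y. f (Complex x y) \<partial>lborel \<partial>lborel)"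
  unfolding nn_integral_lborel_complex[OF assms]
  by (rule lborel_pair.Fubini') (simp add: Complex_eq case_prod_unfold)

lemma nn_integral_lborel_translate:
  fixes f :: "real \<Rightarrow> ennreal"
  assumes [measurable]: "f \<in> borel_measurable borel"
  shows "(\<integral>\<^sup>+x. f (x + t) \<partial>lborel) = (\<integral>\<^sup>+x. f x \<partial>lborel)"
  using nn_integral_real_affine[of f 1 t] by (simp add: add.commute)

lemma nn_integral_shear_Re:
  fixes f :: "complex \<Rightarrow> ennreal"
  assumes [measurable]: "f \<in> borel_measurable borel"
  shows "(\<integral>\<^sup>+z. f (z + of_real (a * Im z)) \<partial>lborel) = (\<integral>\<^sup>+z. f z \<partial>lborel)"
proof -
  have *: "Complex x y + of_real (a * y) = Complex (x + a * y) y" for x y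
    by (simp add: complex_eq_iff)
  have tr: "(\<integral>\<^sup>+x. f (Complex (x + a * y) y) \<partial>lborel) = (\<integral>\<^sup>+x. f (Complex x y) \<partial>lborel)" for y
    by (rule nn_integral_lborel_translate) (simp add: Complex_eq)
  show ?thesis
    by (subst (1 2) nn_integral_lborel_complex) (simp_all add: * tr del: of_real_mult)
qed

lemma nn_integral_shear_Im:
  fixes f :: "complex \<Rightarrow> ennreal"
  assumes [measurable]: "f \<in> borel_measurable borel"
  shows "(\<integral>\<^sup>+z. f (z + \<i> * of_real (a * Re z)) \<partial>lborel) = (\<integral>\<^sup>+z. f z \<partial>lborel)"
proof -
  have *: "Complex x y + \<i> * of_real (a * x) = Complex x (y + a * x)" for x y
    by (simp add: complex_eq_iff)
  have tr: "(\<integral>\<^sup>+y. f (Complex x (y + a * x)) \<partial>lborel) = (\<integral>\<^sup>+y. f (Complex x y) \<partial>lborel)" for x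
    by (rule nn_integral_lborel_translate) (simp add: Complex_eq)
  show ?thesis
    by (subst (1 2) nn_integral_lborel_complex') (simp_all add: * tr del: of_real_mult)
qed

text \<open>Fubini and translation invariance on lines show that shears preserve Lebesgue measure, and every
  rotation other than \<open>z \<mapsto> - z\<close> is a product of three shears.\<close>

lemma nn_integral_rotate:
  fixes f :: "complex \<Rightarrow> ennreal" and u :: complex
  assumes [measurable]: "f \<in> borel_measurable borel" and u: "cmod u = 1" "u \<noteq> -1"
  shows "(\<integral>\<^sup>+z. f (u * z) \<partial>lborel) = (\<integral>\<^sup>+z. f z \<partial>lborel)"
proof -
  \<comment> \<open>The shear parameter is \<open>- tan (\<theta> / 2)\<close> for the angle \<open>\<theta>\<close> of \<open>u\<close>.\<close>
  define t where "t = - Im u / (1 + Re u)"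
  have sq: "(Re u)\<^sup>2 + (Im u)\<^sup>2 = 1"
    using u(1) by (simp add: cmod_def)
  have pos: "1 + Re u \<noteq> 0"
  proof
    assume "1 + Re u = 0"
    then have "Re u = -1" by simp
    with sq have "Im u = 0" by simp
    with \<open>Re u = -1\<close> have "u = -1" by (simp add: complex_eq_iff)
    with u show False by simp
  qed
  have t1: "t * Im u = Re u - 1"
    unfolding t_def using pos sq by (simp add: field_simps power2_eq_square)
  have t2: "t * (1 + Re u) = - Im u"
    unfolding t_def using pos by simp
  define S where "S a z = z + of_real (a * Im z)" for a and z :: complex
  define R where "R a z = z + \<i> * of_real (a * Re z)" for a and z :: complex
  have dec: "u * z = S t (R (Im u) (S t z))" for z
  proof -
    have "t * Im u * (t * Im z) = (Re u - 1) * (t * Im z)" using t1 by simp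
    moreover have "t * Im z + t * Im z + (Re u - 1) * (t * Im z) = - Im u * Im z"
      using t2 by (simp add: algebra_simps) (metis distrib_left mult.assoc mult.commute minus_mult_left mult.right_neutral)
    moreover have "t * Im u * Re z = (Re u - 1) * Re z" and "Im u * t * Im z = (Re u - 1) * Im z"
      using t1 by (simp_all add: mult.commute)
    ultimately show ?thesis
      by (simp add: complex_eq_iff S_def R_def algebra_simps)
  qed
  have [measurable]: "S a \<in> borel_measurable borel" "R a \<in> borel_measurable borel" for a
    by (simp_all add: S_def[abs_def] R_def[abs_def])
  have "(\<integral>\<^sup>+z. f (u * z) \<partial>lborel) = (\<integral>\<^sup>+z. f (S t (R (Im u) (S t z))) \<partial>lborel)"
    by (simp add: dec)
  also have "\<dots> = (\<integral>\<^sup>+z. f (S t (R (Im u) z)) \<partial>lborel)"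
    using nn_integral_shear_Re[of "\<lambda>z. f (S t (R (Im u) z))" t] by (simp add: S_def)
  also have "\<dots> = (\<integral>\<^sup>+z. f (S t z) \<partial>lborel)"
    using nn_integral_shear_Im[of "\<lambda>z. f (S t z)" "Im u"] by (simp add: R_def)
  also have "\<dots> = (\<integral>\<^sup>+z. f z \<partial>lborel)"
    using nn_integral_shear_Re[of f t] by (simp add: S_def)
  finally show ?thesis .
qed

lemma distr_lborel_rotate:
  fixes u :: complex
  assumes u: "cmod u = 1" "u \<noteq> -1"
  shows "distr lborel borel ((*) u) = lborel"
proof (rule measure_eqI)
  fix A assume A: "A \<in> sets (distr lborel borel ((*) u))"
  then have [measurable]: "A \<in> sets borel" by simp
  have "emeasure (distr lborel borel ((*) u)) A = (\<integral>\<^sup>+z. indicator A z \<partial>distr lborel borel ((*) u))"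
    by simp
  also have "\<dots> = (\<integral>\<^sup>+z. indicator A (u * z) \<partial>lborel)"
    by (rule nn_integral_distr) simp_all
  also have "\<dots> = (\<integral>\<^sup>+z. indicator A z \<partial>lborel)"
    using u by (intro nn_integral_rotate) simp_all
  finally show "emeasure (distr lborel borel ((*) u)) A = emeasure lborel A" by simp
qed simp

section \<open>Monomials in the weighted Bergman space\<close>

lemma integral_rotate:
  fixes f :: "complex \<Rightarrow> complex"
  assumes [measurable]: "f \<in> borel_measurable borel" and u: "cmod u = 1" "u \<noteq> -1"
  shows "(\<integral>z. f (u * z) \<partial>lborel) = (\<integral>z. f z \<partial>lborel)"
proof -
  have "(\<integral>z. f z \<partial>lborel) = (\<integral>z. f z \<partial>distr lborel borel ((*) u))"
    by (simp add: distr_lborel_rotate u)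
  also have "\<dots> = (\<integral>z. f (u * z) \<partial>lborel)"
    by (rule integral_distr) simp_all
  finally show ?thesis by simp
qed

text \<open>The rotation \<open>z \<mapsto> u z\<close> preserves the integral, but multiplies the integrand by \<open>u\<^bsup>j - k\<^esup>\<close>.\<close>

lemma integral_monomials_radial_eq_0:
  fixes \<phi> :: "real \<Rightarrow> real"
  assumes [measurable]: "\<phi> \<in> borel_measurable borel" and "j \<noteq> k"
  shows "(\<integral>z. \<phi> (cmod z) *\<^sub>R (z ^ j * cnj z ^ k) \<partial>lborel) = 0"
proof -
  define n where "n = (if j < k then k - j else j - k)"
  have n: "n \<ge> 1" using \<open>j \<noteq> k\<close> by (auto simp: n_def)
  \<comment> \<open>With \<open>n = \<bar>j - k\<bar>\<close> this gives \<open>u ^ n = \<i>\<close>, hence a factor different from 1 and also \<open>u \<noteq> -1\<close>.\<close>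
  define u where "u = cis (pi / (2 * real n))"
  have u1: "cmod u = 1" by (simp add: u_def)
  have un: "u ^ n = \<i>"
  proof -
    have "real n * (pi / (2 * real n)) = pi / 2" using n by simp
    then show ?thesis unfolding u_def Complex.DeMoivre by (simp only: cis_pi_half)
  qed
  have uu: "u * cnj u = 1"
    using u1 by (simp add: complex_norm_square[symmetric])
  have u2: "u \<noteq> -1"
  proof
    assume "u = -1"
    then have "\<i> = (-1) ^ n" using un by simp
    then show False by (cases "even n") (simp_all add: complex_eq_iff)
  qed
  have q: "u ^ j * cnj u ^ k \<noteq> 1"
  proof (cases "j < k")
    case True
    then have "k = j + n" by (simp add: n_def)
    then have "u ^ j * cnj u ^ k = (u * cnj u) ^ j * cnj (u ^ n)"
      by (simp add: power_add power_mult_distrib algebra_simps)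
    then show ?thesis by (simp add: un uu complex_eq_iff)
  next
    case False
    then have "j = k + n" using \<open>j \<noteq> k\<close> by (simp add: n_def)
    then have "u ^ j * cnj u ^ k = (u * cnj u) ^ k * u ^ n"
      by (simp add: power_add power_mult_distrib algebra_simps)
    then show ?thesis by (simp add: un uu complex_eq_iff)
  qed
  define F where "F z = \<phi> (cmod z) *\<^sub>R (z ^ j * cnj z ^ k)" for z
  have F: "F (u * z) = (u ^ j * cnj u ^ k) * F z" for z
    by (simp add: F_def norm_mult u1 power_mult_distrib scaleR_conv_of_real algebra_simps)
  have [measurable]: "cnj \<in> borel_measurable borel"
    by (intro borel_measurable_continuous_onI continuous_intros)
  have [measurable]: "F \<in> borel_measurable borel"
    unfolding F_def[abs_def] by simp
  have "(\<integral>z. F z \<partial>lborel) = (\<integral>z. F (u * z) \<partial>lborel)"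
    by (rule integral_rotate[symmetric]) (simp_all add: u1 u2)
  also have "\<dots> = (u ^ j * cnj u ^ k) * (\<integral>z. F z \<partial>lborel)"
    by (simp add: F)
  finally have "(1 - u ^ j * cnj u ^ k) * (\<integral>z. F z \<partial>lborel) = 0"
    by (simp add: algebra_simps)
  then show ?thesis using q by (simp add: F_def)
qed

lemma integral_beta:
  "((\<lambda>t::real. t ^ k * (1 - t) ^ m) has_integral
     (1 / (real (m + k + 1) * real ((m + k) choose k)))) {0..1}"
proof (induction k arbitrary: m)
  case 0
  have "((\<lambda>t::real. (1 - t) ^ m) has_integral
      (- 1 / real (Suc m) * (1 - 1) ^ Suc m - (- 1 / real (Suc m) * (1 - 0) ^ Suc m))) {0..1}"
  proof (rule fundamental_theorem_of_calculus)
    fix x :: real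
    have "((\<lambda>t. 1 - t) has_real_derivative -1) (at x within {0..1})"
      by (auto intro!: derivative_eq_intros)
    then have "((\<lambda>t. - 1 / real (Suc m) * (1 - t) ^ Suc m) has_real_derivative
        - 1 / real (Suc m) * ((1 + real m) * (- 1 * (1 - x) ^ m))) (at x within {0..1})"
      by (intro DERIV_cmult DERIV_power_Suc)
    also have "- 1 / real (Suc m) * ((1 + real m) * (- 1 * (1 - x) ^ m)) = (1 - x) ^ m"
      unfolding of_nat_Suc[symmetric] by (simp del: of_nat_Suc)
    finally show "((\<lambda>t. - 1 / real (Suc m) * (1 - t) ^ Suc m) has_vector_derivative (1 - x) ^ m) (at x within {0..1})"
      unfolding has_real_derivative_iff_has_vector_derivative .
  qed simp
  then show ?case by simp
next
  case (Suc k)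
  \<comment> \<open>Integration by parts lowers the exponent of \<open>t\<close> and raises that of \<open>1 - t\<close>.\<close>
  have "((\<lambda>t::real. real (Suc k) * (t ^ k * (1 - t) ^ Suc m) - real (Suc m) * (t ^ Suc k * (1 - t) ^ m))
      has_integral (1 ^ Suc k * (1 - 1) ^ Suc m - 0 ^ Suc k * (1 - 0) ^ Suc m)) {0..1}"
  proof (rule fundamental_theorem_of_calculus)
    fix x :: real
    have "((\<lambda>t. 1 - t) has_real_derivative -1) (at x within {0..1})"
      by (auto intro!: derivative_eq_intros)
    then have "((\<lambda>t. t ^ Suc k * (1 - t) ^ Suc m) has_real_derivative
        (1 + real k) * (1 * x ^ k) * (1 - x) ^ Suc m + (1 + real m) * (- 1 * (1 - x) ^ m) * x ^ Suc k)
        (at x within {0..1})"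
      by (intro DERIV_mult DERIV_power_Suc DERIV_ident)
    also have "(1 + real k) * (1 * x ^ k) * (1 - x) ^ Suc m + (1 + real m) * (- 1 * (1 - x) ^ m) * x ^ Suc k =
        real (Suc k) * (x ^ k * (1 - x) ^ Suc m) - real (Suc m) * (x ^ Suc k * (1 - x) ^ m)"
      by (simp add: algebra_simps)
    finally show "((\<lambda>t. t ^ Suc k * (1 - t) ^ Suc m) has_vector_derivative
        real (Suc k) * (x ^ k * (1 - x) ^ Suc m) - real (Suc m) * (x ^ Suc k * (1 - x) ^ m)) (at x within {0..1})"
      unfolding has_real_derivative_iff_has_vector_derivative .
  qed simp
  then have "((\<lambda>t::real. real (Suc k) * (t ^ k * (1 - t) ^ Suc m) - real (Suc m) * (t ^ Suc k * (1 - t) ^ m))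
      has_integral 0) {0..1}" by simp
  from has_integral_diff[OF has_integral_mult_right[OF Suc.IH[of "Suc m"], of "real (Suc k)"] this]
  have "((\<lambda>t::real. real (Suc m) * (t ^ Suc k * (1 - t) ^ m)) has_integral
      (real (Suc k) * (1 / (real (Suc m + k + 1) * real (Suc m + k choose k))))) {0..1}"
    by simp
  from has_integral_mult_right[OF this, of "1 / real (Suc m)"]
  have *: "((\<lambda>t::real. t ^ Suc k * (1 - t) ^ m) has_integral
      (1 / real (Suc m) * (real (Suc k) * (1 / (real (Suc m + k + 1) * real (Suc m + k choose k)))))) {0..1}"
    by (simp add: mult.assoc[symmetric] del: of_nat_Suc power_Suc)
  have "Suc k * (Suc m + k choose Suc k) = Suc m * (Suc m + k choose k)"
  proof -
    have "Suc k * (Suc m + k choose Suc k) = (Suc m + k) * (m + k choose k)"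
      using Suc_times_binomial[of k "m + k"] by simp
    also have "\<dots> = Suc m * (Suc m + k choose k)"
      using binomial_absorb_comp[of "Suc m + k" k] by simp
    finally show ?thesis .
  qed
  then have "real (Suc k) * real (Suc m + k choose Suc k) = real (Suc m) * real (Suc m + k choose k)"
    by (metis of_nat_mult)
  then have "1 / real (Suc m) * (real (Suc k) * (1 / (real (Suc m + k + 1) * real (Suc m + k choose k))))
     = 1 / (real (m + Suc k + 1) * real ((m + Suc k) choose Suc k))"
    by (simp add: divide_simps del: of_nat_Suc binomial_Suc_Suc)
  with * show ?case by simp
qed

lemma emeasure_annulus:
  assumes "0 \<le> x" "x \<le> 1"
  shows "emeasure lborel {z. x < (cmod z)\<^sup>2 \<and> cmod z < 1} = ennreal (pi * (1 - x))"
proof -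
  have sub: "cball 0 (sqrt x) \<inter> ball 0 1 \<in> sets borel" "ball (0::complex) 1 \<in> sets borel" by auto
  have *: "x < (cmod z)\<^sup>2 \<longleftrightarrow> \<not> cmod z \<le> sqrt x" for z
    using assms using real_sqrt_le_iff[of "(cmod z)\<^sup>2" x] by (simp add: not_le)
  have eq: "{z. x < (cmod z)\<^sup>2 \<and> cmod z < 1} = ball 0 1 - cball 0 (sqrt x) \<inter> ball 0 1"
    by (auto simp: *)
  have e1: "emeasure lborel (ball (0::complex) 1) = ennreal pi"
    by (simp add: emeasure_ball unit_ball_vol_2)
  have e2: "emeasure lborel (cball 0 (sqrt x) \<inter> ball (0::complex) 1) = ennreal (pi * x)"
  proof (cases "x = 1")
    case True
    then have "cball 0 (sqrt x) \<inter> ball (0::complex) 1 = ball 0 1" by auto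
    then show ?thesis using e1 True by simp
  next
    case False
    then have "sqrt x < 1" using assms by simp
    then have "cball 0 (sqrt x) \<inter> ball (0::complex) 1 = cball 0 (sqrt x)"
      by (intro Int_absorb2 subsetI) (simp add: le_less_trans[OF _ \<open>sqrt x < 1\<close>])
    then show ?thesis using assms by (simp add: emeasure_cball unit_ball_vol_2 mult.commute)
  qed
  have "emeasure lborel {z. x < (cmod z)\<^sup>2 \<and> cmod z < 1} = ennreal pi - ennreal (pi * x)"
    unfolding eq using sub by (subst emeasure_Diff) (auto simp: e1 e2)
  also have "\<dots> = ennreal (pi * (1 - x))"
    using assms by (simp add: ennreal_minus algebra_simps)
  finally show ?thesis .
qed

text \<open>A disc of radius \<open>sqrt x\<close> has area \<open>pi * x\<close>, so \<open>\<bar>z\<bar>\<^sup>2\<close> is uniformly distributed. This reduces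
  integrals of radial functions to integrals over \<open>[0, 1]\<close>.\<close>

lemma distr_norm_sq_disc:
  "distr (restrict_space lborel (ball (0::complex) 1)) borel (\<lambda>z. (cmod z)\<^sup>2) =
   density lborel (\<lambda>t. ennreal pi * indicator {0..1} t)"
    (is "?M = ?N")
proof (rule measure_eqI_lessThan)
  show eq: "emeasure ?M {x<..} = emeasure ?N {x<..}" for x
  proof -
    have "emeasure ?M {x<..} = emeasure lborel {z. x < (cmod z)\<^sup>2 \<and> cmod z < 1}"
      by (subst emeasure_distr)
         (auto simp: space_restrict_space emeasure_restrict_space intro!: measurable_restrict_space1 arg_cong[where f = "emeasure lborel"])
    also have "\<dots> = ennreal (pi * (1 - max 0 x)) "
    proof -
      consider "x < 0" | "0 \<le> x" "x \<le> 1" | "x > 1" by linarith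
      then show ?thesis
      proof cases
        case 1
        then have "x < (cmod z)\<^sup>2" for z
          by (meson less_le_trans zero_le_power2)
        then have "{z. x < (cmod z)\<^sup>2 \<and> cmod z < 1} = ball 0 1" by auto
        then show ?thesis using 1 by (simp add: emeasure_ball unit_ball_vol_2)
      next
        case 2 then show ?thesis using emeasure_annulus[of x] by simp
      next
        case 3
        have "\<not> (x < (cmod z)\<^sup>2 \<and> cmod z < 1)" for z
          using 3 power_le_one[of "cmod z" 2] by (auto simp: not_less)
        then have "{z. x < (cmod z)\<^sup>2 \<and> cmod z < 1} = {}" by blast
        then have "emeasure lborel {z. x < (cmod z)\<^sup>2 \<and> cmod z < 1} = 0" by (simp only: emeasure_empty)
        moreover have "pi * (1 - max 0 x) \<le> 0" using 3 by (simp add: mult_le_0_iff)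
        ultimately show ?thesis by (simp add: ennreal_neg)
      qed
    qed
    also have "\<dots> = emeasure ?N {x<..}"
    proof -
      have "emeasure ?N {x<..} = (\<integral>\<^sup>+t. ennreal pi * indicator ({0..1} \<inter> {x<..}) t \<partial>lborel)"
        by (subst emeasure_density) (auto simp: mult.assoc indicator_inter_arith)
      also have "\<dots> = ennreal pi * emeasure lborel ({0..1} \<inter> {x<..})"
        by (simp add: nn_integral_cmult_indicator)
      also have "emeasure lborel ({0..1} \<inter> {x<..}) = ennreal (1 - max 0 x)"
      proof (cases "x < 0")
        case True
        then have "{0..1} \<inter> {x<..} = {0..1}" by auto
        then show ?thesis using True by simp
      next
        case False
        then have "{0..1} \<inter> {x<..} = {x<..1}" by auto
        then show ?thesis using False
          by (cases "x \<le> 1") (simp_all add: ennreal_neg)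
      qed
      finally show ?thesis by (simp add: ennreal_mult')
    qed
    finally show ?thesis .
  qed
  show "emeasure ?M {x<..} < \<infinity>" for x
  proof -
    have "emeasure ?N {x<..} \<le> (\<integral>\<^sup>+t. ennreal pi * indicator {0..1::real} t \<partial>lborel)"
      by (subst emeasure_density) (auto intro!: nn_integral_mono simp: indicator_def)
    also have "\<dots> < \<infinity>" by (simp add: nn_integral_cmult_indicator ennreal_mult_less_top)
    finally show ?thesis by (simp add: eq)
  qed
qed simp_all

lemma nn_integral_disc_radial:
  assumes [measurable]: "f \<in> borel_measurable borel"
  shows "(\<integral>\<^sup>+z. f ((cmod z)\<^sup>2) \<partial>restrict_space lborel (ball 0 1)) =
    ennreal pi * (\<integral>\<^sup>+t. f t * indicator {0..1} t \<partial>lborel)"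
proof -
  have "(\<integral>\<^sup>+z. f ((cmod z)\<^sup>2) \<partial>restrict_space lborel (ball 0 1)) =
      (\<integral>\<^sup>+t. f t \<partial>distr (restrict_space lborel (ball (0::complex) 1)) borel (\<lambda>z. (cmod z)\<^sup>2))"
    by (subst nn_integral_distr) (auto intro!: measurable_restrict_space1)
  also have "\<dots> = (\<integral>\<^sup>+t. ennreal pi * (f t * indicator {0..1} t) \<partial>lborel)"
    unfolding distr_norm_sq_disc by (subst nn_integral_density) (auto simp: ac_simps)
  also have "\<dots> = ennreal pi * (\<integral>\<^sup>+t. f t * indicator {0..1} t \<partial>lborel)"
    by (rule nn_integral_cmult) simp
  finally show ?thesis .
qed

lemma sets_bergman_measure [measurable_cong]:
  "sets (bergman_measure m) = sets (restrict_space borel unit_disc)"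
  by (simp add: bergman_measure_def sets_restrict_space)

lemma space_bergman_measure [simp]: "space (bergman_measure m) = unit_disc"
  by (simp add: bergman_measure_def space_restrict_space)

lemma bergman_density_measurable [measurable]:
  "(\<lambda>z. ennreal (real m / pi * (1 - (cmod z)\<^sup>2) ^ (m - 1)))
     \<in> borel_measurable (restrict_space lborel unit_disc)"
  by (intro measurable_restrict_space1) simp

text \<open>The reciprocal of the squared norm of \<open>z\<^sup>k\<close> is the coefficient of \<open>x\<^sup>k\<close> in \<open>(1 - x)\<^bsup>-(m+1)\<^esup>\<close>; this is
  what makes \<^const>\<open>bergman_kernel\<close> the reproducing kernel.\<close>

lemma nn_integral_bergman_monomial:
  assumes "m \<ge> 1"
  shows "(\<integral>\<^sup>+z. ennreal (cmod z ^ (2 * k)) \<partial>bergman_measure m) = ennreal (1 / real ((m + k) choose k))"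
proof -
  obtain n where m: "m = Suc n" using assms by (cases m) auto
  have "(\<integral>\<^sup>+z. ennreal (cmod z ^ (2 * k)) \<partial>bergman_measure m) =
      (\<integral>\<^sup>+z. ennreal (real m / pi * (1 - (cmod z)\<^sup>2) ^ (m - 1)) * ennreal (cmod z ^ (2 * k))
        \<partial>restrict_space lborel unit_disc)"
    unfolding bergman_measure_def
    by (subst nn_integral_density) (auto intro!: measurable_restrict_space1)
  also have "\<dots> = (\<integral>\<^sup>+z. (\<lambda>t. ennreal (real m / pi * (t ^ k * (1 - t) ^ n))) ((cmod z)\<^sup>2)
        \<partial>restrict_space lborel unit_disc)"
  proof (intro nn_integral_cong)
    fix z :: complex assume "z \<in> space (restrict_space lborel unit_disc)"
    then have "(cmod z)\<^sup>2 \<le> 1" by (simp add: space_restrict_space power_le_one)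
    then show "ennreal (real m / pi * (1 - (cmod z)\<^sup>2) ^ (m - 1)) * ennreal (cmod z ^ (2 * k)) =
        (\<lambda>t. ennreal (real m / pi * (t ^ k * (1 - t) ^ n))) ((cmod z)\<^sup>2)"
      by (subst ennreal_mult'[symmetric], simp, unfold power_mult m) (simp add: mult_ac)
  qed
  also have "\<dots> = ennreal pi * (\<integral>\<^sup>+t. ennreal (real m / pi * (t ^ k * (1 - t) ^ n)) * indicator {0..1} t \<partial>lborel)"
    by (rule nn_integral_disc_radial) simp
  also have "(\<integral>\<^sup>+t. ennreal (real m / pi * (t ^ k * (1 - t) ^ n)) * indicator {0..1} t \<partial>lborel) =
      ennreal (real m / pi * (1 / (real (n + k + 1) * real ((n + k) choose k))))"
    by (rule nn_integral_has_integral_lebesgue')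
       (use has_integral_mult_right[OF integral_beta[of k n], of "real m / pi"] in auto)
  also have "ennreal pi * \<dots> = ennreal (real m / (real (n + k + 1) * real ((n + k) choose k)))"
    by (subst ennreal_mult'[symmetric]) simp_all
  also have "real m / (real (n + k + 1) * real ((n + k) choose k)) = 1 / real ((m + k) choose k)"
  proof -
    have "Suc (n + k) * (n + k choose k) = Suc n * (Suc (n + k) choose k)"
      using binomial_absorb_comp[of "Suc (n + k)" k] by simp
    then have "real (n + k + 1) * real (n + k choose k) = real m * real (m + k choose k)"
      unfolding m by (metis Suc_eq_plus1 add_Suc of_nat_mult)
    then show ?thesis using assms by (simp add: divide_simps)
  qed
  finally show ?thesis .
qed

lemma prob_space_bergman_measure: "m \<ge> 1 \<Longrightarrow> prob_space (bergman_measure m)"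
  using nn_integral_bergman_monomial[of m 0] by (intro prob_spaceI) simp

lemma measurable_bergman:
  "f \<in> borel_measurable borel \<Longrightarrow> f \<in> borel_measurable (bergman_measure m)"
  by (subst measurable_cong_sets[OF sets_bergman_measure refl]) (rule measurable_restrict_space1)

lemma borel_measurable_bergman_continuous:
  "continuous_on unit_disc f \<Longrightarrow> f \<in> borel_measurable (bergman_measure m)"
  by (subst measurable_cong_sets[OF sets_bergman_measure refl])
     (rule borel_measurable_continuous_on_restrict)

lemma integral_bergman:
  fixes f :: "complex \<Rightarrow> 'a::{banach, second_countable_topology}"
  assumes "f \<in> borel_measurable (bergman_measure m)"
  shows "(\<integral>z. f z \<partial>bergman_measure m) =
    (\<integral>z. indicator unit_disc z *\<^sub>R ((real m / pi * (1 - (cmod z)\<^sup>2) ^ (m - 1)) *\<^sub>R f z) \<partial>lborel)"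
proof -
  have f: "f \<in> borel_measurable (restrict_space lborel unit_disc)"
    using assms by (simp add: measurable_def sets_bergman_measure sets_restrict_space space_restrict_space bergman_measure_def)
  show ?thesis
    unfolding bergman_measure_def
    by (subst integral_density)
       (auto intro!: f measurable_restrict_space1 simp: integral_restrict_space space_restrict_space
          power_le_one AE_restrict_space_iff)
qed

lemma integral_bergman_monomials_eq_0:
  assumes "j \<noteq> k"
  shows "(\<integral>z. indicator (cball 0 r) z *\<^sub>R (z ^ j * cnj z ^ k) \<partial>bergman_measure m) = 0"
proof -
  have [measurable]: "cnj \<in> borel_measurable borel"
    by (intro borel_measurable_continuous_onI continuous_intros)
  define \<phi> where "\<phi> t = (if t < 1 \<and> t \<le> r then real m / pi * (1 - t\<^sup>2) ^ (m - 1) else 0)" for t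
  have [measurable]: "\<phi> \<in> borel_measurable borel"
    unfolding \<phi>_def[abs_def] by simp
  have "(\<integral>z. indicator (cball 0 r) z *\<^sub>R (z ^ j * cnj z ^ k) \<partial>bergman_measure m) =
      (\<integral>z. \<phi> (cmod z) *\<^sub>R (z ^ j * cnj z ^ k) \<partial>lborel)"
    by (subst integral_bergman, rule measurable_bergman, measurable)
       (auto intro!: Bochner_Integration.integral_cong simp: \<phi>_def indicator_def)
  then show ?thesis
    using integral_monomials_radial_eq_0[of \<phi> j k] assms by simp
qed

lemma integrable_bergman_bounded:
  fixes f :: "complex \<Rightarrow> 'a::{banach, second_countable_topology}"
  assumes "m \<ge> 1" "f \<in> borel_measurable (bergman_measure m)"
    and "\<And>z. z \<in> unit_disc \<Longrightarrow> norm (f z) \<le> B"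
  shows "integrable (bergman_measure m) f"
proof -
  interpret prob_space "bergman_measure m" by (rule prob_space_bergman_measure) fact
  show ?thesis
    using assms by (intro integrable_const_bound[where B = B] AE_I2) auto
qed

lemma integral_bergman_monomial:
  assumes "m \<ge> 1"
  shows "(\<integral>z. z ^ k * cnj z ^ k \<partial>bergman_measure m) = 1 / of_nat ((m + k) choose k)"
proof -
  have eq: "z ^ k * cnj z ^ k = of_real (cmod z ^ (2 * k))" for z
    by (simp add: power_mult power_mult_distrib[symmetric] complex_norm_square[symmetric])
  have "(\<integral>z. cmod z ^ (2 * k) \<partial>bergman_measure m) = 1 / real ((m + k) choose k)"
    using nn_integral_bergman_monomial[OF assms, of k]
    by (intro integral_eq_nn_integral[THEN trans] measurable_bergman) auto
  then have "(\<integral>z. complex_of_real (cmod z ^ (2 * k)) \<partial>bergman_measure m) =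
      of_real (1 / real ((m + k) choose k))"
    by (simp only: integral_complex_of_real)
  then show ?thesis by (simp only: eq) simp
qed

lemma integral_bergman_exhaust:
  fixes g :: "complex \<Rightarrow> complex"
  assumes g: "integrable (bergman_measure m) g" and \<rho>: "\<rho> \<longlonglongrightarrow> 1"
  shows "(\<lambda>n. \<integral>z. indicator (cball 0 (\<rho> n)) z *\<^sub>R g z \<partial>bergman_measure m)
    \<longlonglongrightarrow> integral\<^sup>L (bergman_measure m) g"
proof (rule integral_dominated_convergence[where w = "\<lambda>z. norm (g z)"])
  show "AE z in bergman_measure m. (\<lambda>n. indicator (cball 0 (\<rho> n)) z *\<^sub>R g z) \<longlonglongrightarrow> g z"
  proof (intro AE_I2)
    fix z assume "z \<in> space (bergman_measure m)"
    then have "cmod z < 1" by simp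
    then have "eventually (\<lambda>n. cmod z < \<rho> n) sequentially"
      using \<rho> by (simp add: order_tendstoD)
    then have "eventually (\<lambda>n. indicator (cball 0 (\<rho> n)) z *\<^sub>R g z = g z) sequentially"
      by eventually_elim (simp add: indicator_def)
    then show "(\<lambda>n. indicator (cball 0 (\<rho> n)) z *\<^sub>R g z) \<longlonglongrightarrow> g z"
      by (rule tendsto_eventually)
  qed
  show "integrable (bergman_measure m) (\<lambda>z. norm (g z))"
    using g by (rule integrable_norm)
  show g': "g \<in> borel_measurable (bergman_measure m)"
    using g by (rule borel_measurable_integrable)
  show "(\<lambda>z. indicator (cball 0 (\<rho> n)) z *\<^sub>R g z) \<in> borel_measurable (bergman_measure m)" for n
    by (intro borel_measurable_scaleR g' measurable_bergman borel_measurable_indicator) simp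
  show "AE z in bergman_measure m. norm (indicator (cball 0 (\<rho> n)) z *\<^sub>R g z) \<le> norm (g z)" for n
    by (intro AE_I2) (simp add: indicator_def)
qed

lemma integral_bergman_truncated_power_series:
  assumes m: "m \<ge> 1" and f: "\<And>z. z \<in> unit_disc \<Longrightarrow> (\<lambda>j. a j * z ^ j) sums f z"
    and r: "0 < r" "r < 1"
  shows "(\<integral>z. indicator (cball 0 r) z *\<^sub>R (f z * cnj z ^ k) \<partial>bergman_measure m) =
    a k * (\<integral>z. indicator (cball 0 r) z *\<^sub>R (z ^ k * cnj z ^ k) \<partial>bergman_measure m)"
proof -
  interpret prob_space "bergman_measure m" by (rule prob_space_bergman_measure) fact
  have [measurable]: "cnj \<in> borel_measurable borel"
    by (intro borel_measurable_continuous_onI continuous_intros)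
  define F where "F j z = a j * (indicator (cball 0 r) z *\<^sub>R (z ^ j * cnj z ^ k))" for j z
  have Fb: "norm (F j z) \<le> cmod (a j) * r ^ j" if "z \<in> unit_disc" for j z
  proof -
    have "cmod z ^ j * cmod z ^ k \<le> r ^ j * 1 ^ k" if "cmod z \<le> r"
      using that \<open>z \<in> unit_disc\<close> r by (intro mult_mono power_mono) auto
    then show ?thesis using r
      by (auto simp: F_def indicator_def norm_mult norm_power intro!: mult_left_mono)
  qed
  have Fm: "F j \<in> borel_measurable (bergman_measure m)" for j
    unfolding F_def[abs_def]
    by (intro measurable_bergman borel_measurable_times borel_measurable_scaleR borel_measurable_indicator
        borel_measurable_const borel_measurable_continuous_onI continuous_intros) simp
  have Fi: "integrable (bergman_measure m) (F j)" for j
    by (rule integrable_bergman_bounded[OF m Fm Fb])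
  obtain s where s: "r < s" "s < 1" using r dense by blast
  have "summable (\<lambda>j. a j * (of_real s) ^ j)"
    using f[of "of_real s"] s r by (auto simp: sums_iff)
  then have "summable (\<lambda>j. norm (a j * (of_real r) ^ j))"
    by (rule powser_insidea) (use s r in auto)
  then have sm: "summable (\<lambda>j. cmod (a j) * r ^ j)"
    using r by (simp add: norm_mult norm_power)
  have "(\<lambda>j. integral\<^sup>L (bergman_measure m) (F j)) sums (\<integral>z. (\<Sum>j. F j z) \<partial>bergman_measure m)"
  proof (rule sums_integral)
    show "AE z in bergman_measure m. summable (\<lambda>i. norm (F i z))"
      by (intro AE_I2 summable_comparison_test'[OF sm, of 0]) (simp add: Fb)
    show "summable (\<lambda>i. \<integral>z. norm (F i z) \<partial>bergman_measure m)"
    proof (rule summable_comparison_test'[OF sm, of 0])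
      fix j
      have "(\<integral>z. norm (F j z) \<partial>bergman_measure m) \<le> cmod (a j) * r ^ j"
        by (rule integral_le_const[OF integrable_norm[OF Fi]]) (intro AE_I2, simp add: Fb)
      then show "norm (\<integral>z. norm (F j z) \<partial>bergman_measure m) \<le> cmod (a j) * r ^ j" by simp
    qed
  qed (rule Fi)
  moreover have "(\<integral>z. (\<Sum>j. F j z) \<partial>bergman_measure m) =
      (\<integral>z. indicator (cball 0 r) z *\<^sub>R (f z * cnj z ^ k) \<partial>bergman_measure m)"
  proof (rule Bochner_Integration.integral_cong[OF refl])
    fix z assume "z \<in> space (bergman_measure m)"
    then have "(\<lambda>j. (indicator (cball 0 r) z *\<^sub>R cnj z ^ k) * (a j * z ^ j)) sums
        ((indicator (cball 0 r) z *\<^sub>R cnj z ^ k) * f z)"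
      by (intro sums_mult f) simp
    then have "(\<lambda>j. F j z) sums (indicator (cball 0 r) z *\<^sub>R (f z * cnj z ^ k))"
      by (simp add: F_def scaleR_conv_of_real mult_ac)
    then show "(\<Sum>j. F j z) = indicator (cball 0 r) z *\<^sub>R (f z * cnj z ^ k)"
      by (rule sums_unique[symmetric])
  qed
  moreover have "(\<lambda>j. integral\<^sup>L (bergman_measure m) (F j)) =
      (\<lambda>j. if j = k then a k * (\<integral>z. indicator (cball 0 r) z *\<^sub>R (z ^ k * cnj z ^ k) \<partial>bergman_measure m) else 0)"
    unfolding F_def[abs_def] integral_mult_right_zero by (simp add: fun_eq_iff integral_bergman_monomials_eq_0)
  ultimately have "(\<lambda>j. if j = k then a k * (\<integral>z. indicator (cball 0 r) z *\<^sub>R (z ^ k * cnj z ^ k) \<partial>bergman_measure m) else 0)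
      sums (\<integral>z. indicator (cball 0 r) z *\<^sub>R (f z * cnj z ^ k) \<partial>bergman_measure m)" by simp
  from sums_unique2[OF this sums_single[of k "\<lambda>_. a k * _"]] show ?thesis .
qed

text \<open>On a disc of radius less than 1 the series converges uniformly, so that by orthogonality only one
  term survives; integrability of \<open>f\<close> then allows these discs to exhaust the unit disc.\<close>

lemma integral_bergman_power_series:
  assumes m: "m \<ge> 1"
    and f: "\<And>z. z \<in> unit_disc \<Longrightarrow> (\<lambda>j. a j * z ^ j) sums f z"
    and int: "integrable (bergman_measure m) f"
  shows "(\<integral>z. f z * cnj z ^ k \<partial>bergman_measure m) = a k / of_nat ((m + k) choose k)"
proof -
  define \<rho> where "\<rho> n = real (Suc n) / real (Suc (Suc n))" for n
  have \<rho>: "0 < \<rho> n" "\<rho> n < 1" for n by (simp_all add: \<rho>_def)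
  have \<rho>_lim: "\<rho> \<longlonglongrightarrow> 1" unfolding \<rho>_def[abs_def]
    using LIMSEQ_Suc[OF LIMSEQ_n_over_Suc_n[where 'a=real]] by simp
  have ck: "(\<lambda>z. cnj z ^ k) \<in> borel_measurable (bergman_measure m)"
    by (intro borel_measurable_bergman_continuous continuous_intros)
  have fm: "f \<in> borel_measurable (bergman_measure m)"
    using int by (rule borel_measurable_integrable)
  have i1: "integrable (bergman_measure m) (\<lambda>z. f z * cnj z ^ k)"
  proof (rule Bochner_Integration.integrable_bound[OF int])
    show "(\<lambda>z. f z * cnj z ^ k) \<in> borel_measurable (bergman_measure m)"
      by (intro borel_measurable_times fm ck)
    show "AE z in bergman_measure m. norm (f z * cnj z ^ k) \<le> norm (f z)"
      by (intro AE_I2) (auto simp: norm_mult norm_power intro!: mult_left_le power_le_one)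
  qed
  have i2: "integrable (bergman_measure m) (\<lambda>z. z ^ k * cnj z ^ k)"
  proof (rule integrable_bergman_bounded[OF m])
    show "(\<lambda>z. z ^ k * cnj z ^ k) \<in> borel_measurable (bergman_measure m)"
      by (intro borel_measurable_bergman_continuous continuous_intros)
    show "norm (z ^ k * cnj z ^ k) \<le> 1" if "z \<in> unit_disc" for z
      using that by (auto simp: norm_mult norm_power intro!: mult_le_one power_le_one)
  qed
  have "(\<lambda>n. a k * (\<integral>z. indicator (cball 0 (\<rho> n)) z *\<^sub>R (z ^ k * cnj z ^ k) \<partial>bergman_measure m))
      \<longlonglongrightarrow> a k * (\<integral>z. z ^ k * cnj z ^ k \<partial>bergman_measure m)"
    by (intro tendsto_mult integral_bergman_exhaust i2 tendsto_const \<rho>_lim)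
  then have "(\<lambda>n. \<integral>z. indicator (cball 0 (\<rho> n)) z *\<^sub>R (f z * cnj z ^ k) \<partial>bergman_measure m)
      \<longlonglongrightarrow> a k * (\<integral>z. z ^ k * cnj z ^ k \<partial>bergman_measure m)"
    by (simp only: integral_bergman_truncated_power_series[OF m f \<rho>])
  from LIMSEQ_unique[OF integral_bergman_exhaust[OF i1 \<rho>_lim] this] show ?thesis
    by (simp add: integral_bergman_monomial[OF m])
qed

section \<open>The reproducing property of the Bergman kernel\<close>

lemma bergman_series:
  assumes "cmod x < 1"
  shows "(\<lambda>k. of_nat ((m + k) choose k) * x ^ k) sums (1 / (1 - x) ^ (m + 1))"
proof -
  have g: "((of_nat (m + 1) + of_nat n - 1 :: complex) gchoose n) = of_nat ((m + n) choose n)" for n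
    using binomial_gbinomial[of "m + n" n, where 'a = complex] by simp
  have nz: "1 - x \<noteq> 0" using assms by auto
  have "(\<lambda>n. (-1) ^ n * ((of_nat (m + 1) + of_nat n - 1) gchoose n) * (- x) ^ n) sums
      (1 + (- x)) powr (- of_nat (m + 1))"
    by (rule one_plus_neg_powr_powser) (use assms in simp)
  also have "(\<lambda>n. (-1) ^ n * ((of_nat (m + 1) + of_nat n - 1) gchoose n) * (- x) ^ n) =
      (\<lambda>k. of_nat ((m + k) choose k) * x ^ k)"
  proof
    fix n
    have "(-1) ^ n * (- x) ^ n = x ^ n" by (simp only: power_mult_distrib[symmetric]) simp
    then show "(-1) ^ n * ((of_nat (m + 1) + of_nat n - 1) gchoose n) * (- x) ^ n =
        of_nat ((m + n) choose n) * x ^ n"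
      unfolding g by (metis mult.assoc mult.commute)
  qed
  also have "(1 + (- x)) powr (- of_nat (m + 1)) = 1 / (1 - x) ^ (m + 1)"
    unfolding powr_minus divide_inverse using powr_nat'[of "1 + (- x)" "m + 1"] nz by simp
  finally show ?thesis .
qed

lemma bergman_kernel_bound:
  assumes "z \<in> cball 0 1" "w \<in> unit_disc"
  shows "cmod (bergman_kernel m z w) \<le> 1 / (1 - cmod w) ^ (m + 1)"
proof -
  have "1 - cmod w \<le> 1 - cmod z * cmod w"
    using assms by (simp add: mult_left_le_one_le)
  also have "\<dots> \<le> cmod (1 - z * cnj w)"
    using norm_triangle_ineq2[of 1 "z * cnj w"] by (simp add: norm_mult)
  finally have "(1 - cmod w) ^ (m + 1) \<le> cmod (1 - z * cnj w) ^ (m + 1)"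
    using assms by (intro power_mono) auto
  moreover have "0 < (1 - cmod w) ^ (m + 1)"
    using assms by (intro zero_less_power) simp
  ultimately show ?thesis
    unfolding bergman_kernel_def norm_divide norm_power norm_one
    by (intro frac_le[OF zero_le_one order_refl])
qed

text \<open>For fixed \<open>w\<close> the series of the kernel converges uniformly on the disc, so it may be integrated
  against \<open>f\<close> term by term, and each term produces one term of the Taylor series of \<open>f\<close> at \<open>w\<close>.\<close>

theorem bergman_reproducing:
  assumes m: "m \<ge> 1" and f: "f holomorphic_on unit_disc"
    and int: "integrable (bergman_measure m) f" and w: "w \<in> unit_disc"
  shows "(\<integral>z. f z * bergman_kernel m w z \<partial>bergman_measure m) = f w"
proof -
  define \<beta> where "\<beta> = bergman_measure m"
  define a where "a k = (deriv ^^ k) f 0 / fact k" for k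
  define c where "c k = (of_nat ((m + k) choose k) :: complex)" for k
  have fs: "(\<lambda>j. a j * z ^ j) sums f z" if "z \<in> unit_disc" for z
    using holomorphic_power_series[OF f that] by (simp add: a_def)
  have ck: "(\<lambda>z. cnj z ^ k) \<in> borel_measurable \<beta>" for k
    unfolding \<beta>_def by (intro borel_measurable_bergman_continuous continuous_intros)
  have fi: "integrable \<beta> f" using int by (simp add: \<beta>_def)
  have fm: "f \<in> borel_measurable \<beta>" using fi by (rule borel_measurable_integrable)
  have cnz: "c k \<noteq> 0" for k by (simp add: c_def)
  define F where "F k z = c k * w ^ k * (f z * cnj z ^ k)" for k z
  have Fb: "norm (F k z) \<le> norm (c k * w ^ k) * norm (f z)" if "z \<in> unit_disc" for k z
    using that by (auto simp: F_def norm_mult norm_power intro!: mult_left_mono mult_left_le power_le_one)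
  have Fm: "F k \<in> borel_measurable \<beta>" for k
    unfolding F_def[abs_def] by (intro borel_measurable_times borel_measurable_const fm ck)
  have spc: "space \<beta> = unit_disc" by (simp add: \<beta>_def)
  have Fi: "integrable \<beta> (F k)" for k
  proof (rule Bochner_Integration.integrable_bound[of _ "\<lambda>z. norm (c k * w ^ k) * norm (f z)"])
    show "AE z in \<beta>. norm (F k z) \<le> norm (norm (c k * w ^ k) * norm (f z))"
      by (rule AE_I2) (simp add: spc Fb del: norm_mult)
  qed (simp_all add: fi Fm)
  have sm: "summable (\<lambda>k. norm (c k * w ^ k))"
  proof -
    obtain s where s: "cmod w < s" "s < 1" using w dense[of "cmod w" 1] by auto
    then have "0 \<le> s" by (meson norm_ge_zero less_imp_le order_trans)
    then have "summable (\<lambda>k. c k * (of_real s) ^ k)"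
      using bergman_series[of "of_real s" m] s by (auto simp: c_def sums_iff)
    then show ?thesis by (rule powser_insidea) (use s \<open>0 \<le> s\<close> in simp)
  qed
  have "(\<lambda>k. integral\<^sup>L \<beta> (F k)) sums (\<integral>z. (\<Sum>k. F k z) \<partial>\<beta>)"
  proof (rule sums_integral)
    show "AE z in \<beta>. summable (\<lambda>k. norm (F k z))"
    proof (intro AE_I2)
      fix z assume "z \<in> space \<beta>"
      then have "norm (F k z) \<le> norm (c k * w ^ k) * norm (f z)" for k by (simp only: spc Fb)
      then show "summable (\<lambda>k. norm (F k z))"
        by (intro summable_comparison_test'[OF summable_mult2[OF sm], of 0]) simp
    qed
    show "summable (\<lambda>k. \<integral>z. norm (F k z) \<partial>\<beta>)"
    proof (rule summable_comparison_test'[OF summable_mult2[OF sm], of 0])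
      fix k
      have "(\<integral>z. norm (F k z) \<partial>\<beta>) \<le> (\<integral>z. norm (c k * w ^ k) * norm (f z) \<partial>\<beta>)"
        by (rule integral_mono) (simp_all add: Fi fi Fb spc integrable_norm)
      then show "norm (\<integral>z. norm (F k z) \<partial>\<beta>) \<le> norm (c k * w ^ k) * (\<integral>z. norm (f z) \<partial>\<beta>)" by simp
    qed
  qed (rule Fi)
  moreover have "(\<integral>z. (\<Sum>k. F k z) \<partial>\<beta>) = (\<integral>z. f z * bergman_kernel m w z \<partial>\<beta>)"
  proof (rule Bochner_Integration.integral_cong[OF refl])
    fix z assume z: "z \<in> space \<beta>"
    have "cmod w * cmod z < 1 * 1"
      using z w spc by (intro mult_strict_mono') auto
    then have "cmod (w * cnj z) < 1" by (simp add: norm_mult)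
    from sums_mult[OF bergman_series[OF this, of m], of "f z"]
    have "(\<lambda>k. F k z) sums (f z * bergman_kernel m w z)"
      by (simp add: F_def c_def bergman_kernel_def power_mult_distrib mult_ac)
    then show "(\<Sum>k. F k z) = f z * bergman_kernel m w z" by (simp add: sums_iff)
  qed
  moreover have "integral\<^sup>L \<beta> (F k) = a k * w ^ k" for k
    using integral_bergman_power_series[OF m fs int, of k] cnz[of k]
    unfolding F_def[abs_def] integral_mult_right_zero by (simp add: \<beta>_def c_def)
  ultimately have "(\<lambda>k. a k * w ^ k) sums (\<integral>z. f z * bergman_kernel m w z \<partial>\<beta>)"
    by simp
  from sums_unique2[OF this fs[OF w]] show ?thesis unfolding \<beta>_def .
qed

section \<open>Square-integrable functions\<close>

definition square_integrable :: "'a measure \<Rightarrow> ('a \<Rightarrow> complex) \<Rightarrow> bool" where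
  "square_integrable \<mu> f \<longleftrightarrow> f \<in> borel_measurable \<mu> \<and> integrable \<mu> (\<lambda>z. (cmod (f z))\<^sup>2)"

text \<open>The extension of \<^const>\<open>L2_inner\<close> from polynomials to functions, needed because reproducing kernels
  are not polynomials.\<close>

definition l2_prod :: "'a measure \<Rightarrow> ('a \<Rightarrow> complex) \<Rightarrow> ('a \<Rightarrow> complex) \<Rightarrow> complex" where
  "l2_prod \<mu> f g = (\<integral>z. f z * cnj (g z) \<partial>\<mu>)"

lemma borel_measurable_cnj [measurable (raw)]:
  "f \<in> borel_measurable M \<Longrightarrow> (\<lambda>x. cnj (f x)) \<in> borel_measurable M"
  by (rule borel_measurable_continuous_on[of cnj]) (intro continuous_intros)

lemma integrable_l2_prod:
  assumes f: "square_integrable \<mu> f" and g: "square_integrable \<mu> g"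
  shows "integrable \<mu> (\<lambda>z. f z * cnj (g z))"
proof (rule Bochner_Integration.integrable_bound)
  show "integrable \<mu> (\<lambda>z. (cmod (f z))\<^sup>2 + (cmod (g z))\<^sup>2)"
    using f g by (simp add: square_integrable_def)
  show "(\<lambda>z. f z * cnj (g z)) \<in> borel_measurable \<mu>"
    using f g by (intro borel_measurable_times borel_measurable_cnj) (simp_all add: square_integrable_def)
  have "a * b \<le> a\<^sup>2 + b\<^sup>2" if "0 \<le> a" "0 \<le> b" for a b :: real
    using sum_squares_bound[of a b] that mult_nonneg_nonneg[of a b] by linarith
  then show "AE z in \<mu>. norm (f z * cnj (g z)) \<le> norm ((cmod (f z))\<^sup>2 + (cmod (g z))\<^sup>2)"
    by (intro AE_I2) (simp add: norm_mult)
qed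

lemma square_integrable_scale:
  "square_integrable \<mu> f \<Longrightarrow> square_integrable \<mu> (\<lambda>z. c * f z)"
  by (auto simp: square_integrable_def norm_mult power_mult_distrib)

lemma sq_norm_diff_le: "(cmod (a - b))\<^sup>2 \<le> 2 * (cmod a)\<^sup>2 + 2 * (cmod b)\<^sup>2"
proof -
  have "(cmod (a - b))\<^sup>2 \<le> (cmod a + cmod b)\<^sup>2"
    by (intro power_mono norm_triangle_ineq4) simp
  also have "\<dots> \<le> 2 * (cmod a)\<^sup>2 + 2 * (cmod b)\<^sup>2"
    using sum_squares_bound[of "cmod a" "cmod b"] by (simp add: power2_sum)
  finally show ?thesis .
qed

lemma square_integrable_add:
  assumes f: "square_integrable \<mu> f" and g: "square_integrable \<mu> g"
  shows "square_integrable \<mu> (\<lambda>z. f z + g z)"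
proof -
  have [measurable]: "f \<in> borel_measurable \<mu>" "g \<in> borel_measurable \<mu>"
    using f g by (simp_all add: square_integrable_def)
  have "integrable \<mu> (\<lambda>z. (cmod (f z + g z))\<^sup>2)"
  proof (rule Bochner_Integration.integrable_bound)
    show "integrable \<mu> (\<lambda>z. 2 * (cmod (f z))\<^sup>2 + 2 * (cmod (g z))\<^sup>2)"
      using f g by (simp add: square_integrable_def)
    show "(\<lambda>z. (cmod (f z + g z))\<^sup>2) \<in> borel_measurable \<mu>"
      by measurable
    have "(cmod (a + b))\<^sup>2 \<le> 2 * (cmod a)\<^sup>2 + 2 * (cmod b)\<^sup>2" for a b
      using sq_norm_diff_le[of a "- b"] by simp
    then show "AE z in \<mu>. norm ((cmod (f z + g z))\<^sup>2) \<le> norm (2 * (cmod (f z))\<^sup>2 + 2 * (cmod (g z))\<^sup>2)"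
      by (intro AE_I2) simp
  qed
  then show ?thesis using f g by (simp add: square_integrable_def)
qed

lemma square_integrable_diff:
  assumes "square_integrable \<mu> f" "square_integrable \<mu> g"
  shows "square_integrable \<mu> (\<lambda>z. f z - g z)"
  using square_integrable_add[OF assms(1) square_integrable_scale[OF assms(2), of "-1"]] by simp

lemma l2_prod_diff_left:
  assumes "square_integrable \<mu> f" "square_integrable \<mu> g" "square_integrable \<mu> h"
  shows "l2_prod \<mu> (\<lambda>z. f z - g z) h = l2_prod \<mu> f h - l2_prod \<mu> g h"
  using Bochner_Integration.integral_diff[OF integrable_l2_prod[OF assms(1,3)] integrable_l2_prod[OF assms(2,3)]]
  by (simp add: l2_prod_def algebra_simps)

lemma l2_prod_cnj: "cnj (l2_prod \<mu> f g) = l2_prod \<mu> g f"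
proof -
  have "cnj (l2_prod \<mu> f g) = (\<integral>z. cnj (f z * cnj (g z)) \<partial>\<mu>)"
    unfolding l2_prod_def by (simp only: Bochner_Integration.integral_cnj)
  then show ?thesis by (simp add: l2_prod_def mult.commute)
qed

lemma l2_prod_diff_right:
  assumes "square_integrable \<mu> f" "square_integrable \<mu> g" "square_integrable \<mu> h"
  shows "l2_prod \<mu> h (\<lambda>z. f z - g z) = l2_prod \<mu> h f - l2_prod \<mu> h g"
  using arg_cong[where f = cnj, OF l2_prod_diff_left[OF assms]] by (simp add: l2_prod_cnj)

lemma l2_prod_self: "l2_prod \<mu> f f = of_real (\<integral>z. (cmod (f z))\<^sup>2 \<partial>\<mu>)"
  unfolding l2_prod_def by (simp only: complex_norm_square[symmetric] integral_complex_of_real)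

lemma l2_prod_cauchy_schwarz:
  assumes f: "square_integrable \<mu> f" and g: "square_integrable \<mu> g"
  shows "(cmod (l2_prod \<mu> f g))\<^sup>2 \<le> (\<integral>z. (cmod (f z))\<^sup>2 \<partial>\<mu>) * (\<integral>z. (cmod (g z))\<^sup>2 \<partial>\<mu>)"
proof -
  have [measurable]: "f \<in> borel_measurable \<mu>" "g \<in> borel_measurable \<mu>"
    using f g by (simp_all add: square_integrable_def)
  have i: "integrable \<mu> (\<lambda>z. cmod (f z) * cmod (g z))"
    using integrable_norm[OF integrable_l2_prod[OF f g]] by (simp add: norm_mult)
  have "ennreal ((\<integral>z. cmod (f z) * cmod (g z) \<partial>\<mu>)\<^sup>2) = (\<integral>\<^sup>+z. ennreal (cmod (f z)) * ennreal (cmod (g z)) \<partial>\<mu>)\<^sup>2"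
    using nn_integral_eq_integral[OF i]
    by (simp add: ennreal_power ennreal_mult' integral_nonneg_AE)
  also have "\<dots> \<le> (\<integral>\<^sup>+z. ennreal (cmod (f z)) ^ 2 \<partial>\<mu>) * (\<integral>\<^sup>+z. ennreal (cmod (g z)) ^ 2 \<partial>\<mu>)"
    by (rule Cauchy_Schwarz_nn_integral) simp_all
  also have "\<dots> = ennreal ((\<integral>z. (cmod (f z))\<^sup>2 \<partial>\<mu>) * (\<integral>z. (cmod (g z))\<^sup>2 \<partial>\<mu>))"
    using f g by (simp add: square_integrable_def ennreal_power nn_integral_eq_integral ennreal_mult)
  finally have "(\<integral>z. cmod (f z) * cmod (g z) \<partial>\<mu>)\<^sup>2 \<le> (\<integral>z. (cmod (f z))\<^sup>2 \<partial>\<mu>) * (\<integral>z. (cmod (g z))\<^sup>2 \<partial>\<mu>)"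
    by (subst (asm) ennreal_le_iff) simp_all
  moreover have "cmod (l2_prod \<mu> f g) \<le> (\<integral>z. cmod (f z) * cmod (g z) \<partial>\<mu>)"
    unfolding l2_prod_def
    using integral_norm_bound[of \<mu> "\<lambda>z. f z * cnj (g z)"] by (simp add: norm_mult)
  then have "(cmod (l2_prod \<mu> f g))\<^sup>2 \<le> (\<integral>z. cmod (f z) * cmod (g z) \<partial>\<mu>)\<^sup>2"
    by (rule power_mono) simp
  ultimately show ?thesis by linarith
qed

section \<open>Orthonormal polynomials and reproducing kernels\<close>

text \<open>Exactly the measures for which the Gram-Schmidt process on monomials is defined at every step: the
  norms exist and never vanish.\<close>

locale polynomial_measure =
  fixes \<mu> :: "complex measure"
  assumes square_integrable_poly: "square_integrable \<mu> (poly p)"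
    and poly_norm_pos: "p \<noteq> 0 \<Longrightarrow> (\<integral>z. (cmod (poly p z))\<^sup>2 \<partial>\<mu>) > 0"
begin

abbreviation P :: "nat \<Rightarrow> complex poly" where
  "P \<equiv> gram_schmidt_poly \<mu>"

lemma L2_inner_conv: "L2_inner \<mu> p q = l2_prod \<mu> (poly p) (poly q)"
  by (simp add: L2_inner_def l2_prod_def)

lemma L2_inner_diff_left: "L2_inner \<mu> (p - q) r = L2_inner \<mu> p r - L2_inner \<mu> q r"
proof -
  have "poly (p - q) = (\<lambda>z. poly p z - poly q z)" by (simp add: fun_eq_iff)
  then show ?thesis
    using l2_prod_diff_left[OF square_integrable_poly square_integrable_poly square_integrable_poly, of p q r]
    by (simp add: L2_inner_conv)
qed

lemma L2_inner_smult_left: "L2_inner \<mu> (Polynomial.smult c p) r = c * L2_inner \<mu> p r"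
  by (simp add: L2_inner_def mult.assoc)

lemma L2_inner_cnj: "cnj (L2_inner \<mu> p q) = L2_inner \<mu> q p"
  by (simp add: L2_inner_conv l2_prod_cnj)

lemma L2_inner_smult_right: "L2_inner \<mu> p (Polynomial.smult c r) = cnj c * L2_inner \<mu> p r"
  using arg_cong[where f = cnj, OF L2_inner_smult_left[of c r p]] by (simp add: L2_inner_cnj)

lemma L2_inner_0_left [simp]: "L2_inner \<mu> 0 r = 0"
  by (simp add: L2_inner_def)

lemma L2_inner_add_left: "L2_inner \<mu> (p + q) r = L2_inner \<mu> p r + L2_inner \<mu> q r"
  using L2_inner_diff_left[of p "- q" r] L2_inner_smult_left[of "-1" q r] by simp

lemma L2_inner_sum_left: "L2_inner \<mu> (\<Sum>i\<in>A. p i) r = (\<Sum>i\<in>A. L2_inner \<mu> (p i) r)"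
  by (induction A rule: infinite_finite_induct) (simp_all add: L2_inner_add_left)

lemma L2_inner_sum_right: "L2_inner \<mu> r (\<Sum>i\<in>A. p i) = (\<Sum>i\<in>A. L2_inner \<mu> r (p i))"
  using arg_cong[where f = cnj, OF L2_inner_sum_left[of p A r]] by (simp add: L2_inner_cnj)

lemma L2_inner_self: "L2_inner \<mu> p p = of_real ((L2_norm \<mu> p)\<^sup>2)"
  by (simp add: L2_inner_conv l2_prod_self L2_norm_def)

lemma L2_norm_pos: "p \<noteq> 0 \<Longrightarrow> L2_norm \<mu> p > 0"
  using poly_norm_pos[of p] by (simp add: L2_norm_def)

definition residual :: "nat \<Rightarrow> complex poly" where
  "residual k = Polynomial.monom 1 k - (\<Sum>j<k. Polynomial.smult (L2_inner \<mu> (Polynomial.monom 1 k) (P j)) (P j))"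

lemma P_residual: "P k = Polynomial.smult (complex_of_real (1 / L2_norm \<mu> (residual k))) (residual k)"
  by (subst gram_schmidt_poly.simps) (simp add: residual_def Let_def)

lemma coeff_P: "(\<forall>i>k. poly.coeff (P k) i = 0) \<and> poly.coeff (P k) k \<noteq> 0"
proof (induction k rule: less_induct)
  case (less k)
  have r: "poly.coeff (residual k) i = (if i = k then 1 else 0)" if "i \<ge> k" for i
    using less.IH that by (simp add: residual_def coeff_sum)
  then have "poly.coeff (residual k) k = 1" by simp
  then have "residual k \<noteq> 0" by auto
  then have "L2_norm \<mu> (residual k) \<noteq> 0" using L2_norm_pos[of "residual k"] by simp
  then show ?case by (simp add: P_residual r)
qed

lemma residual_nonzero: "residual k \<noteq> 0"
  using coeff_P[of k] by (auto simp: P_residual)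

lemma P_orthonormal_le: "j \<le> k \<Longrightarrow> L2_inner \<mu> (P k) (P j) = (if j = k then 1 else 0)"
proof (induction k arbitrary: j rule: less_induct)
  case (less k)
  have IH: "L2_inner \<mu> (P i) (P j) = (if i = j then 1 else 0)" if "i < k" "j < k" for i j
  proof (cases "j \<le> i")
    case True then show ?thesis using less.IH[of i j] that by simp
  next
    case False
    then show ?thesis
      using less.IH[of j i] that L2_inner_cnj[of "P j" "P i"] by simp
  qed
  show ?case
  proof (cases "j = k")
    case True
    have "L2_norm \<mu> (residual k) \<noteq> 0" using L2_norm_pos[OF residual_nonzero[of k]] by simp
    then show ?thesis
      unfolding True P_residual L2_inner_smult_left L2_inner_smult_right L2_inner_self[of "residual k"]
      by (simp add: power2_eq_square)
  next
    case False
    then have "j < k" using less by simp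
    then have "L2_inner \<mu> (residual k) (P j) = 0"
      by (simp add: residual_def L2_inner_diff_left L2_inner_sum_left L2_inner_smult_left IH
          if_distrib sum.delta cong: if_cong)
    then show ?thesis using False by (subst P_residual) (simp add: L2_inner_smult_left)
  qed
qed

lemma P_orthonormal: "L2_inner \<mu> (P j) (P k) = (if j = k then 1 else 0)"
proof (cases "k \<le> j")
  case True then show ?thesis by (simp add: P_orthonormal_le)
next
  case False
  then show ?thesis using P_orthonormal_le[of j k] L2_inner_cnj[of "P k" "P j"] by simp
qed

lemma P_spans:
  assumes "\<And>i. i \<ge> n \<Longrightarrow> poly.coeff p i = 0"
  shows "\<exists>c. p = (\<Sum>k<n. Polynomial.smult (c k) (P k))"
  using assms
proof (induction n arbitrary: p)
  case 0
  then have "p = 0" by (intro poly_eqI) simp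
  then show ?case by simp
next
  case (Suc n)
  define d where "d = poly.coeff p n / poly.coeff (P n) n"
  have "poly.coeff (p - Polynomial.smult d (P n)) i = 0" if "i \<ge> n" for i
    using that Suc.prems[of i] coeff_P[of n] by (cases "i = n") (auto simp: d_def)
  from Suc.IH[OF this] obtain c where c: "p - Polynomial.smult d (P n) = (\<Sum>k<n. Polynomial.smult (c k) (P k))"
    by blast
  have "p = (\<Sum>k<Suc n. Polynomial.smult ((c(n := d)) k) (P k))"
    using c by (simp add: diff_eq_eq)
  then show ?case by blast
qed

text \<open>By the reproducing property the partial sum at \<open>w\<close> is the orthogonal projection of the function
  \<open>kf w\<close> to the polynomials of degree less than \<open>n\<close>, so it is the best approximation of that degree
  and converges in \<open>L\<^sup>2\<close> as soon as \<open>kf w\<close> can be approximated at all. The reproducing property at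
  \<open>z\<close> then turns convergence in \<open>L\<^sup>2\<close> into convergence at the point \<open>z\<close>.\<close>

theorem gram_schmidt_kernel_tendsto:
  fixes kf :: "complex \<Rightarrow> complex \<Rightarrow> complex"
  assumes sq: "\<And>w. w \<in> S \<Longrightarrow> square_integrable \<mu> (kf w)"
    and rp: "\<And>p w. w \<in> S \<Longrightarrow> l2_prod \<mu> (poly p) (kf w) = poly p w"
    and rk: "\<And>v w. v \<in> S \<Longrightarrow> w \<in> S \<Longrightarrow> l2_prod \<mu> (kf v) (kf w) = kf v w"
    and approx: "\<And>w e. w \<in> S \<Longrightarrow> e > 0 \<Longrightarrow> \<exists>p. (\<integral>z. (cmod (kf w z - poly p z))\<^sup>2 \<partial>\<mu>) < e"
    and z: "z \<in> S" and w: "w \<in> S"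
  shows "(\<lambda>n. \<Sum>k<n. poly (P k) z * cnj (poly (P k) w)) \<longlonglongrightarrow> kf w z"
proof -
  define D where "D p = (\<integral>z. (cmod (kf w z - poly p z))\<^sup>2 \<partial>\<mu>)" for p
  define s where "s n = (\<Sum>k<n. Polynomial.smult (cnj (poly (P k) w)) (P k))" for n
  note sp = square_integrable_poly
  \<comment> \<open>Completing the square: the minimum is attained at the coefficients of \<open>s n\<close>.\<close>
  have D_eq: "D (\<Sum>k<n. Polynomial.smult (c k) (P k)) = Re (kf w w) +
      (\<Sum>k<n. (cmod (c k - cnj (poly (P k) w)))\<^sup>2 - (cmod (poly (P k) w))\<^sup>2)" for c n
  proof -
    define p where "p = (\<Sum>k<n. Polynomial.smult (c k) (P k))"
    have "of_real (D p) = l2_prod \<mu> (\<lambda>z. kf w z - poly p z) (\<lambda>z. kf w z - poly p z)"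
      by (simp add: l2_prod_self D_def)
    also have "\<dots> = l2_prod \<mu> (kf w) (kf w) - l2_prod \<mu> (kf w) (poly p) - (l2_prod \<mu> (poly p) (kf w) - l2_prod \<mu> (poly p) (poly p))"
      using sq[OF w] sp[of p] square_integrable_diff[OF sq[OF w] sp[of p]]
      by (simp add: l2_prod_diff_left l2_prod_diff_right)
    also have "l2_prod \<mu> (kf w) (poly p) = cnj (poly p w)"
      using l2_prod_cnj[of \<mu> "poly p" "kf w"] by (simp add: rp w)
    also have "l2_prod \<mu> (poly p) (poly p) = (\<Sum>k<n. c k * cnj (c k))"
      unfolding L2_inner_conv[symmetric] p_def
      by (simp add: L2_inner_sum_left L2_inner_sum_right L2_inner_smult_left L2_inner_smult_right
          P_orthonormal if_distrib sum.delta mult.commute cong: if_cong)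
    also have "l2_prod \<mu> (poly p) (kf w) = poly p w" by (rule rp[OF w])
    also have "poly p w = (\<Sum>k<n. c k * poly (P k) w)"
      by (simp add: p_def poly_sum)
    finally have "of_real (D p) = kf w w + (\<Sum>k<n. c k * cnj (c k) - cnj (c k * poly (P k) w) - c k * poly (P k) w)"
      by (simp add: rk w sum_subtractf)
    then have "D p = Re (kf w w + (\<Sum>k<n. c k * cnj (c k) - cnj (c k * poly (P k) w) - c k * poly (P k) w))"
      by (metis Re_complex_of_real)
    also have "\<dots> = Re (kf w w) + (\<Sum>k<n. (cmod (c k - cnj (poly (P k) w)))\<^sup>2 - (cmod (poly (P k) w))\<^sup>2)"
    proof -
      have "Re (x * cnj x - cnj (x * y) - x * y) = (cmod (x - cnj y))\<^sup>2 - (cmod y)\<^sup>2" for x y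
        unfolding cmod_power2 by (simp add: power2_eq_square algebra_simps)
      then show ?thesis by (simp only: plus_complex.sel Re_sum)
    qed
    finally show ?thesis by (simp add: p_def)
  qed
  have D_le: "D (s n) \<le> D p" if deg: "degree p < n" for n p
  proof -
    obtain c where c: "p = (\<Sum>k<n. Polynomial.smult (c k) (P k))"
      using P_spans[of n p] deg by (metis coeff_eq_0 less_le_trans)
    show ?thesis unfolding c s_def D_eq by (intro add_left_mono sum_mono) simp
  qed
  have D0: "D p \<ge> 0" for p by (simp add: D_def)
  have "(\<lambda>n. D (s n)) \<longlonglongrightarrow> 0"
  proof (rule LIMSEQ_I)
    fix e :: real assume "e > 0"
    then obtain p where p: "D p < e" using approx[OF w] by (auto simp: D_def)
    have "norm (D (s n) - 0) < e" if "n \<ge> Suc (degree p)" for n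
      using D_le[of p n] that p D0[of "s n"] by simp
    then show "\<exists>no. \<forall>n\<ge>no. norm (D (s n) - 0) < e" by blast
  qed
  then have lim0: "(\<lambda>n. D (s n) * (\<integral>x. (cmod (kf z x))\<^sup>2 \<partial>\<mu>)) \<longlonglongrightarrow> 0"
    by (rule tendsto_mult_left_zero)
  have "(\<lambda>n. (cmod (kf w z - poly (s n) z))\<^sup>2) \<longlonglongrightarrow> 0"
  proof (rule tendsto_sandwich[OF _ _ tendsto_const lim0])
    have "(cmod (kf w z - poly (s n) z))\<^sup>2 \<le> D (s n) * (\<integral>x. (cmod (kf z x))\<^sup>2 \<partial>\<mu>)" for n
    proof -
      have "kf w z - poly (s n) z = l2_prod \<mu> (\<lambda>x. kf w x - poly (s n) x) (kf z)"
        by (simp add: l2_prod_diff_left sq sp w z rp rk)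
      then show ?thesis
        using l2_prod_cauchy_schwarz[OF square_integrable_diff[OF sq[OF w] sp[of "s n"]] sq[OF z]]
        by (simp add: D_def)
    qed
    then show "\<forall>\<^sub>F n in sequentially. (cmod (kf w z - poly (s n) z))\<^sup>2 \<le> D (s n) * (\<integral>x. (cmod (kf z x))\<^sup>2 \<partial>\<mu>)"
      by simp
  qed simp
  from tendsto_real_sqrt[OF this] have "(\<lambda>n. cmod (kf w z - poly (s n) z)) \<longlonglongrightarrow> 0"
    by simp
  then have "(\<lambda>n. kf w z - poly (s n) z) \<longlonglongrightarrow> 0"
    by (rule tendsto_norm_zero_cancel)
  from tendsto_diff[OF tendsto_const[of "kf w z"] this] have "(\<lambda>n. poly (s n) z) \<longlonglongrightarrow> kf w z"
    by simp
  then show ?thesis by (simp add: s_def poly_sum mult.commute)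
qed

end

section \<open>The weight and the reference measure\<close>

lemma norm_powr_upper:
  assumes "w \<noteq> 0"
  shows "cmod (w powr \<delta>) \<le> exp (pi * \<bar>Im \<delta>\<bar>) * cmod w powr Re \<delta>"
proof -
  have "- Im \<delta> * Arg w \<le> \<bar>Im \<delta>\<bar> * \<bar>Arg w\<bar>"
    by (metis abs_ge_self abs_minus_cancel abs_mult)
  also have "\<dots> \<le> \<bar>Im \<delta>\<bar> * pi"
    using Arg_bounded[of w] by (intro mult_left_mono) auto
  finally show ?thesis
    unfolding norm_powr_complex by (subst mult.commute) (intro mult_right_mono; simp add: mult.commute)
qed

lemma norm_powr_lower:
  assumes "w \<noteq> 0"
  shows "exp (- pi * \<bar>Im \<delta>\<bar>) * cmod w powr Re \<delta> \<le> cmod (w powr \<delta>)"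
proof -
  have "Im \<delta> * Arg w \<le> \<bar>Im \<delta>\<bar> * \<bar>Arg w\<bar>"
    by (metis abs_ge_self abs_mult)
  also have "\<dots> \<le> \<bar>Im \<delta>\<bar> * pi"
    using Arg_bounded[of w] by (intro mult_left_mono) auto
  finally show ?thesis
    unfolding norm_powr_complex by (subst mult.commute) (intro mult_left_mono; simp add: mult.commute)
qed

definition hp_weight :: "complex \<Rightarrow> complex \<Rightarrow> complex" where
  "hp_weight \<delta> z = (1 - z) powr \<delta>"

lemma holomorphic_hp_weight: "hp_weight \<delta> holomorphic_on unit_disc"
  unfolding hp_weight_def[abs_def]
proof (intro holomorphic_intros)
  fix z :: complex assume "z \<in> unit_disc"
  then have "Re z < 1" using abs_Re_le_cmod[of z] by simp
  then show "1 - z \<notin> \<real>\<^sub>\<le>\<^sub>0" by (auto simp: complex_nonpos_Reals_iff)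
qed

lemma borel_measurable_hp_weight [measurable]: "hp_weight \<delta> \<in> borel_measurable (bergman_measure m)"
  by (intro borel_measurable_bergman_continuous holomorphic_on_imp_continuous_on holomorphic_hp_weight)

lemma hp_weight_nonzero: "z \<in> unit_disc \<Longrightarrow> hp_weight \<delta> z \<noteq> 0"
  by (auto simp: hp_weight_def)

lemma hp_measure_density:
  "hp_measure m \<delta> = density (restrict_space lborel unit_disc)
     (\<lambda>z. ennreal ((cmod (hp_weight \<delta> z))\<^sup>2 * (1 - (cmod z)\<^sup>2) ^ (m - 1)))"
  by (simp add: hp_measure_def hp_weight_def)

lemma hp_measure_conv:
  assumes "m \<ge> 1"
  shows "hp_measure m \<delta> =
    density (bergman_measure m) (\<lambda>z. ennreal (pi / real m * (cmod (hp_weight \<delta> z))\<^sup>2))"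
proof -
  have wm [measurable]: "hp_weight \<delta> \<in> borel_measurable (restrict_space lborel unit_disc)"
    using borel_measurable_hp_weight[of \<delta> m]
    by (simp add: measurable_def sets_bergman_measure sets_restrict_space space_restrict_space)
  have sm [measurable]: "(\<lambda>z. 1 - (cmod z)\<^sup>2) \<in> borel_measurable (restrict_space lborel unit_disc)"
    by (intro measurable_restrict_space1) measurable
  show ?thesis
    unfolding hp_measure_density bergman_measure_def
  proof (subst density_density_eq)
    show "(\<lambda>z. ennreal (pi / real m * (cmod (hp_weight \<delta> z))\<^sup>2)) \<in> borel_measurable (restrict_space lborel unit_disc)"
      by measurable
    show "density (restrict_space lborel unit_disc) (\<lambda>z. ennreal ((cmod (hp_weight \<delta> z))\<^sup>2 * (1 - (cmod z)\<^sup>2) ^ (m - 1))) =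
      density (restrict_space lborel unit_disc)
       (\<lambda>x. ennreal (real m / pi * (1 - (cmod x)\<^sup>2) ^ (m - 1)) * ennreal (pi / real m * (cmod (hp_weight \<delta> x))\<^sup>2))"
    proof (rule density_cong)
      show "(\<lambda>z. ennreal ((cmod (hp_weight \<delta> z))\<^sup>2 * (1 - (cmod z)\<^sup>2) ^ (m - 1))) \<in> borel_measurable (restrict_space lborel unit_disc)"
        by measurable
      show "(\<lambda>x. ennreal (real m / pi * (1 - (cmod x)\<^sup>2) ^ (m - 1)) * ennreal (pi / real m * (cmod (hp_weight \<delta> x))\<^sup>2))
          \<in> borel_measurable (restrict_space lborel unit_disc)"
        by measurable
      have eq: "(cmod (hp_weight \<delta> z))\<^sup>2 * (1 - (cmod z)\<^sup>2) ^ (m - 1) =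
          (real m / pi * (1 - (cmod z)\<^sup>2) ^ (m - 1)) * (pi / real m * (cmod (hp_weight \<delta> z))\<^sup>2)" for z
        using assms by (simp add: field_simps)
      show "AE z in restrict_space lborel unit_disc. ennreal ((cmod (hp_weight \<delta> z))\<^sup>2 * (1 - (cmod z)\<^sup>2) ^ (m - 1)) =
          ennreal (real m / pi * (1 - (cmod z)\<^sup>2) ^ (m - 1)) * ennreal (pi / real m * (cmod (hp_weight \<delta> z))\<^sup>2)"
        unfolding eq by (intro AE_I2 ennreal_mult'') simp
    qed
  qed (rule bergman_density_measurable)
qed

lemma sets_hp_measure: "sets (hp_measure m \<delta>) = sets (restrict_space borel unit_disc)"
  by (simp add: hp_measure_def sets_restrict_space)

lemma space_hp_measure [simp]: "space (hp_measure m \<delta>) = unit_disc"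
  by (simp add: hp_measure_def space_restrict_space)

lemma borel_measurable_hp_iff:
  "f \<in> borel_measurable (hp_measure m \<delta>) \<longleftrightarrow> f \<in> borel_measurable (bergman_measure m)"
  by (simp add: measurable_def sets_bergman_measure sets_hp_measure)

lemma integral_hp:
  fixes f :: "complex \<Rightarrow> 'a::{banach, second_countable_topology}"
  assumes "m \<ge> 1" "f \<in> borel_measurable (bergman_measure m)"
  shows "(\<integral>z. f z \<partial>hp_measure m \<delta>) =
      (\<integral>z. (pi / real m * (cmod (hp_weight \<delta> z))\<^sup>2) *\<^sub>R f z \<partial>bergman_measure m)"
  unfolding hp_measure_conv[OF assms(1)]
  by (rule integral_density[OF assms(2)])
     (simp_all add: assms(1))

lemma integrable_hp_iff:
  fixes f :: "complex \<Rightarrow> 'a::{banach, second_countable_topology}"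
  assumes "m \<ge> 1" "f \<in> borel_measurable (bergman_measure m)"
  shows "integrable (hp_measure m \<delta>) f \<longleftrightarrow>
      integrable (bergman_measure m) (\<lambda>z. (pi / real m * (cmod (hp_weight \<delta> z))\<^sup>2) *\<^sub>R f z)"
  unfolding hp_measure_conv[OF assms(1)]
  by (rule integrable_density[OF assms(2)])
     (simp_all add: assms(1))

lemma nn_integral_powr_strip:
  assumes s: "s > -1"
  shows "(\<integral>\<^sup>+x. ennreal ((1 - x) powr s) * indicator {-1..1} x \<partial>lborel) < \<infinity>"
proof -
  have "(\<integral>\<^sup>+x. ennreal ((1 - x) powr s) * indicator {-1..1} x \<partial>lborel) =
      (\<integral>\<^sup>+x. ennreal (x powr s) * indicator {0..2} x \<partial>lborel)"
    by (subst nn_integral_real_affine[where c = "-1" and t = 1])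
       (auto intro!: nn_integral_cong simp: indicator_def)
  also have "\<dots> = ennreal (2 powr (s + 1) / (s + 1))"
    by (rule nn_integral_has_integral_lebesgue') (use has_integral_powr_from_0[OF s, of 2] in simp_all)
  finally show ?thesis by simp
qed

text \<open>Since \<open>\<bar>1 - z\<bar> \<ge> 1 - Re z\<close>, a negative power of \<open>\<bar>1 - z\<bar>\<close> is dominated by a function of the
  real part only, and \<open>s > -1\<close> makes that function integrable near 1. With \<open>s = 2 * Re \<delta>\<close> this is
  the condition \<open>Re \<delta> > -1/2\<close>.\<close>

lemma integrable_powr_weight:
  assumes m: "m \<ge> 1" and s: "s > -1"
  shows "integrable (bergman_measure m) (\<lambda>z. cmod (1 - z) powr s)"
proof -
  have meas: "(\<lambda>z. cmod (1 - z) powr s) \<in> borel_measurable (bergman_measure m)"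
    by (intro measurable_bergman) measurable
  show ?thesis
  proof (cases "s \<ge> 0")
    case True
    show ?thesis
    proof (rule integrable_bergman_bounded[OF m meas])
      fix z assume "z \<in> unit_disc"
      then have "cmod (1 - z) \<le> 2" using norm_triangle_ineq4[of 1 z] by simp
      then show "norm (cmod (1 - z) powr s) \<le> 2 powr s" using True by (simp add: powr_mono2)
    qed
  next
    case False
    define c where "c = real m / pi"
    define h where "h x = ennreal ((1 - x) powr s) * indicator {-1..1} x" for x :: real
    have [measurable]: "h \<in> borel_measurable borel" unfolding h_def[abs_def] by measurable
    have "(\<integral>\<^sup>+z. ennreal (cmod (1 - z) powr s) \<partial>bergman_measure m) =
        (\<integral>\<^sup>+z. ennreal (c * (1 - (cmod z)\<^sup>2) ^ (m - 1)) * ennreal (cmod (1 - z) powr s) * indicator unit_disc z \<partial>lborel)"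
      unfolding bergman_measure_def c_def
      by (subst nn_integral_density)
         (auto simp: nn_integral_restrict_space intro!: measurable_restrict_space1)
    also have "\<dots> \<le> (\<integral>\<^sup>+z. ennreal c * (h (Re z) * indicator {-1..1} (Im z)) \<partial>lborel)"
    proof (rule nn_integral_mono)
      fix z :: complex
      show "ennreal (c * (1 - (cmod z)\<^sup>2) ^ (m - 1)) * ennreal (cmod (1 - z) powr s) * indicator unit_disc z
          \<le> ennreal c * (h (Re z) * indicator {-1..1} (Im z))"
      proof (cases "z \<in> unit_disc")
        case True
        then have R: "\<bar>Re z\<bar> < 1" "\<bar>Im z\<bar> < 1"
          using abs_Re_le_cmod[of z] abs_Im_le_cmod[of z] by simp_all
        have "(1 - (cmod z)\<^sup>2) ^ (m - 1) \<le> 1"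
          using True by (intro power_le_one) (simp_all add: power_le_one)
        then have 1: "c * (1 - (cmod z)\<^sup>2) ^ (m - 1) \<le> c" by (intro mult_left_le) (simp_all add: c_def)
        have "1 - Re z \<le> cmod (1 - z)" using complex_Re_le_cmod[of "1 - z"] by simp
        then have 2: "cmod (1 - z) powr s \<le> (1 - Re z) powr s"
          using R False by (intro powr_mono2') auto
        have 3: "indicator {-1..1} (Re z) = (1 :: ennreal)" "indicator {-1..1} (Im z) = (1 :: ennreal)"
          using R by (simp_all add: indicator_def abs_less_iff)
        show ?thesis
          using True 3 mult_mono[OF ennreal_leI[OF 1] ennreal_leI[OF 2]] by (simp add: h_def)
      qed simp
    qed
    also have "\<dots> = (\<integral>\<^sup>+x. \<integral>\<^sup>+y. ennreal c * (h x * indicator {-1..1} (y::real)) \<partial>lborel \<partial>lborel)"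
      by (subst nn_integral_lborel_complex') simp_all
    also have "\<dots> = ennreal c * ((\<integral>\<^sup>+x. h x \<partial>lborel) * 2)"
      by (simp add: nn_integral_cmult nn_integral_multc)
    also have "\<dots> < \<infinity>"
      using nn_integral_powr_strip[OF s] by (simp add: h_def ennreal_mult_less_top)
    finally show ?thesis
      using meas by (intro integrableI_bounded) simp_all
  qed
qed

lemma integrable_weight_sq:
  assumes m: "m \<ge> 1" and \<delta>: "Re \<delta> > -1/2"
  shows "integrable (bergman_measure m) (\<lambda>z. (cmod (hp_weight \<delta> z))\<^sup>2)"
proof (rule Bochner_Integration.integrable_bound)
  show "integrable (bergman_measure m) (\<lambda>z. (exp (pi * \<bar>Im \<delta>\<bar>))\<^sup>2 * cmod (1 - z) powr (2 * Re \<delta>))"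
    using \<delta> by (intro integrable_mult_right integrable_powr_weight m) simp
  show "(\<lambda>z. (cmod (hp_weight \<delta> z))\<^sup>2) \<in> borel_measurable (bergman_measure m)"
    by measurable
  show "AE z in bergman_measure m. norm ((cmod (hp_weight \<delta> z))\<^sup>2) \<le>
      norm ((exp (pi * \<bar>Im \<delta>\<bar>))\<^sup>2 * cmod (1 - z) powr (2 * Re \<delta>))"
  proof (intro AE_I2)
    fix z assume "z \<in> space (bergman_measure m)"
    then have "1 - z \<noteq> 0" by auto
    from power_mono[OF norm_powr_upper[OF this, of \<delta>], of 2]
    have "(cmod (hp_weight \<delta> z))\<^sup>2 \<le> (exp (pi * \<bar>Im \<delta>\<bar>))\<^sup>2 * (cmod (1 - z) powr Re \<delta>)\<^sup>2"
      by (simp add: power_mult_distrib hp_weight_def)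
    also have "(cmod (1 - z) powr Re \<delta>)\<^sup>2 = cmod (1 - z) powr (2 * Re \<delta>)"
      by (simp add: power2_eq_square powr_add[symmetric])
    finally show "norm ((cmod (hp_weight \<delta> z))\<^sup>2) \<le>
      norm ((exp (pi * \<bar>Im \<delta>\<bar>))\<^sup>2 * cmod (1 - z) powr (2 * Re \<delta>))" by simp
  qed
qed

lemma finite_measure_hp:
  assumes "m \<ge> 1" "Re \<delta> > -1/2"
  shows "finite_measure (hp_measure m \<delta>)"
proof -
  have "integrable (hp_measure m \<delta>) (\<lambda>_. 1 :: real)"
    using integrable_weight_sq[OF assms] assms(1) by (subst integrable_hp_iff) simp_all
  then show ?thesis
    by (intro finite_measureI) (simp add: integrable_iff_bounded)
qed

lemma square_integrable_hp_bounded: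
  assumes m: "m \<ge> 1" and \<delta>: "Re \<delta> > -1/2"
    and f: "f \<in> borel_measurable (bergman_measure m)" and B: "\<And>z. z \<in> unit_disc \<Longrightarrow> cmod (f z) \<le> B"
  shows "square_integrable (hp_measure m \<delta>) f"
proof -
  interpret finite_measure "hp_measure m \<delta>" by (rule finite_measure_hp[OF m \<delta>])
  have fm: "f \<in> borel_measurable (hp_measure m \<delta>)" using f by (simp add: borel_measurable_hp_iff)
  have "integrable (hp_measure m \<delta>) (\<lambda>z. (cmod (f z))\<^sup>2)"
  proof (rule integrable_const_bound[where B = "B\<^sup>2"])
    show "AE z in hp_measure m \<delta>. norm ((cmod (f z))\<^sup>2) \<le> B\<^sup>2"
      by (intro AE_I2) (simp add: B power_mono)
    show "(\<lambda>z. (cmod (f z))\<^sup>2) \<in> borel_measurable (hp_measure m \<delta>)"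
      using fm by measurable
  qed
  then show ?thesis using fm by (simp add: square_integrable_def)
qed

lemma poly_bounded_on_disc:
  fixes p :: "complex poly"
  shows "\<exists>B. \<forall>z\<in>unit_disc. cmod (poly p z) \<le> B"
proof -
  have "compact (poly p ` cball 0 1)"
    by (intro compact_continuous_image continuous_intros compact_cball)
  then obtain B where "\<forall>x\<in>poly p ` cball 0 1. norm x \<le> B"
    using compact_imp_bounded[THEN bounded_iff[THEN iffD1]] by blast
  then show ?thesis by (intro exI[of _ B]) auto
qed

text \<open>A polynomial of norm 0 vanishes almost everywhere on the disc, because the density is positive there;
  but a nonzero polynomial has only finitely many roots.\<close>

lemma polynomial_measure_hp:
  assumes m: "m \<ge> 1" and \<delta>: "Re \<delta> > -1/2"
  shows "polynomial_measure (hp_measure m \<delta>)"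
proof
  fix p :: "complex poly"
  obtain B where B: "\<And>z. z \<in> unit_disc \<Longrightarrow> cmod (poly p z) \<le> B" using poly_bounded_on_disc[of p] by blast
  have pm: "poly p \<in> borel_measurable (bergman_measure m)"
    by (intro borel_measurable_bergman_continuous continuous_intros)
  show sq: "square_integrable (hp_measure m \<delta>) (poly p)"
    by (rule square_integrable_hp_bounded[OF m \<delta> pm B])
  assume "p \<noteq> 0"
  have "(\<integral>z. (cmod (poly p z))\<^sup>2 \<partial>hp_measure m \<delta>) \<noteq> 0"
  proof
    assume "(\<integral>z. (cmod (poly p z))\<^sup>2 \<partial>hp_measure m \<delta>) = 0"
    then have "AE z in hp_measure m \<delta>. (cmod (poly p z))\<^sup>2 = 0"
      using sq by (subst (asm) integral_nonneg_eq_0_iff_AE) (simp_all add: square_integrable_def)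
    moreover have "(\<lambda>z. ennreal (pi / real m * (cmod (hp_weight \<delta> z))\<^sup>2)) \<in> borel_measurable (bergman_measure m)"
      by measurable
    ultimately have "AE z in bergman_measure m. 0 < ennreal (pi / real m * (cmod (hp_weight \<delta> z))\<^sup>2) \<longrightarrow> (cmod (poly p z))\<^sup>2 = 0"
      unfolding hp_measure_conv[OF m] by (simp add: AE_density)
    then have "AE z in bergman_measure m. poly p z = 0"
      using AE_space by eventually_elim (use m hp_weight_nonzero in auto)
    then have "AE z in lborel. z \<in> unit_disc \<longrightarrow> 0 < ennreal (real m / pi * (1 - (cmod z)\<^sup>2) ^ (m - 1)) \<longrightarrow> poly p z = 0"
      unfolding bergman_measure_def
      by (simp add: AE_density[OF bergman_density_measurable] AE_restrict_space_iff)
    moreover have "AE z in lborel. z \<notin> {z. poly p z = 0}"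
      using \<open>p \<noteq> 0\<close> by (intro AE_not_in finite_imp_null_set_lborel poly_roots_finite)
    ultimately have "AE z in lborel. z \<notin> unit_disc"
    proof eventually_elim
      case (elim z)
      show ?case
      proof
        assume "z \<in> unit_disc"
        then have "(cmod z)\<^sup>2 < 1" by (simp add: power_less_one_iff abs_square_less_1)
        then have "0 < real m / pi * (1 - (cmod z)\<^sup>2) ^ (m - 1)" using m by simp
        with elim \<open>z \<in> unit_disc\<close> show False by simp
      qed
    qed
    then have "emeasure lborel unit_disc = 0"
      by (subst (asm) AE_iff_measurable[of unit_disc]) auto
    then show False by (simp add: emeasure_ball unit_ball_vol_2)
  qed
  moreover have "(\<integral>z. (cmod (poly p z))\<^sup>2 \<partial>hp_measure m \<delta>) \<ge> 0" by simp
  ultimately show "(\<integral>z. (cmod (poly p z))\<^sup>2 \<partial>hp_measure m \<delta>) > 0" by linarith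
qed

section \<open>Density of polynomials\<close>

text \<open>The inequality \<open>\<bar>1 - z\<bar> \<le> 2 * \<bar>1 - r z\<bar>\<close> controls the quotient of the two weights. For \<open>Re \<delta> < 0\<close> the
  quotient is unbounded near 1, but still dominated by an integrable function that does not depend on
  \<open>r\<close>.\<close>

lemma weight_dilation_bound:
  assumes z: "z \<in> unit_disc" and r: "0 \<le> r" "r < 1"
  shows "(cmod (hp_weight \<delta> z) / cmod (hp_weight \<delta> (of_real r * z)))\<^sup>2
    \<le> exp (4 * pi * \<bar>Im \<delta>\<bar>) * 4 powr \<bar>Re \<delta>\<bar> * (1 + cmod (1 - z) powr (2 * Re \<delta>))"
proof -
  define E where "E = exp (pi * \<bar>Im \<delta>\<bar>)"
  define a where "a = cmod (1 - z)"
  define b where "b = cmod (1 - of_real r * z)"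
  have nz: "1 - z \<noteq> 0" using z by auto
  have "cmod (of_real r * z) < 1"
    using z r by (simp add: norm_mult) (metis abs_of_nonneg mult_le_one norm_ge_zero less_imp_le mult_left_le_one_le le_less_trans)
  then have nz': "1 - of_real r * z \<noteq> 0" by auto
  have a: "a > 0" and b: "b > 0" using nz nz' by (simp_all add: a_def b_def)
  have b2: "b \<le> 2"
    using norm_triangle_ineq4[of 1 "of_real r * z"] \<open>cmod (of_real r * z) < 1\<close> by (simp add: b_def)
  have ab: "a \<le> 2 * b"
  proof -
    have "1 - r \<le> b"
    proof -
      have "cmod (of_real r * z) \<le> r" using z r by (simp add: norm_mult mult_left_le)
      then show ?thesis using norm_triangle_ineq2[of 1 "of_real r * z"] by (simp add: b_def)
    qed
    moreover have "a \<le> b + (1 - r)"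
    proof -
      have "a = cmod ((1 - of_real r * z) - (of_real (1 - r) * z))" by (simp add: a_def algebra_simps)
      also have "\<dots> \<le> b + cmod (of_real (1 - r) * z)" unfolding b_def by (rule norm_triangle_ineq4)
      also have "cmod (of_real (1 - r) * z) \<le> 1 - r"
        unfolding norm_mult norm_of_real using z r by (simp add: mult_left_le)
      finally show ?thesis by simp
    qed
    ultimately show ?thesis by simp
  qed
  have "cmod (hp_weight \<delta> z) / cmod (hp_weight \<delta> (of_real r * z)) \<le> (E * a powr Re \<delta>) / (inverse E * b powr Re \<delta>)"
    using norm_powr_upper[OF nz, of \<delta>] norm_powr_lower[OF nz', of \<delta>] b
    by (intro frac_le) (simp_all add: E_def a_def b_def exp_minus hp_weight_def)
  also have "\<dots> = E\<^sup>2 * (a / b) powr Re \<delta>"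
    using a b by (simp add: powr_divide power2_eq_square E_def field_simps)
  finally have 1: "(cmod (hp_weight \<delta> z) / cmod (hp_weight \<delta> (of_real r * z)))\<^sup>2 \<le> (E\<^sup>2 * (a / b) powr Re \<delta>)\<^sup>2"
    by (intro power_mono) simp_all
  have 2: "((a / b) powr Re \<delta>)\<^sup>2 \<le> 4 powr \<bar>Re \<delta>\<bar> * (1 + a powr (2 * Re \<delta>))"
  proof -
    have sq: "(t powr Re \<delta>)\<^sup>2 = t powr (2 * Re \<delta>)" for t
      by (simp add: power2_eq_square powr_add[symmetric])
    have four: "2 powr (2 * x) = 4 powr x" for x :: real
      by (simp add: powr_powr[symmetric])
    show ?thesis
    proof (cases "Re \<delta> \<ge> 0")
      case True
      have "(a / b) powr (2 * Re \<delta>) \<le> 2 powr (2 * Re \<delta>)"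
        using True a b ab by (intro powr_mono2) (simp_all add: field_simps)
      also have "\<dots> \<le> 4 powr \<bar>Re \<delta>\<bar> * (1 + a powr (2 * Re \<delta>))"
        using True by (simp add: four)
      finally show ?thesis by (simp add: sq)
    next
      case False
      have "(a / b) powr (2 * Re \<delta>) = a powr (2 * Re \<delta>) * b powr (- (2 * Re \<delta>))"
        using a b by (simp add: powr_divide powr_minus field_simps)
      also have "\<dots> \<le> a powr (2 * Re \<delta>) * 2 powr (2 * \<bar>Re \<delta>\<bar>)"
        using False b b2 by (intro mult_left_mono) (auto intro: powr_mono2)
      also have "\<dots> \<le> 4 powr \<bar>Re \<delta>\<bar> * (1 + a powr (2 * Re \<delta>))"
        unfolding four by (simp add: algebra_simps)
      finally show ?thesis by (simp add: sq)
    qed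
  qed
  have "(E\<^sup>2 * (a / b) powr Re \<delta>)\<^sup>2 = exp (4 * pi * \<bar>Im \<delta>\<bar>) * ((a / b) powr Re \<delta>)\<^sup>2"
    by (simp add: power_mult_distrib E_def exp_of_nat_mult[symmetric] power_mult[symmetric] mult.assoc)
  also have "\<dots> \<le> exp (4 * pi * \<bar>Im \<delta>\<bar>) * (4 powr \<bar>Re \<delta>\<bar> * (1 + a powr (2 * Re \<delta>)))"
    by (intro mult_left_mono 2) simp
  finally show ?thesis using 1 unfolding a_def mult.assoc by (rule order_trans[rotated])
qed

lemma dilation_in_disc:
  fixes r :: real and z :: complex
  assumes "0 < r" "r < 1" "z \<in> unit_disc"
  shows "of_real r * z \<in> unit_disc"
proof -
  have "r * cmod z < 1 * 1" using assms by (intro mult_strict_mono') auto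
  then show ?thesis using assms(1) by (simp add: norm_mult)
qed

lemma dilation_poly_approx:
  assumes f: "f holomorphic_on unit_disc" and r: "0 < r" "r < 1" and e: "e > 0"
  shows "\<exists>p. \<forall>z\<in>unit_disc. cmod (f (of_real r * z) - poly p z) < e"
proof -
  define a where "a k = (deriv ^^ k) f 0 / fact k" for k
  have fs: "(\<lambda>j. a j * z ^ j) sums f z" if "z \<in> unit_disc" for z
    using holomorphic_power_series[OF f that] by (simp add: a_def)
  obtain s where s: "r < s" "s < 1" using r dense by blast
  have "summable (\<lambda>j. a j * of_real s ^ j)"
    using fs[of "of_real s"] s r by (auto simp: sums_iff)
  then have "ereal (norm (of_real s :: complex)) \<le> conv_radius a"
    by (rule conv_radius_geI)
  then have "ereal r < conv_radius a" using s r less_le_trans[of "ereal r" "ereal s"] by simp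
  from powser_uniform_limit[OF this, of 0]
  have "uniform_limit (cball 0 r) (\<lambda>n x. \<Sum>i<n. a i * (x - 0) ^ i) (\<lambda>x. \<Sum>i. a i * (x - 0) ^ i) sequentially" .
  from uniform_limitD[OF this e]
  obtain n where n: "\<And>x. x \<in> cball 0 r \<Longrightarrow> dist (\<Sum>i<n. a i * (x - 0) ^ i) (\<Sum>i. a i * (x - 0) ^ i) < e"
    unfolding eventually_sequentially by blast
  define p where "p = (\<Sum>i<n. Polynomial.monom (a i * of_real r ^ i) i)"
  have "cmod (f (of_real r * z) - poly p z) < e" if z: "z \<in> unit_disc" for z
  proof -
    have rz: "cmod (of_real r * z) \<le> r" using z r by (simp add: norm_mult mult_left_le)
    then have "of_real r * z \<in> unit_disc" using r by simp
    then have "f (of_real r * z) = (\<Sum>i. a i * (of_real r * z) ^ i)" using fs by (simp add: sums_iff)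
    moreover have "poly p z = (\<Sum>i<n. a i * (of_real r * z) ^ i)"
      by (simp add: p_def poly_sum poly_monom power_mult_distrib mult.assoc)
    ultimately show ?thesis using n[of "of_real r * z"] rz by (simp add: dist_norm norm_minus_commute)
  qed
  then show ?thesis by blast
qed

text \<open>Dominated convergence: the dilated functions multiplied by the weight are dominated uniformly in the
  dilation factor, even where \<open>f\<close> itself is unbounded.\<close>

lemma dilation_converges:
  assumes m: "m \<ge> 1" and \<delta>: "Re \<delta> > -1/2"
    and h: "h holomorphic_on unit_disc" and B: "\<And>z. z \<in> unit_disc \<Longrightarrow> cmod (h z) \<le> B"
    and \<rho>: "\<And>n. 0 < \<rho> n" "\<And>n. \<rho> n < 1" "\<rho> \<longlonglongrightarrow> 1"
  defines "f \<equiv> \<lambda>z. h z / hp_weight \<delta> z"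
  shows "(\<lambda>n. \<integral>z. (cmod (f (of_real (\<rho> n) * z) - f z))\<^sup>2 \<partial>hp_measure m \<delta>) \<longlonglongrightarrow> 0"
proof -
  have fh: "f holomorphic_on unit_disc"
    unfolding f_def by (intro holomorphic_on_divide h holomorphic_hp_weight hp_weight_nonzero)
  have fc: "continuous_on unit_disc f" by (rule holomorphic_on_imp_continuous_on[OF fh])
  have rz: "of_real (\<rho> n) * z \<in> unit_disc" if "z \<in> unit_disc" for n z
    by (rule dilation_in_disc[OF \<rho>(1,2) that])
  have fnm [measurable]: "(\<lambda>z. f (of_real (\<rho> n) * z)) \<in> borel_measurable (bergman_measure m)" for n
    by (intro borel_measurable_bergman_continuous continuous_on_compose2[OF fc] continuous_intros)
       (use rz in auto)
  have fm [measurable]: "f \<in> borel_measurable (bergman_measure m)"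
    by (rule borel_measurable_bergman_continuous[OF fc])
  define C where "C = exp (4 * pi * \<bar>Im \<delta>\<bar>) * 4 powr \<bar>Re \<delta>\<bar>"
  define W where "W z = pi / real m * (2 * B\<^sup>2 * (C * (1 + cmod (1 - z) powr (2 * Re \<delta>))) + 2 * B\<^sup>2)" for z
  interpret prob_space "bergman_measure m" by (rule prob_space_bergman_measure[OF m])
  have Wi: "integrable (bergman_measure m) W"
    unfolding W_def[abs_def]
    using integrable_powr_weight[OF m, of "2 * Re \<delta>"] \<delta> by simp
  have dom: "pi / real m * (cmod (hp_weight \<delta> z))\<^sup>2 * (cmod (f (of_real (\<rho> n) * z) - f z))\<^sup>2 \<le> W z"
    if z: "z \<in> unit_disc" for z n
  proof -
    define g where "g = cmod (hp_weight \<delta> z)"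
    define g' where "g' = cmod (hp_weight \<delta> (of_real (\<rho> n) * z))"
    have g: "g > 0" "g' > 0" using hp_weight_nonzero z rz[OF z] by (auto simp: g_def g'_def)
    have "g\<^sup>2 * (cmod (f (of_real (\<rho> n) * z) - f z))\<^sup>2
        \<le> g\<^sup>2 * (2 * (cmod (f (of_real (\<rho> n) * z)))\<^sup>2 + 2 * (cmod (f z))\<^sup>2)"
      by (intro mult_left_mono sq_norm_diff_le) simp
    also have "\<dots> = 2 * ((cmod (h (of_real (\<rho> n) * z)))\<^sup>2 * (g / g')\<^sup>2) + 2 * (cmod (h z))\<^sup>2"
      using g by (simp add: f_def norm_divide power_divide g_def g'_def field_simps)
    also have "\<dots> \<le> 2 * (B\<^sup>2 * (C * (1 + cmod (1 - z) powr (2 * Re \<delta>)))) + 2 * B\<^sup>2"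
    proof (intro add_mono mult_left_mono mult_mono)
      show "(g / g')\<^sup>2 \<le> C * (1 + cmod (1 - z) powr (2 * Re \<delta>))"
        using weight_dilation_bound[OF z, of "\<rho> n" \<delta>] \<rho>(1,2)[of n] by (simp add: g_def g'_def C_def)
      show "(cmod (h (of_real (\<rho> n) * z)))\<^sup>2 \<le> B\<^sup>2" "(cmod (h z))\<^sup>2 \<le> B\<^sup>2"
        using B[OF z] B[OF rz[OF z]] by (auto intro: power_mono)
    qed simp_all
    finally have "g\<^sup>2 * (cmod (f (of_real (\<rho> n) * z) - f z))\<^sup>2
        \<le> 2 * B\<^sup>2 * (C * (1 + cmod (1 - z) powr (2 * Re \<delta>))) + 2 * B\<^sup>2" by simp
    from mult_left_mono[OF this, of "pi / real m"] show ?thesis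
      by (simp add: W_def g_def mult.assoc)
  qed
  have "(\<lambda>n. \<integral>z. pi / real m * (cmod (hp_weight \<delta> z))\<^sup>2 * (cmod (f (of_real (\<rho> n) * z) - f z))\<^sup>2 \<partial>bergman_measure m)
      \<longlonglongrightarrow> (\<integral>z. 0 \<partial>bergman_measure m)"
  proof (rule integral_dominated_convergence[where w = W])
    show "AE z in bergman_measure m. (\<lambda>n. pi / real m * (cmod (hp_weight \<delta> z))\<^sup>2 *
        (cmod (f (of_real (\<rho> n) * z) - f z))\<^sup>2) \<longlonglongrightarrow> 0"
    proof (intro AE_I2)
      fix z assume "z \<in> space (bergman_measure m)"
      then have z: "z \<in> unit_disc" by simp
      have "(\<lambda>n. of_real (\<rho> n) * z) \<longlonglongrightarrow> of_real 1 * z"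
        by (intro tendsto_intros \<rho>)
      then have "(\<lambda>n. f (of_real (\<rho> n) * z)) \<longlonglongrightarrow> f z"
        using fc z rz[OF z] by (intro continuous_on_tendsto_compose[OF fc]) auto
      then have "(\<lambda>n. pi / real m * (cmod (hp_weight \<delta> z))\<^sup>2 * (cmod (f (of_real (\<rho> n) * z) - f z))\<^sup>2)
          \<longlonglongrightarrow> pi / real m * (cmod (hp_weight \<delta> z))\<^sup>2 * (cmod (f z - f z))\<^sup>2"
        by (intro tendsto_intros)
      then show "(\<lambda>n. pi / real m * (cmod (hp_weight \<delta> z))\<^sup>2 *
        (cmod (f (of_real (\<rho> n) * z) - f z))\<^sup>2) \<longlonglongrightarrow> 0" by simp
    qed
    show "AE z in bergman_measure m. norm (pi / real m * (cmod (hp_weight \<delta> z))\<^sup>2 *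
        (cmod (f (of_real (\<rho> n) * z) - f z))\<^sup>2) \<le> W z" for n
      by (intro AE_I2) (use dom in \<open>simp add: abs_of_nonneg\<close>)
    show "(\<lambda>z. pi / real m * (cmod (hp_weight \<delta> z))\<^sup>2 * (cmod (f (of_real (\<rho> n) * z) - f z))\<^sup>2)
        \<in> borel_measurable (bergman_measure m)" for n
      by measurable
  qed (simp_all add: Wi)
  moreover have "(\<integral>z. (cmod (f (of_real (\<rho> n) * z) - f z))\<^sup>2 \<partial>hp_measure m \<delta>) =
      (\<integral>z. pi / real m * (cmod (hp_weight \<delta> z))\<^sup>2 * (cmod (f (of_real (\<rho> n) * z) - f z))\<^sup>2 \<partial>bergman_measure m)" for n
    by (subst integral_hp[OF m]) simp_all
  ultimately show ?thesis by simp
qed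

lemma square_integrable_hp_quotient:
  assumes m: "m \<ge> 1" and h: "h \<in> borel_measurable (bergman_measure m)"
    and B: "\<And>z. z \<in> unit_disc \<Longrightarrow> cmod (h z) \<le> B"
  shows "square_integrable (hp_measure m \<delta>) (\<lambda>z. h z / hp_weight \<delta> z)"
proof -
  note h [measurable]
  have "integrable (bergman_measure m) (\<lambda>z. pi / real m * (cmod (hp_weight \<delta> z))\<^sup>2 * (cmod (h z / hp_weight \<delta> z))\<^sup>2)"
  proof (rule integrable_bergman_bounded[OF m, where B = "pi / real m * B\<^sup>2"])
    fix z assume z: "z \<in> unit_disc"
    have "pi / real m * (cmod (h z))\<^sup>2 \<le> pi / real m * B\<^sup>2"
      using B[OF z] by (intro mult_left_mono power_mono) auto
    then show "norm (pi / real m * (cmod (hp_weight \<delta> z))\<^sup>2 * (cmod (h z / hp_weight \<delta> z))\<^sup>2) \<le> pi / real m * B\<^sup>2"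
      using hp_weight_nonzero[OF z, of \<delta>] by (simp add: norm_divide power_divide)
  qed measurable
  then show ?thesis
    using m by (simp add: square_integrable_def borel_measurable_hp_iff integrable_hp_iff)
qed

text \<open>The function need not extend to the closed disc, but its dilations do: a dilation is close in \<open>L\<^sup>2\<close>, and
  its Taylor polynomials are uniformly close to it.\<close>

lemma hp_poly_dense:
  assumes m: "m \<ge> 1" and \<delta>: "Re \<delta> > -1/2"
    and h: "h holomorphic_on unit_disc" and B: "\<And>z. z \<in> unit_disc \<Longrightarrow> cmod (h z) \<le> B" and e: "e > 0"
  shows "\<exists>p. (\<integral>z. (cmod (h z / hp_weight \<delta> z - poly p z))\<^sup>2 \<partial>hp_measure m \<delta>) < e"
proof -
  define f where "f z = h z / hp_weight \<delta> z" for z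
  define \<rho> where "\<rho> n = real (Suc n) / real (Suc (Suc n))" for n
  have \<rho>: "0 < \<rho> n" "\<rho> n < 1" for n by (simp_all add: \<rho>_def)
  have \<rho>_lim: "\<rho> \<longlonglongrightarrow> 1" unfolding \<rho>_def[abs_def]
    using LIMSEQ_Suc[OF LIMSEQ_n_over_Suc_n[where 'a=real]] by simp
  interpret finite_measure "hp_measure m \<delta>" by (rule finite_measure_hp[OF m \<delta>])
  define V where "V = measure (hp_measure m \<delta>) unit_disc"
  have fh: "f holomorphic_on unit_disc"
    unfolding f_def by (intro holomorphic_on_divide h holomorphic_hp_weight hp_weight_nonzero)
  have fsq: "square_integrable (hp_measure m \<delta>) f"
    unfolding f_def[abs_def]
    by (rule square_integrable_hp_quotient[OF m _ B])
       (intro borel_measurable_bergman_continuous holomorphic_on_imp_continuous_on h)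
  have "(\<lambda>n. \<integral>z. (cmod (f (of_real (\<rho> n) * z) - f z))\<^sup>2 \<partial>hp_measure m \<delta>) \<longlonglongrightarrow> 0"
    using dilation_converges[OF m \<delta> h B \<rho> \<rho>_lim] by (simp add: f_def)
  from order_tendstoD(2)[OF this, of "e / 4"] e
  obtain n where n: "(\<integral>z. (cmod (f (of_real (\<rho> n) * z) - f z))\<^sup>2 \<partial>hp_measure m \<delta>) < e / 4"
    by (auto simp: eventually_sequentially)
  define f' where "f' z = f (of_real (\<rho> n) * z)" for z
  have V: "V \<ge> 0" by (simp add: V_def)
  \<comment> \<open>A uniform error \<open>\<epsilon>\<close> costs at most \<open>\<epsilon>\<^sup>2 * V \<le> e / 4\<close> in the squared norm.\<close>
  define \<epsilon> where "\<epsilon> = sqrt (e / (4 * (V + 1)))"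
  have \<epsilon>: "\<epsilon> > 0" using e V by (simp add: \<epsilon>_def)
  obtain p where p: "\<And>z. z \<in> unit_disc \<Longrightarrow> cmod (f' z - poly p z) < \<epsilon>"
    using dilation_poly_approx[OF fh \<rho> \<epsilon>, of n] unfolding f'_def by blast
  interpret pm: polynomial_measure "hp_measure m \<delta>" by (rule polynomial_measure_hp[OF m \<delta>])
  have rz: "of_real (\<rho> n) * z \<in> unit_disc" if "z \<in> unit_disc" for z
    by (rule dilation_in_disc[OF \<rho> that])
  have f'm: "f' \<in> borel_measurable (bergman_measure m)"
    unfolding f'_def[abs_def]
    by (intro borel_measurable_bergman_continuous
          continuous_on_compose2[OF holomorphic_on_imp_continuous_on[OF fh]] continuous_intros)
       (use rz in auto)
  have d2: "square_integrable (hp_measure m \<delta>) (\<lambda>z. f' z - poly p z)"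
  proof (rule square_integrable_hp_bounded[OF m \<delta>])
    show "(\<lambda>z. f' z - poly p z) \<in> borel_measurable (bergman_measure m)"
      using f'm pm.square_integrable_poly[of p]
      by (intro borel_measurable_diff) (simp_all add: square_integrable_def borel_measurable_hp_iff)
    show "cmod (f' z - poly p z) \<le> \<epsilon>" if "z \<in> unit_disc" for z using p[OF that] by simp
  qed
  have d1: "square_integrable (hp_measure m \<delta>) (\<lambda>z. f z - f' z)"
    using square_integrable_diff[OF square_integrable_diff[OF fsq pm.square_integrable_poly[of p]] d2] by simp
  have "(\<integral>z. (cmod (f z - poly p z))\<^sup>2 \<partial>hp_measure m \<delta>) \<le>
      (\<integral>z. 2 * (cmod (f z - f' z))\<^sup>2 + 2 * (cmod (f' z - poly p z))\<^sup>2 \<partial>hp_measure m \<delta>)"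
  proof (rule integral_mono)
    show "integrable (hp_measure m \<delta>) (\<lambda>z. (cmod (f z - poly p z))\<^sup>2)"
      using square_integrable_diff[OF fsq pm.square_integrable_poly[of p]] by (simp add: square_integrable_def)
    show "integrable (hp_measure m \<delta>) (\<lambda>z. 2 * (cmod (f z - f' z))\<^sup>2 + 2 * (cmod (f' z - poly p z))\<^sup>2)"
      using d1 d2 by (simp add: square_integrable_def)
    show "(cmod (f z - poly p z))\<^sup>2 \<le> 2 * (cmod (f z - f' z))\<^sup>2 + 2 * (cmod (f' z - poly p z))\<^sup>2" for z
      using sq_norm_diff_le[of "f z - f' z" "poly p z - f' z"] by (simp add: norm_minus_commute)
  qed
  also have "\<dots> = 2 * (\<integral>z. (cmod (f' z - f z))\<^sup>2 \<partial>hp_measure m \<delta>) + 2 * (\<integral>z. (cmod (f' z - poly p z))\<^sup>2 \<partial>hp_measure m \<delta>)"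
    using d1 d2 by (simp add: square_integrable_def norm_minus_commute)
  also have "(\<integral>z. (cmod (f' z - poly p z))\<^sup>2 \<partial>hp_measure m \<delta>) \<le> (\<integral>z. \<epsilon>\<^sup>2 \<partial>hp_measure m \<delta>)"
  proof (rule integral_mono)
    show "integrable (hp_measure m \<delta>) (\<lambda>z. (cmod (f' z - poly p z))\<^sup>2)" using d2 by (simp add: square_integrable_def)
    show "(cmod (f' z - poly p z))\<^sup>2 \<le> \<epsilon>\<^sup>2" if "z \<in> space (hp_measure m \<delta>)" for z
      using p[of z] that by (intro power_mono) simp_all
  qed simp
  also have "(\<integral>z. \<epsilon>\<^sup>2 \<partial>hp_measure m \<delta>) = V * (e / (4 * (V + 1)))"
    using e V by (simp add: V_def \<epsilon>_def)
  also have "V * (e / (4 * (V + 1))) \<le> e / 4"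
    using e V by (simp add: field_simps)
  finally have "(\<integral>z. (cmod (f z - poly p z))\<^sup>2 \<partial>hp_measure m \<delta>) < e"
    using n by (simp add: f'_def)
  then show ?thesis unfolding f_def by blast
qed

section \<open>The limiting kernel\<close>

lemma bergman_kernel_cnj: "cnj (bergman_kernel m z w) = bergman_kernel m w z"
  by (simp add: bergman_kernel_def mult.commute)

lemma bergman_kernel_holomorphic:
  assumes "w \<in> unit_disc"
  shows "(\<lambda>z. bergman_kernel m z w) holomorphic_on unit_disc"
  unfolding bergman_kernel_def
proof (intro holomorphic_intros)
  fix z assume "z \<in> unit_disc"
  then have "cmod z * cmod w < 1 * 1" using assms by (intro mult_strict_mono') auto
  then have "z * cnj w \<noteq> 1" by (metis complex_mod_cnj norm_mult norm_one mult_1 less_irrefl)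
  then show "(1 - z * cnj w) ^ (m + 1) \<noteq> 0" by simp
qed

text \<open>Multiplication by \<^term>\<open>hp_weight \<delta>\<close> turns the inner product of \<^term>\<open>hp_measure m \<delta>\<close> into that of
  \<^term>\<open>bergman_measure m\<close> up to the factor \<open>pi / m\<close>, and it preserves holomorphy since the weight has
  no zeros. Hence the reproducing kernel is the Bergman kernel divided by the weight in both
  variables.\<close>

theorem hp_kernel_tendsto:
  assumes m: "m \<ge> 1" and \<delta>: "Re \<delta> > -1/2" and z: "z \<in> unit_disc" and w: "w \<in> unit_disc"
  shows "(\<lambda>n. hp_kernel m \<delta> n z w) \<longlonglongrightarrow>
    of_real (real m / pi) * bergman_kernel m z w / (hp_weight \<delta> z * cnj (hp_weight \<delta> w))"
proof -
  define c where "c = complex_of_real (real m / pi)"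
  define h where "h w z = c * bergman_kernel m z w / cnj (hp_weight \<delta> w)" for w z
  define k where "k w z = h w z / hp_weight \<delta> z" for w z
  interpret pm: polynomial_measure "hp_measure m \<delta>" by (rule polynomial_measure_hp[OF m \<delta>])
  have hh: "h w holomorphic_on unit_disc" if "w \<in> unit_disc" for w
    unfolding h_def[abs_def]
    using bergman_kernel_holomorphic[OF that, of m] hp_weight_nonzero[OF that, of \<delta>]
    by (intro holomorphic_on_divide holomorphic_on_mult holomorphic_on_const) simp_all
  have hb: "\<exists>B. \<forall>z\<in>unit_disc. cmod (h w z) \<le> B" if w: "w \<in> unit_disc" for w
  proof (intro exI ballI)
    fix z assume "z \<in> unit_disc"
    then have "cmod (bergman_kernel m z w) \<le> 1 / (1 - cmod w) ^ (m + 1)"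
      using w by (intro bergman_kernel_bound) auto
    then show "cmod (h w z) \<le> cmod c * (1 / (1 - cmod w) ^ (m + 1)) / cmod (hp_weight \<delta> w)"
      unfolding h_def norm_divide norm_mult complex_mod_cnj
      by (intro divide_right_mono mult_left_mono) auto
  qed
  have kh: "k w holomorphic_on unit_disc" if "w \<in> unit_disc" for w
    unfolding k_def[abs_def] using hh[OF that] holomorphic_hp_weight hp_weight_nonzero
    by (intro holomorphic_on_divide) simp_all
  have ksq: "square_integrable (hp_measure m \<delta>) (k w)" if w: "w \<in> unit_disc" for w
  proof -
    from hb[OF w] obtain B where B: "\<And>z. z \<in> unit_disc \<Longrightarrow> cmod (h w z) \<le> B" by blast
    show ?thesis unfolding k_def[abs_def]
      by (rule square_integrable_hp_quotient[OF m _ B])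
         (intro borel_measurable_bergman_continuous holomorphic_on_imp_continuous_on hh[OF w])
  qed
  have rep: "l2_prod (hp_measure m \<delta>) f (k w) = f w"
    if f: "f holomorphic_on unit_disc" and fsq: "square_integrable (hp_measure m \<delta>) f" and w: "w \<in> unit_disc" for f w
  proof -
    define F where "F z = f z * hp_weight \<delta> z" for z
    have Fh: "F holomorphic_on unit_disc"
      unfolding F_def[abs_def] by (intro holomorphic_on_mult f holomorphic_hp_weight)
    have fm: "f \<in> borel_measurable (bergman_measure m)"
      using fsq by (simp add: square_integrable_def borel_measurable_hp_iff)
    note fm[measurable]
    have Fi: "integrable (bergman_measure m) F"
    proof (rule Bochner_Integration.integrable_bound)
      interpret prob_space "bergman_measure m" by (rule prob_space_bergman_measure[OF m])
      have "integrable (bergman_measure m) (\<lambda>z. pi / real m * (cmod (hp_weight \<delta> z))\<^sup>2 * (cmod (f z))\<^sup>2)"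
        using fsq m by (simp add: square_integrable_def integrable_hp_iff)
      from integrable_mult_right[OF this, of "real m / pi"]
      show "integrable (bergman_measure m) (\<lambda>z. 1 + (cmod (F z))\<^sup>2)"
        using m by (simp add: F_def norm_mult power_mult_distrib mult.commute)
      show "F \<in> borel_measurable (bergman_measure m)"
        unfolding F_def[abs_def] by measurable
      have "t \<le> 1 + t\<^sup>2" for t :: real
      proof -
        have "2 * t \<le> 1 + t\<^sup>2" using sum_squares_bound[of 1 t] by simp
        then show ?thesis using zero_le_power2[of t] by linarith
      qed
      then show "AE z in bergman_measure m. norm (F z) \<le> norm (1 + (cmod (F z))\<^sup>2)"
        by (intro AE_I2) (simp add: abs_of_nonneg)
    qed
    have km: "k w \<in> borel_measurable (bergman_measure m)"
      using ksq[OF w] by (simp add: square_integrable_def borel_measurable_hp_iff)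
    have "l2_prod (hp_measure m \<delta>) f (k w) =
        (\<integral>z. (pi / real m * (cmod (hp_weight \<delta> z))\<^sup>2) *\<^sub>R (f z * cnj (k w z)) \<partial>bergman_measure m)"
      unfolding l2_prod_def by (intro integral_hp m borel_measurable_times borel_measurable_cnj fm km)
    also have "\<dots> = (\<integral>z. F z * bergman_kernel m w z / hp_weight \<delta> w \<partial>bergman_measure m)"
    proof (rule Bochner_Integration.integral_cong[OF refl])
      fix z assume "z \<in> space (bergman_measure m)"
      then have g: "hp_weight \<delta> z \<noteq> 0" using hp_weight_nonzero by simp
      have "(pi / real m * (cmod (hp_weight \<delta> z))\<^sup>2) *\<^sub>R (f z * cnj (k w z)) =
          (of_real (pi / real m) * c) * (f z * (hp_weight \<delta> z * cnj (hp_weight \<delta> z)) * bergman_kernel m w z /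
            (hp_weight \<delta> w * cnj (hp_weight \<delta> z)))"
        unfolding scaleR_conv_of_real of_real_mult complex_norm_square k_def h_def
        by (simp add: bergman_kernel_cnj c_def field_simps)
      also have "of_real (pi / real m) * c = 1"
        using m by (simp add: c_def)
      finally show "(pi / real m * (cmod (hp_weight \<delta> z))\<^sup>2) *\<^sub>R (f z * cnj (k w z)) =
          F z * bergman_kernel m w z / hp_weight \<delta> w"
        using g by (simp add: F_def field_simps)
    qed
    also have "\<dots> = F w / hp_weight \<delta> w"
      using bergman_reproducing[OF m Fh Fi w] by simp
    also have "\<dots> = f w" using hp_weight_nonzero[OF w] by (simp add: F_def)
    finally show ?thesis .
  qed
  have "(\<lambda>n. \<Sum>j<n. poly (pm.P j) z * cnj (poly (pm.P j) w)) \<longlonglongrightarrow> k w z"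
  proof (rule pm.gram_schmidt_kernel_tendsto[where S = unit_disc])
    show "\<exists>p. (\<integral>z. (cmod (k w z - poly p z))\<^sup>2 \<partial>hp_measure m \<delta>) < e" if w: "w \<in> unit_disc" and e: "e > 0" for w and e :: real
    proof -
      from hb[OF w] obtain B where B: "\<And>z. z \<in> unit_disc \<Longrightarrow> cmod (h w z) \<le> B" by blast
      show ?thesis unfolding k_def by (rule hp_poly_dense[OF m \<delta> hh[OF w] B e])
    qed
    show "l2_prod (hp_measure m \<delta>) (poly p) (k w) = poly p w" if "w \<in> unit_disc" for p w
      using that by (intro rep pm.square_integrable_poly holomorphic_intros)
    show "l2_prod (hp_measure m \<delta>) (k v) (k w) = k v w" if "v \<in> unit_disc" "w \<in> unit_disc" for v w
      using that by (intro rep ksq kh)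
  qed (use z w ksq in auto)
  then show ?thesis
    by (simp add: hp_kernel_def k_def h_def c_def field_simps)
qed

corollary hp_limit_kernel_eq:
  assumes "m \<ge> 1" "Re \<delta> > -1/2" "z \<in> unit_disc" "w \<in> unit_disc"
  shows "hp_limit_kernel m \<delta> z w =
    of_real (real m / pi) * bergman_kernel m z w / (hp_weight \<delta> z * cnj (hp_weight \<delta> w))"
  unfolding hp_limit_kernel_def by (rule limI[OF hp_kernel_tendsto[OF assms]])

section \<open>Gauge changes of a determinantal process\<close>

lemma PiM_density:
  fixes f :: "'a \<Rightarrow> ennreal"
  assumes \<mu>: "sigma_finite_measure \<mu>" and f [measurable]: "f \<in> borel_measurable \<mu>"
    and d: "sigma_finite_measure (density \<mu> f)" and I: "finite I"
  shows "(\<Pi>\<^sub>M i\<in>I. density \<mu> f) = density (\<Pi>\<^sub>M i\<in>I. \<mu>) (\<lambda>x. \<Prod>i\<in>I. f (x i))"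
proof -
  interpret P: product_sigma_finite "\<lambda>_. \<mu>" by (simp add: product_sigma_finite_def \<mu>)
  interpret D: product_sigma_finite "\<lambda>_. density \<mu> f" by (simp add: product_sigma_finite_def d)
  have fm: "(\<lambda>x. \<Prod>i\<in>I. f (x i)) \<in> borel_measurable (\<Pi>\<^sub>M i\<in>I. \<mu>)"
    by (intro borel_measurable_prod_ennreal, rule measurable_compose[OF _ f], rule measurable_component_singleton)
  show ?thesis
  proof (rule D.PiM_eqI[OF I, symmetric])
    show "sets (density (\<Pi>\<^sub>M i\<in>I. \<mu>) (\<lambda>x. \<Prod>i\<in>I. f (x i))) = sets (\<Pi>\<^sub>M i\<in>I. density \<mu> f)"
      by (simp cong: sets_PiM_cong)
    fix A assume "\<And>i. i \<in> I \<Longrightarrow> A i \<in> sets (density \<mu> f)"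
    then have A: "\<And>i. i \<in> I \<Longrightarrow> A i \<in> sets \<mu>" by simp
    then have "PiE I A \<in> sets (\<Pi>\<^sub>M i\<in>I. \<mu>)" using I by (intro sets_PiM_I_finite) auto
    then have "emeasure (density (\<Pi>\<^sub>M i\<in>I. \<mu>) (\<lambda>x. \<Prod>i\<in>I. f (x i))) (PiE I A) =
        (\<integral>\<^sup>+x. (\<Prod>i\<in>I. f (x i)) * indicator (PiE I A) x \<partial>(\<Pi>\<^sub>M i\<in>I. \<mu>))"
      by (rule emeasure_density[OF fm])
    also have "\<dots> = (\<integral>\<^sup>+x. (\<Prod>i\<in>I. f (x i) * indicator (A i) (x i)) \<partial>(\<Pi>\<^sub>M i\<in>I. \<mu>))"
    proof (rule nn_integral_cong)
      fix x assume "x \<in> space (\<Pi>\<^sub>M i\<in>I. \<mu>)"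
      then have x: "x \<in> extensional I" by (simp add: space_PiM PiE_def)
      have "(indicator (PiE I A) x :: ennreal) = (\<Prod>i\<in>I. indicator (A i) (x i))"
      proof (cases "\<forall>i\<in>I. x i \<in> A i")
        case True then show ?thesis using x by (simp add: PiE_iff)
      next
        case False
        then have "(\<Prod>i\<in>I. indicator (A i) (x i)) = (0 :: ennreal)"
          using I False by (intro prod_zero) (auto simp: indicator_def)
        then show ?thesis using False by (auto simp: indicator_def)
      qed
      then show "(\<Prod>i\<in>I. f (x i)) * indicator (PiE I A) x = (\<Prod>i\<in>I. f (x i) * indicator (A i) (x i))"
        by (simp add: prod.distrib)
    qed
    also have "\<dots> = (\<Prod>i\<in>I. \<integral>\<^sup>+x. f x * indicator (A i) x \<partial>\<mu>)"
      by (rule P.product_nn_integral_prod[OF I]) (use A in measurable)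
    also have "\<dots> = (\<Prod>i\<in>I. emeasure (density \<mu> f) (A i))"
      by (intro prod.cong refl emeasure_density[symmetric] f A)
    finally show "emeasure (density (\<Pi>\<^sub>M i\<in>I. \<mu>) (\<lambda>x. \<Prod>i\<in>I. f (x i))) (PiE I A) =
        (\<Prod>i\<in>I. emeasure (density \<mu> f) (A i))" .
  qed
qed

lemma kernel_det_leibniz:
  "kernel_det K l x = (\<Sum>p | p permutes {0..<l}. signof p * (\<Prod>i = 0..<l. K (x i) (x (p i))))"
  unfolding kernel_det_def
proof (subst det_def'[OF mat_carrier], rule sum.cong[OF refl])
  fix p assume "p \<in> {p. p permutes {0..<l}}"
  then have "p i < l" if "i < l" for i using permutes_in_image[of p "{0..<l}" i] that by simp
  then show "signof p * (\<Prod>i = 0..<l. Matrix.mat l l (\<lambda>(i, j). K (x i) (x j)) $$ (i, p i)) =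
      signof p * (\<Prod>i = 0..<l. K (x i) (x (p i)))"
    by (intro arg_cong2[where f = "(*)"] refl prod.cong) simp
qed

text \<open>The matrix of the new kernel is the old one multiplied by a diagonal matrix on the left and by its
  adjoint on the right.\<close>

lemma kernel_det_gauge:
  assumes K': "\<And>i j. i < l \<Longrightarrow> j < l \<Longrightarrow> K' (x i) (x j) = K (x i) (x j) * (h (x i) * cnj (h (x j)))"
  shows "kernel_det K' l x = (\<Prod>i<l. of_real ((cmod (h (x i)))\<^sup>2)) * kernel_det K l x"
proof -
  have "kernel_det K' l x = (\<Sum>p | p permutes {0..<l}. signof p * (\<Prod>i = 0..<l. K' (x i) (x (p i))))"
    by (rule kernel_det_leibniz)
  also have "\<dots> = (\<Sum>p | p permutes {0..<l}. (\<Prod>i<l. of_real ((cmod (h (x i)))\<^sup>2)) *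
      (signof p * (\<Prod>i = 0..<l. K (x i) (x (p i)))))"
  proof (rule sum.cong[OF refl])
    fix p assume "p \<in> {p. p permutes {0..<l}}"
    then have p: "p permutes {0..<l}" by simp
    have "(\<Prod>i = 0..<l. K' (x i) (x (p i))) =
        (\<Prod>i = 0..<l. K (x i) (x (p i)) * (h (x i) * cnj (h (x (p i)))))"
      using permutes_in_image[OF p] by (intro prod.cong refl K') auto
    also have "\<dots> = (\<Prod>i = 0..<l. K (x i) (x (p i))) * ((\<Prod>i = 0..<l. h (x i)) * (\<Prod>i = 0..<l. cnj (h (x (p i)))))"
      by (simp add: prod.distrib)
    also have "(\<Prod>i = 0..<l. cnj (h (x (p i)))) = (\<Prod>i = 0..<l. cnj (h (x i)))"
      using prod.permute[OF p, of "\<lambda>i. cnj (h (x i))"] by (simp add: o_def)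
    also have "(\<Prod>i = 0..<l. h (x i)) * (\<Prod>i = 0..<l. cnj (h (x i))) = (\<Prod>i<l. of_real ((cmod (h (x i)))\<^sup>2))"
      unfolding complex_norm_square by (simp add: prod.distrib lessThan_atLeast0)
    finally show "signof p * (\<Prod>i = 0..<l. K' (x i) (x (p i))) = (\<Prod>i<l. of_real ((cmod (h (x i)))\<^sup>2)) *
      (signof p * (\<Prod>i = 0..<l. K (x i) (x (p i))))"
      by (simp add: mult_ac)
  qed
  also have "\<dots> = (\<Prod>i<l. of_real ((cmod (h (x i)))\<^sup>2)) * kernel_det K l x"
    unfolding kernel_det_leibniz by (rule sum_distrib_left[symmetric])
  finally show ?thesis .
qed

text \<open>The factor \<open>\<bar>h\<bar>\<^sup>2\<close> that the correlation functions gain at each point is cancelled by the density of the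
  new reference measure, so both sides of the moment identity are unchanged.\<close>

theorem determinantal_gauge:
  fixes E :: "'a::polish_space set"
  assumes det: "determinantal E M X K \<mu>"
    and h: "h \<in> borel_measurable (restrict_space borel E)" and h0: "\<And>x. x \<in> E \<Longrightarrow> h x \<noteq> 0"
    and K': "\<And>x y. x \<in> E \<Longrightarrow> y \<in> E \<Longrightarrow> K' x y = K x y * (h x * cnj (h y))"
    and \<mu>': "\<mu>' = density \<mu> (\<lambda>x. ennreal (1 / (cmod (h x))\<^sup>2))"
    and \<mu>_sf: "sigma_finite_measure \<mu>" and \<mu>'_sf: "sigma_finite_measure \<mu>'" and \<mu>'_radon: "radon_on E \<mu>'"
  shows "determinantal E M X K' \<mu>'"
  unfolding determinantal_def
proof (intro conjI allI impI \<mu>'_radon)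
  show "simple_point_process E M X" using det by (simp add: determinantal_def)
  have Km: "(\<lambda>(x, y). K x y) \<in> borel_measurable (restrict_space borel E \<Otimes>\<^sub>M restrict_space borel E)"
    using det by (simp add: determinantal_def)
  note h [measurable]
  have cm: "cnj \<in> borel_measurable borel" by (intro borel_measurable_continuous_onI continuous_intros)
  have "(\<lambda>p. h (fst p) * cnj (h (snd p))) \<in> borel_measurable (restrict_space borel E \<Otimes>\<^sub>M restrict_space borel E)"
    by (intro borel_measurable_times measurable_compose[OF _ cm] measurable_compose[OF measurable_fst h]
        measurable_compose[OF measurable_snd h])
  from borel_measurable_times[OF Km this]
  show "(\<lambda>(x, y). K' x y) \<in> borel_measurable (restrict_space borel E \<Otimes>\<^sub>M restrict_space borel E)"
    by (rule measurable_cong[THEN iffD1, rotated])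
       (auto simp: space_pair_measure space_restrict_space K')
  have sets_\<mu>: "sets \<mu> = sets (restrict_space borel E)"
    using det by (simp add: determinantal_def radon_on_def)
  have space_\<mu>: "space \<mu> = E"
    using sets_eq_imp_space_eq[OF sets_\<mu>] by (simp add: space_restrict_space)
  have h\<mu>: "h \<in> borel_measurable \<mu>" using h measurable_cong_sets[OF sets_\<mu> refl] by blast
  fix r :: nat and \<Delta> :: "nat \<Rightarrow> 'a set" and n :: "nat \<Rightarrow> nat"
  assume r: "1 \<le> r" and \<Delta>: "\<forall>k<r. \<Delta> k \<in> sets (restrict_space borel E) \<and> precompact_in E (\<Delta> k)"
    and disj: "disjoint_family_on \<Delta> {..<r}" and n: "\<forall>k<r. 1 \<le> n k"
  define l where "l = (\<Sum>k<r. n k)"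
  define P where "P = (\<Pi>\<^sub>M i\<in>{..<l}. \<mu>)"
  define A where "A = block_product r \<Delta> n"
  define w where "w x = (\<Prod>i<l. (cmod (h (x i)))\<^sup>2)" for x :: "nat \<Rightarrow> 'a"
  have D: "integrable M (\<lambda>\<omega>. factorial_count r \<Delta> n (X \<omega>))" "set_integrable P A (kernel_det K l)"
    "complex_of_real (\<integral>\<omega>. factorial_count r \<Delta> n (X \<omega>) \<partial>M) = (LINT x : A | P. kernel_det K l x)"
    using det r \<Delta> disj n unfolding determinantal_def P_def l_def A_def Let_def by blast+
  have spP: "x i \<in> E" if "x \<in> space P" "i < l" for x i
    using that by (auto simp: P_def space_PiM space_\<mu>)
  have wpos: "w x > 0" if "x \<in> space P" for x
    unfolding w_def by (intro prod_pos) (use h0 spP[OF that] in auto)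
  have hi [measurable]: "(\<lambda>x. h (x i)) \<in> borel_measurable P" if "i < l" for i
    unfolding P_def by (rule measurable_compose[OF _ h\<mu>], rule measurable_component_singleton) (use that in simp)
  have wm: "w \<in> borel_measurable P"
    unfolding w_def[abs_def]
    by (intro borel_measurable_prod borel_measurable_power measurable_compose[OF hi borel_measurable_norm]) simp
  have P': "(\<Pi>\<^sub>M i\<in>{..<l}. \<mu>') = density P (\<lambda>x. ennreal (1 / w x))"
  proof -
    have fm: "(\<lambda>x. ennreal (1 / (cmod (h x))\<^sup>2)) \<in> borel_measurable \<mu>" using h\<mu> by measurable
    have "(\<Pi>\<^sub>M i\<in>{..<l}. \<mu>') = density P (\<lambda>x. \<Prod>i<l. ennreal (1 / (cmod (h (x i)))\<^sup>2))"
      unfolding \<mu>' P_def by (rule PiM_density[OF \<mu>_sf fm \<mu>'_sf[unfolded \<mu>']]) simp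
    also have "(\<lambda>x. \<Prod>i<l. ennreal (1 / (cmod (h (x i)))\<^sup>2)) = (\<lambda>x. ennreal (1 / w x))"
      by (simp add: fun_eq_iff w_def prod_ennreal prod_dividef)
    finally show ?thesis .
  qed
  have gauge: "indicator A x *\<^sub>R kernel_det K' l x = w x *\<^sub>R (indicator A x *\<^sub>R kernel_det K l x)" if "x \<in> space P" for x
  proof -
    have "kernel_det K' l x = (\<Prod>i<l. of_real ((cmod (h (x i)))\<^sup>2)) * kernel_det K l x"
      by (rule kernel_det_gauge) (use spP[OF that] K' in auto)
    then show ?thesis by (simp add: w_def scaleR_conv_of_real)
  qed
  have Km': "(\<lambda>x. indicator A x *\<^sub>R kernel_det K l x) \<in> borel_measurable P"
    using D(2) unfolding set_integrable_def by (rule borel_measurable_integrable)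
  have Km'': "(\<lambda>x. indicator A x *\<^sub>R kernel_det K' l x) \<in> borel_measurable P"
    using borel_measurable_scaleR[OF wm Km'] gauge by (subst measurable_cong) auto
  have canc: "(1 / w x) *\<^sub>R (indicator A x *\<^sub>R kernel_det K' l x) = indicator A x *\<^sub>R kernel_det K l x" if "x \<in> space P" for x
    using gauge[OF that] wpos[OF that] by simp
  have w': "(\<lambda>x. 1 / w x) \<in> borel_measurable P" using wm by measurable
  have wnn: "AE x in P. 0 \<le> 1 / w x" using wpos by (intro AE_I2) (simp add: less_imp_le)
  have "set_integrable (\<Pi>\<^sub>M i\<in>{..<l}. \<mu>') A (kernel_det K' l)"
    unfolding set_integrable_def P'
    by (subst integrable_density[OF Km'' w' wnn], subst Bochner_Integration.integrable_cong[OF refl canc])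
       (use D(2) in \<open>auto simp: set_integrable_def\<close>)
  moreover have "(LINT x : A | (\<Pi>\<^sub>M i\<in>{..<l}. \<mu>'). kernel_det K' l x) = (LINT x : A | P. kernel_det K l x)"
    unfolding set_lebesgue_integral_def P'
    by (subst integral_density[OF Km'' w' wnn]) (rule Bochner_Integration.integral_cong[OF refl canc])
  ultimately show "let l = (\<Sum>k<r. n k); \<mu>l = (\<Pi>\<^sub>M i\<in>{..<l}. \<mu>') in
           integrable M (\<lambda>\<omega>. factorial_count r \<Delta> n (X \<omega>)) \<and>
           set_integrable \<mu>l (block_product r \<Delta> n) (kernel_det K' l) \<and>
           complex_of_real (\<integral>\<omega>. factorial_count r \<Delta> n (X \<omega>) \<partial>M) =
             (LINT x : block_product r \<Delta> n | \<mu>l. kernel_det K' l x)"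
    using D(1,3) unfolding Let_def l_def[symmetric] A_def[symmetric] by simp
qed

section \<open>Determinants of positive semidefinite matrices\<close>

lemma trace_conjugate:
  fixes B :: "'a::comm_ring_1 mat"
  assumes B: "B \<in> carrier_mat n n" and P: "P \<in> carrier_mat n n" and Q: "Q \<in> carrier_mat n n"
    and QP: "Q * P = 1\<^sub>m n"
  shows "(\<Sum>i<n. (P * B * Q) $$ (i, i)) = (\<Sum>i<n. B $$ (i, i))"
proof -
  have tr: "(\<Sum>i<n. (X * Y) $$ (i, i)) = (\<Sum>i<n. (Y * X) $$ (i, i))"
    if X: "X \<in> carrier_mat n n" and Y: "Y \<in> carrier_mat n n" for X Y :: "'a mat"
  proof -
    have "(\<Sum>i<n. (X * Y) $$ (i, i)) = (\<Sum>i<n. \<Sum>j<n. X $$ (i, j) * Y $$ (j, i))"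
      using X Y by (auto simp: scalar_prod_def lessThan_atLeast0 intro!: sum.cong)
    also have "\<dots> = (\<Sum>j<n. \<Sum>i<n. Y $$ (j, i) * X $$ (i, j))"
      by (subst sum.swap) (simp add: mult.commute)
    also have "\<dots> = (\<Sum>i<n. (Y * X) $$ (i, i))"
      using X Y by (auto simp: scalar_prod_def lessThan_atLeast0 intro!: sum.cong)
    finally show ?thesis .
  qed
  have "(\<Sum>i<n. (P * B * Q) $$ (i, i)) = (\<Sum>i<n. (Q * (P * B)) $$ (i, i))"
    using B P Q by (intro tr) auto
  also have "Q * (P * B) = Q * P * B"
    using B P Q by (simp add: assoc_mult_mat[of Q n n P n B n])
  also have "\<dots> = B" using QP B by simp
  finally show ?thesis .
qed

definition psd_mat :: "nat \<Rightarrow> complex mat \<Rightarrow> bool" where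
  "psd_mat n A \<longleftrightarrow> A \<in> carrier_mat n n \<and>
     (\<forall>v. \<exists>t\<ge>0. (\<Sum>i<n. \<Sum>j<n. cnj (v i) * A $$ (i, j) * v j) = of_real t)"

lemma psd_eigenvalue:
  assumes A: "psd_mat n A" and e: "eigenvalue A e"
  shows "\<exists>t\<ge>0. e = of_real t"
proof -
  have Ac: "A \<in> carrier_mat n n" using A by (simp add: psd_mat_def)
  from e obtain v where "eigenvector A v e" by (auto simp: eigenvalue_def)
  then have v: "v \<in> carrier_vec n" "v \<noteq> 0\<^sub>v n" "A *\<^sub>v v = e \<cdot>\<^sub>v v"
    using Ac by (auto simp: eigenvector_def)
  have Av: "(\<Sum>j<n. A $$ (i, j) * v $ j) = e * v $ i" if "i < n" for i
  proof -
    have "(\<Sum>j<n. A $$ (i, j) * v $ j) = (A *\<^sub>v v) $ i"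
      using that Ac v(1) by (auto simp: scalar_prod_def lessThan_atLeast0 intro!: sum.cong)
    then show ?thesis using that v by simp
  qed
  define s where "s = (\<Sum>i<n. (cmod (v $ i))\<^sup>2)"
  have "(\<Sum>i<n. \<Sum>j<n. cnj (v $ i) * A $$ (i, j) * v $ j) = (\<Sum>i<n. cnj (v $ i) * (e * v $ i))"
    by (simp add: mult.assoc sum_distrib_left[symmetric] Av)
  also have "\<dots> = e * of_real s"
    unfolding s_def of_real_sum complex_norm_square sum_distrib_left by (simp add: mult_ac)
  finally have q: "(\<Sum>i<n. \<Sum>j<n. cnj (v $ i) * A $$ (i, j) * v $ j) = e * of_real s" .
  have "\<forall>v. \<exists>t\<ge>0. (\<Sum>i<n. \<Sum>j<n. cnj (v i) * A $$ (i, j) * v j) = of_real t"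
    using A by (simp add: psd_mat_def)
  from this[rule_format, of "\<lambda>i. v $ i"] q
  obtain t where t: "t \<ge> 0" "e * of_real s = of_real t" by auto
  have "s > 0"
  proof -
    from v(1,2) obtain i where i: "i < n" "v $ i \<noteq> 0" by (auto simp: vec_eq_iff)
    then have "0 < (cmod (v $ i))\<^sup>2" by simp
    also have "\<dots> \<le> s" unfolding s_def using i by (intro member_le_sum) auto
    finally show ?thesis .
  qed
  then have "e = of_real (t / s)" using t by (simp add: field_simps)
  then show ?thesis using t \<open>s > 0\<close> by (intro exI[of _ "t / s"]) simp
qed

text \<open>The inequality of arithmetic and geometric means, with the roots cleared.\<close>

lemma prod_le_of_mean:
  fixes r :: "nat \<Rightarrow> real"
  assumes r: "\<And>i. i < n \<Longrightarrow> r i \<ge> 0" and le: "(\<Sum>i<n. r i) \<le> real n * B"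
  shows "(\<Prod>i<n. r i) \<le> B ^ n"
proof (cases "n = 0")
  case False
  have p0: "(\<Prod>i<n. r i) \<ge> 0" using r by (intro prod_nonneg) auto
  have "(\<Prod>i<n. r i) powr (1 / real n) \<le> (\<Sum>i<n. r i / real n)"
    using arith_geom_mean[of "{..<n}" r] False r by (auto simp: lessThan_empty_iff)
  also have "\<dots> \<le> B"
    using le False by (simp add: sum_divide_distrib[symmetric] field_simps)
  finally have "((\<Prod>i<n. r i) powr (1 / real n)) ^ n \<le> B ^ n"
    by (intro power_mono) simp_all
  moreover have "((\<Prod>i<n. r i) powr (1 / real n)) ^ n = (\<Prod>i<n. r i)"
  proof (cases "(\<Prod>i<n. r i) = 0")
    case True
    show ?thesis unfolding True using False by simp
  next
    case nz: False
    show ?thesis using p0 False by (subst powr_realpow'[symmetric]) (simp_all add: powr_powr)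
  qed
  ultimately show ?thesis by simp
qed simp

text \<open>The eigenvalues are nonnegative and have mean at most \<open>B\<close>, so their product is at most \<open>B\<^sup>n\<close>. The
  expansion of the determinant over permutations would lose a factor \<open>n!\<close>, and with it the
  exponential moments of the counts.\<close>

lemma psd_det_bound:
  assumes A: "psd_mat n A" and B: "\<And>i. i < n \<Longrightarrow> cmod (A $$ (i, i)) \<le> B"
  shows "cmod (Determinant.det A) \<le> B ^ n"
proof -
  have Ac: "A \<in> carrier_mat n n" using A by (simp add: psd_mat_def)
  obtain es where es: "char_poly A = (\<Prod>a\<leftarrow>es. [:- a, 1:])" "length es = n"
    using char_poly_factorized[OF Ac] by blast
  obtain U P Q where "schur_decomposition A es = (U, P, Q)"
    by (cases "schur_decomposition A es") auto
  from schur_decomposition[OF Ac es(1) this]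
  have sim: "similar_mat_wit A U P Q" and ut: "upper_triangular U" and dg: "diag_mat U = es" by auto
  from similar_mat_witD2[OF Ac sim]
  have c: "U \<in> carrier_mat n n" "P \<in> carrier_mat n n" "Q \<in> carrier_mat n n" "Q * P = 1\<^sub>m n" "A = P * U * Q"
    by auto
  have Ui: "U $$ (i, i) = es ! i" if "i < n" for i
    using that c(1) dg[symmetric] by (simp add: diag_mat_def)
  have "\<exists>t\<ge>0. es ! i = of_real t" if "i < n" for i
  proof (rule psd_eigenvalue[OF A])
    have "es ! i \<in> set es" using that es by simp
    then have "poly (char_poly A) (es ! i) = 0"
      unfolding es(1) by (auto simp: poly_prod_list prod_list_zero_iff)
    then show "eigenvalue A (es ! i)" by (simp add: eigenvalue_root_char_poly[OF Ac])
  qed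
  then obtain r where r: "\<And>i. i < n \<Longrightarrow> r i \<ge> 0 \<and> es ! i = of_real (r i)" by metis
  have "of_real (\<Sum>i<n. r i) = (\<Sum>i<n. U $$ (i, i))" using r Ui by simp
  also have "\<dots> = (\<Sum>i<n. A $$ (i, i))"
    unfolding c(5) by (rule trace_conjugate[symmetric]) (use c in auto)
  finally have "(\<Sum>i<n. r i) = Re (\<Sum>i<n. A $$ (i, i))" by (metis Re_complex_of_real)
  also have "\<dots> \<le> (\<Sum>i<n. B)"
    unfolding Re_sum by (intro sum_mono order_trans[OF complex_Re_le_cmod] B) simp
  finally have le: "(\<Sum>i<n. r i) \<le> real n * B" by simp
  have "Determinant.det A = Determinant.det U"
    by (rule det_similar) (use sim in \<open>auto simp: similar_mat_def\<close>)
  also have "\<dots> = prod_list es" using det_upper_triangular[OF ut c(1)] dg by simp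
  also have "\<dots> = (\<Prod>i<n. es ! i)"
    using es(2) by (simp add: prod.list_conv_set_nth lessThan_atLeast0)
  also have "\<dots> = of_real (\<Prod>i<n. r i)" using r by simp
  finally have "cmod (Determinant.det A) = \<bar>\<Prod>i<n. r i\<bar>" by (simp only: norm_of_real)
  also have "\<dots> = (\<Prod>i<n. r i)" using r by (intro abs_of_nonneg prod_nonneg) auto
  also have "\<dots> \<le> B ^ n" using prod_le_of_mean[of n r B] r le by blast
  finally show ?thesis .
qed

section \<open>Inverting the binomial moments of an integer\<close>

text \<open>The coefficients that recover the indicator of \<open>x = a\<close> from the binomial coefficients of \<open>x\<close>. The
  sum over all \<open>n\<close> does so; its partial sums up to \<open>L\<close> are exact for \<open>x \<le> L\<close> and dominated by \<open>3\<^sup>x\<close>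
  for every \<open>L\<close>.\<close>

definition inversion_coeff :: "nat \<Rightarrow> nat \<Rightarrow> real" where
  "inversion_coeff a n = (if a \<le> n then (-1) ^ (n - a) * real (n choose a) else 0)"

definition truncated_indicator :: "nat \<Rightarrow> nat \<Rightarrow> nat \<Rightarrow> real" where
  "truncated_indicator a L x = (\<Sum>n\<le>L. inversion_coeff a n * real (x choose n))"

lemma truncated_indicator_eq:
  assumes "x \<le> L"
  shows "truncated_indicator a L x = (if x = a then 1 else 0)"
proof -
  have "truncated_indicator a L x = (\<Sum>n\<in>{a..x}. inversion_coeff a n * real (x choose n))"
    unfolding truncated_indicator_def
    by (rule sum.mono_neutral_right) (use assms in \<open>auto simp: inversion_coeff_def\<close>)
  also have "\<dots> = (if x = a then 1 else 0)"
  proof (cases "a \<le> x")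
    case True
    have "(\<Sum>n\<in>{a..x}. inversion_coeff a n * real (x choose n)) =
        (\<Sum>n\<in>{a..x}. real (x choose a) * ((-1) ^ (n - a) * real ((x - a) choose (n - a))))"
    proof (rule sum.cong[OF refl])
      fix n assume n: "n \<in> {a..x}"
      then have "(x choose n) * (n choose a) = (x choose a) * ((x - a) choose (n - a))"
        using choose_mult[of a n x] by simp
      then have "real (x choose n) * real (n choose a) = real (x choose a) * real ((x - a) choose (n - a))"
        by (metis of_nat_mult)
      then show "inversion_coeff a n * real (x choose n) =
          real (x choose a) * ((-1) ^ (n - a) * real ((x - a) choose (n - a)))"
        using n by (simp add: inversion_coeff_def algebra_simps)
    qed
    also have "\<dots> = real (x choose a) * (\<Sum>n\<in>{a..x}. (-1) ^ (n - a) * real ((x - a) choose (n - a)))"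
      by (simp add: sum_distrib_left)
    also have "(\<Sum>n\<in>{a..x}. (-1) ^ (n - a) * real ((x - a) choose (n - a))) =
        (\<Sum>k\<le>x - a. (-1) ^ k * real ((x - a) choose k))"
      by (rule sum.reindex_bij_witness[of _ "\<lambda>k. k + a" "\<lambda>n. n - a"]) (use True in auto)
    also have "\<dots> = (if x = a then 1 else 0)"
      using choose_alternating_sum[of "x - a", where 'a = real] True by (cases "x = a") auto
    finally show ?thesis by simp
  qed auto
  finally show ?thesis .
qed

lemma sum_choose_pow2: "(\<Sum>n\<le>L. 2 ^ n * real (x choose n)) \<le> 3 ^ x"
proof -
  have "(\<Sum>n\<le>L. 2 ^ n * real (x choose n)) \<le> (\<Sum>n\<le>max L x. 2 ^ n * real (x choose n))"
    by (rule sum_mono2) auto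
  also have "\<dots> = (\<Sum>n\<le>x. 2 ^ n * real (x choose n))"
    by (rule sum.mono_neutral_right) auto
  also have "\<dots> = (2 + 1) ^ x"
    by (subst binomial_ring) (simp add: mult.commute)
  finally show ?thesis by simp
qed

lemma truncated_indicator_bound: "\<bar>truncated_indicator a L x\<bar> \<le> 3 ^ x"
proof -
  have "\<bar>truncated_indicator a L x\<bar> \<le> (\<Sum>n\<le>L. \<bar>inversion_coeff a n * real (x choose n)\<bar>)"
    unfolding truncated_indicator_def by (rule sum_abs)
  also have "\<dots> \<le> (\<Sum>n\<le>L. 2 ^ n * real (x choose n))"
  proof (rule sum_mono)
    fix n
    have "n choose a \<le> 2 ^ n" by (rule binomial_le_pow2)
    then have "real (n choose a) \<le> 2 ^ n" by (metis of_nat_le_iff of_nat_numeral of_nat_power)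
    then show "\<bar>inversion_coeff a n * real (x choose n)\<bar> \<le> 2 ^ n * real (x choose n)"
      by (auto simp: inversion_coeff_def abs_mult intro!: mult_right_mono)
  qed
  also have "\<dots> \<le> 3 ^ x" by (rule sum_choose_pow2)
  finally show ?thesis .
qed

text \<open>Inclusion and exclusion over all coordinates at once. The exponential moment dominates the truncated
  sums; the left-hand side contains the law only through its mixed binomial moments, which are
  therefore enough to determine it.\<close>

lemma prob_eq_of_binomial_moments:
  fixes x :: "'i \<Rightarrow> 'a \<Rightarrow> nat"
  assumes "prob_space M" "finite I"
    and meas: "\<And>k. k \<in> I \<Longrightarrow> x k \<in> measurable M (count_space UNIV)"
    and int: "integrable M (\<lambda>\<omega>. 3 ^ (\<Sum>k\<in>I. x k \<omega>) :: real)"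
  shows "(\<lambda>L. \<Sum>n\<in>PiE I (\<lambda>_. {..L}). (\<Prod>k\<in>I. inversion_coeff (a k) (n k)) *
             (\<integral>\<omega>. (\<Prod>k\<in>I. real (x k \<omega> choose n k)) \<partial>M))
         \<longlonglongrightarrow> measure M {\<omega>\<in>space M. \<forall>k\<in>I. x k \<omega> = a k}"
proof -
  interpret prob_space M by fact
  have m1: "(\<lambda>\<omega>. f (x k \<omega>)) \<in> borel_measurable M" if "k \<in> I" for k and f :: "nat \<Rightarrow> real"
    by (rule measurable_compose[OF meas[OF that]]) simp
  have ib: "integrable M (\<lambda>\<omega>. \<Prod>k\<in>I. f k (x k \<omega>))" if f: "\<And>k t. \<bar>f k t\<bar> \<le> 3 ^ t" for f :: "'i \<Rightarrow> nat \<Rightarrow> real"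
  proof (rule Bochner_Integration.integrable_bound[OF int])
    show "(\<lambda>\<omega>. \<Prod>k\<in>I. f k (x k \<omega>)) \<in> borel_measurable M"
      by (intro borel_measurable_prod m1)
    show "AE \<omega> in M. norm (\<Prod>k\<in>I. f k (x k \<omega>)) \<le> norm (3 ^ (\<Sum>k\<in>I. x k \<omega>) :: real)"
      by (intro AE_I2) (simp add: abs_prod power_sum prod_mono f)
  qed
  have ch: "\<bar>real (t choose n)\<bar> \<le> 3 ^ t" for t n
  proof -
    have "t choose n \<le> 2 ^ t" by (rule binomial_le_pow2)
    then have "real (t choose n) \<le> 2 ^ t" by (metis of_nat_le_iff of_nat_numeral of_nat_power)
    also have "\<dots> \<le> 3 ^ t" by (rule power_mono) auto
    finally show ?thesis by simp
  qed
  have eq: "(\<Sum>n\<in>PiE I (\<lambda>_. {..L}). (\<Prod>k\<in>I. inversion_coeff (a k) (n k)) *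
             (\<integral>\<omega>. (\<Prod>k\<in>I. real (x k \<omega> choose n k)) \<partial>M)) =
      (\<integral>\<omega>. (\<Prod>k\<in>I. truncated_indicator (a k) L (x k \<omega>)) \<partial>M)" for L
  proof -
    have "(\<integral>\<omega>. (\<Prod>k\<in>I. truncated_indicator (a k) L (x k \<omega>)) \<partial>M) =
        (\<integral>\<omega>. (\<Sum>n\<in>PiE I (\<lambda>_. {..L}). (\<Prod>k\<in>I. inversion_coeff (a k) (n k)) * (\<Prod>k\<in>I. real (x k \<omega> choose n k))) \<partial>M)"
      unfolding truncated_indicator_def
      by (subst prod_sum_PiE) (use \<open>finite I\<close> in \<open>simp_all add: prod.distrib\<close>)
    also have "\<dots> = (\<Sum>n\<in>PiE I (\<lambda>_. {..L}). (\<Prod>k\<in>I. inversion_coeff (a k) (n k)) *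
             (\<integral>\<omega>. (\<Prod>k\<in>I. real (x k \<omega> choose n k)) \<partial>M))"
      using ib[of "\<lambda>k t. real (t choose n k)" for n] ch
      by (subst Bochner_Integration.integral_sum) auto
    finally show ?thesis by simp
  qed
  have meas_set: "{\<omega>\<in>space M. \<forall>k\<in>I. x k \<omega> = a k} \<in> sets M"
  proof -
    have "{\<omega>\<in>space M. x k \<omega> = a k} \<in> sets M" if "k \<in> I" for k
    proof -
      have "x k -` {a k} \<inter> space M \<in> sets M" using meas[OF that] by (rule measurable_sets) simp
      also have "x k -` {a k} \<inter> space M = {\<omega>\<in>space M. x k \<omega> = a k}" by auto
      finally show ?thesis .
    qed
    then show ?thesis using \<open>finite I\<close> by (rule sets.sets_Collect_finite_All)
  qed
  have "(\<lambda>L. \<integral>\<omega>. (\<Prod>k\<in>I. truncated_indicator (a k) L (x k \<omega>)) \<partial>M)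
      \<longlonglongrightarrow> (\<integral>\<omega>. indicator {\<omega>\<in>space M. \<forall>k\<in>I. x k \<omega> = a k} \<omega> \<partial>M)"
  proof (rule integral_dominated_convergence[where w = "\<lambda>\<omega>. 3 ^ (\<Sum>k\<in>I. x k \<omega>)"])
    show "AE \<omega> in M. (\<lambda>L. \<Prod>k\<in>I. truncated_indicator (a k) L (x k \<omega>))
        \<longlonglongrightarrow> indicator {\<omega>\<in>space M. \<forall>k\<in>I. x k \<omega> = a k} \<omega>"
    proof (intro AE_I2 tendsto_eventually)
      fix \<omega> assume \<omega>: "\<omega> \<in> space M"
      show "\<forall>\<^sub>F L in sequentially. (\<Prod>k\<in>I. truncated_indicator (a k) L (x k \<omega>)) =
          indicator {\<omega>\<in>space M. \<forall>k\<in>I. x k \<omega> = a k} \<omega>"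
        using eventually_ge_at_top[of "\<Sum>k\<in>I. x k \<omega>"]
      proof eventually_elim
        case (elim L)
        have "x k \<omega> \<le> L" if "k \<in> I" for k
          using elim member_le_sum[of k I "\<lambda>k. x k \<omega>"] that \<open>finite I\<close> by simp
        then have "(\<Prod>k\<in>I. truncated_indicator (a k) L (x k \<omega>)) = (\<Prod>k\<in>I. if x k \<omega> = a k then 1 else 0)"
          by (intro prod.cong refl truncated_indicator_eq)
        also have "\<dots> = indicator {\<omega>\<in>space M. \<forall>k\<in>I. x k \<omega> = a k} \<omega>"
        proof (cases "\<forall>k\<in>I. x k \<omega> = a k")
          case False
          then show ?thesis using \<open>finite I\<close> by (auto simp: indicator_def)
        qed (use \<omega> in simp)
        finally show ?case .
      qed
    qed
    show "AE \<omega> in M. norm (\<Prod>k\<in>I. truncated_indicator (a k) L (x k \<omega>)) \<le> 3 ^ (\<Sum>k\<in>I. x k \<omega>)" for L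
      by (intro AE_I2) (simp add: abs_prod power_sum prod_mono truncated_indicator_bound)
    show "(\<lambda>\<omega>. \<Prod>k\<in>I. truncated_indicator (a k) L (x k \<omega>)) \<in> borel_measurable M" for L
      by (intro borel_measurable_prod m1)
    show "(\<lambda>\<omega>. indicator {\<omega>\<in>space M. \<forall>k\<in>I. x k \<omega> = a k} \<omega> :: real) \<in> borel_measurable M"
      using meas_set by simp
  qed (rule int)
  then show ?thesis unfolding eq using meas_set by simp
qed

section \<open>Counting points\<close>

text \<open>On precompact sets a configuration has integer mass; the floor only changes the type.\<close>

definition points :: "'a set \<Rightarrow> 'a measure \<Rightarrow> nat" where
  "points A \<xi> = nat \<lfloor>measure \<xi> A\<rfloor>"

lemma space_configuration_algebra:
  "space (configuration_algebra E) = configurations E"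
  by (auto simp: configuration_algebra_def space_Sup_eq_UN)

lemma measurable_emeasure_configuration [measurable]:
  assumes "A \<in> sets (restrict_space borel E)"
  shows "(\<lambda>\<xi>. emeasure \<xi> A) \<in> borel_measurable (configuration_algebra E)"
  unfolding configuration_algebra_def
  by (rule measurable_SUP1[OF assms measurable_vimage_algebra1]) auto

lemma sets_configuration:
  "\<xi> \<in> configurations E \<Longrightarrow> sets \<xi> = sets (restrict_space borel E)"
  by (simp add: configurations_def radon_on_def)

lemma compact_in_sets_restrict:
  fixes E :: "'a::t2_space set"
  assumes "compact C" "C \<subseteq> E"
  shows "C \<in> sets (restrict_space borel E)"
  using assms borel_compact[of C] by (auto simp: sets_restrict_space intro!: image_eqI[of _ _ C])

lemma emeasure_eq_points:
  assumes \<xi>: "\<xi> \<in> configurations E" and A: "A \<in> sets (restrict_space borel E)" "precompact_in E A"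
  shows "emeasure \<xi> A = of_nat (points A \<xi>)"
proof -
  obtain C where C: "compact C" "C \<subseteq> E" "A \<subseteq> C" using A by (auto simp: precompact_in_def)
  have "C \<in> sets \<xi>"
    using C sets_configuration[OF \<xi>] by (simp add: compact_in_sets_restrict)
  then have "emeasure \<xi> A \<le> emeasure \<xi> C" using C by (intro emeasure_mono)
  also have "\<dots> < \<infinity>" using \<xi> C by (auto simp: configurations_def radon_on_def)
  finally have "emeasure \<xi> A \<noteq> \<infinity>" by simp
  then obtain n :: nat where n: "emeasure \<xi> A = of_nat n"
    using \<xi> A sets_configuration[OF \<xi>] by (auto simp: configurations_def)
  then have "measure \<xi> A = real n"
    by (simp add: measure_def ennreal_of_nat_eq_real_of_nat)
  then show ?thesis using n by (simp add: points_def)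
qed

lemma measure_eq_points:
  assumes "\<xi> \<in> configurations E" "A \<in> sets (restrict_space borel E)" "precompact_in E A"
  shows "measure \<xi> A = real (points A \<xi>)"
  using emeasure_eq_points[OF assms] by (simp add: measure_def ennreal_of_nat_eq_real_of_nat)

lemma measurable_points:
  assumes A: "A \<in> sets (restrict_space borel E)"
  shows "points A \<in> measurable (configuration_algebra E) (count_space UNIV)"
proof -
  have [measurable]: "(\<lambda>\<xi>. measure \<xi> A) \<in> borel_measurable (configuration_algebra E)"
    unfolding measure_def by (intro borel_measurable_enn2real measurable_emeasure_configuration A)
  show ?thesis unfolding points_def[abs_def] by measurable
qed

lemma sets_points_eq:
  assumes I: "finite I" and B: "\<And>J. J \<in> I \<Longrightarrow> B J \<in> sets (restrict_space borel E)"
  shows "{\<xi>\<in>configurations E. \<forall>J\<in>I. points (B J) \<xi> = v J} \<in> sets (configuration_algebra E)"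
proof -
  have "{\<xi> \<in> space (configuration_algebra E). \<forall>J\<in>I. points (B J) \<xi> = v J} \<in> sets (configuration_algebra E)"
  proof (rule sets.sets_Collect_finite_All[OF _ I])
    fix J assume "J \<in> I"
    from measurable_sets[OF measurable_points[OF B[OF this]], of "{v J}"]
    have "points (B J) -` {v J} \<inter> space (configuration_algebra E) \<in> sets (configuration_algebra E)" by simp
    also have "points (B J) -` {v J} \<inter> space (configuration_algebra E) =
        {\<xi> \<in> space (configuration_algebra E). points (B J) \<xi> = v J}" by auto
    finally show "{\<xi> \<in> space (configuration_algebra E). points (B J) \<xi> = v J} \<in> sets (configuration_algebra E)" .
  qed
  then show ?thesis by (simp add: space_configuration_algebra)
qed

lemma points_disjoint_union:
  assumes \<xi>: "\<xi> \<in> configurations E" and I: "finite I"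
    and B: "\<And>i. i \<in> I \<Longrightarrow> B i \<in> sets (restrict_space borel E)" "\<And>i. i \<in> I \<Longrightarrow> precompact_in E (B i)"
    and disj: "disjoint_family_on B I" and U: "precompact_in E (\<Union>i\<in>I. B i)"
  shows "points (\<Union>i\<in>I. B i) \<xi> = (\<Sum>i\<in>I. points (B i) \<xi>)"
proof -
  have UB: "(\<Union>i\<in>I. B i) \<in> sets (restrict_space borel E)" using B I by auto
  have "of_nat (points (\<Union>i\<in>I. B i) \<xi>) = emeasure \<xi> (\<Union>i\<in>I. B i)"
    by (rule emeasure_eq_points[OF \<xi> UB U, symmetric])
  also have "\<dots> = (\<Sum>i\<in>I. emeasure \<xi> (B i))"
    using B I disj sets_configuration[OF \<xi>] by (intro sum_emeasure[symmetric]) auto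
  also have "\<dots> = (\<Sum>i\<in>I. of_nat (points (B i) \<xi>))"
    by (intro sum.cong refl emeasure_eq_points[OF \<xi> B])
  finally have "(of_nat (points (\<Union>i\<in>I. B i) \<xi>) :: ennreal) = of_nat (\<Sum>i\<in>I. points (B i) \<xi>)"
    by simp
  then show ?thesis by (simp only: of_nat_eq_iff)
qed

lemma precompact_in_subset: "precompact_in E A \<Longrightarrow> B \<subseteq> A \<Longrightarrow> precompact_in E B"
  by (auto simp: precompact_in_def)

lemma precompact_in_UN:
  assumes "finite I" "\<And>i. i \<in> I \<Longrightarrow> precompact_in E (B i)"
  shows "precompact_in E (\<Union>i\<in>I. B i)"
proof -
  from assms(2) obtain C where C: "\<And>i. i \<in> I \<Longrightarrow> compact (C i) \<and> C i \<subseteq> E \<and> B i \<subseteq> C i"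
    unfolding precompact_in_def by metis
  then have "compact (\<Union>i\<in>I. C i)" using assms(1) by (intro compact_UN) auto
  moreover have "(\<Union>i\<in>I. C i) \<subseteq> E" "(\<Union>i\<in>I. B i) \<subseteq> (\<Union>i\<in>I. C i)" using C by blast+
  ultimately show ?thesis unfolding precompact_in_def by blast
qed

section \<open>Finite-dimensional distributions determine the law\<close>

text \<open>The constraints are pairs, and not a function on sets, so that the intersection of two events belongs
  to the union of the constraints, even if these contradict each other.\<close>

definition count_event :: "'a::polish_space set \<Rightarrow> ('a set \<times> nat) set \<Rightarrow> 'a measure set" where
  "count_event E F = {\<xi> \<in> configurations E. \<forall>p\<in>F. points (fst p) \<xi> = snd p}"

definition finite_count_events :: "'a::polish_space set \<Rightarrow> 'a measure set set" where
  "finite_count_events E = {count_event E F | F.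
     finite F \<and> (\<forall>p\<in>F. fst p \<in> sets (restrict_space borel E) \<and> precompact_in E (fst p))}"

lemma Int_stable_finite_count_events: "Int_stable (finite_count_events E)"
proof (rule Int_stableI)
  fix a b assume "a \<in> finite_count_events E" "b \<in> finite_count_events E"
  then obtain F G where F: "a = count_event E F" "finite F" "\<forall>p\<in>F. fst p \<in> sets (restrict_space borel E) \<and> precompact_in E (fst p)"
    and G: "b = count_event E G" "finite G" "\<forall>p\<in>G. fst p \<in> sets (restrict_space borel E) \<and> precompact_in E (fst p)"
    unfolding finite_count_events_def by blast
  have "a \<inter> b = count_event E (F \<union> G)"
    unfolding F(1) G(1) count_event_def ball_Un by blast
  then show "a \<inter> b \<in> finite_count_events E"
    unfolding finite_count_events_def using F G by (intro CollectI exI[of _ "F \<union> G"]) auto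
qed

text \<open>The mass of an arbitrary Borel set is the supremum of the masses of its precompact parts along an
  exhaustion by compact sets.\<close>

lemma sets_configuration_algebra_generated:
  fixes E :: "'a::polish_space set"
  assumes C: "\<And>n::nat. compact (C n)" "incseq C" "(\<Union>n. C n) = E"
  shows "sets (configuration_algebra E) = sigma_sets (configurations E) (finite_count_events E)"
proof
  have sub: "finite_count_events E \<subseteq> Pow (configurations E)"
    by (auto simp: finite_count_events_def count_event_def)
  define G where "G = sigma (configurations E) (finite_count_events E)"
  have spG: "space G = configurations E" using sub by (simp add: G_def)
  have setsG: "sets G = sigma_sets (configurations E) (finite_count_events E)"
    using sub by (simp add: G_def)
  have "(\<lambda>\<xi>. \<xi>) \<in> measurable G (configuration_algebra E)"
    unfolding configuration_algebra_def
  proof (rule measurable_SUP2)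
    show "sets (restrict_space borel E) \<noteq> {}" using sets.empty_sets by blast
    fix A assume A: "A \<in> sets (restrict_space borel E)"
    have An: "A \<inter> C n \<in> sets (restrict_space borel E)" "precompact_in E (A \<inter> C n)" for n
    proof -
      have "C n \<in> sets (restrict_space borel E)"
        using C by (intro compact_in_sets_restrict) auto
      then show "A \<inter> C n \<in> sets (restrict_space borel E)" using A by blast
      show "precompact_in E (A \<inter> C n)" using C by (auto simp: precompact_in_def)
    qed
    have pm: "(\<lambda>\<xi>. of_nat (points (A \<inter> C n) \<xi>) :: ennreal) \<in> borel_measurable G" for n
    proof -
      have "points (A \<inter> C n) \<in> measurable G (count_space UNIV)"
      proof (rule measurableI)
        fix N :: "nat set"
        have "points (A \<inter> C n) -` N \<inter> space G = (\<Union>j\<in>N. count_event E {(A \<inter> C n, j)})"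
          by (auto simp: spG count_event_def)
        moreover have "count_event E {(A \<inter> C n, j)} \<in> sets G" for j
          unfolding setsG using An
          by (intro sigma_sets.Basic) (auto simp: finite_count_events_def intro!: exI[of _ "{(A \<inter> C n, j)}"])
        ultimately show "points (A \<inter> C n) -` N \<inter> space G \<in> sets G" by auto
      qed simp
      then show ?thesis by (rule measurable_compose) simp
    qed
    have "(\<lambda>\<xi>. SUP n. of_nat (points (A \<inter> C n) \<xi>) :: ennreal) \<in> borel_measurable G"
      by (intro borel_measurable_SUP pm) simp
    moreover have "(SUP n. of_nat (points (A \<inter> C n) \<xi>)) = emeasure \<xi> A" if "\<xi> \<in> space G" for \<xi>
    proof -
      have \<xi>: "\<xi> \<in> configurations E" using that spG by simp
      have "(SUP n. of_nat (points (A \<inter> C n) \<xi>)) = (SUP n. emeasure \<xi> (A \<inter> C n))"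
        by (intro SUP_cong refl emeasure_eq_points[OF \<xi> An, symmetric])
      also have "\<dots> = emeasure \<xi> (\<Union>n. A \<inter> C n)"
      proof (rule SUP_emeasure_incseq)
        show "range (\<lambda>n. A \<inter> C n) \<subseteq> sets \<xi>" using An sets_configuration[OF \<xi>] by auto
        show "incseq (\<lambda>n. A \<inter> C n)" using C(2) unfolding incseq_def by blast
      qed
      also have "(\<Union>n. A \<inter> C n) = A"
        using C(3) A sets.sets_into_space[OF A] by (auto simp: space_restrict_space)
      finally show ?thesis .
    qed
    ultimately have "(\<lambda>\<xi>. emeasure \<xi> A) \<in> borel_measurable G"
      by (subst (asm) measurable_cong) auto
    then show "(\<lambda>\<xi>. \<xi>) \<in> measurable G (vimage_algebra (configurations E) (\<lambda>\<xi>. emeasure \<xi> A) borel)"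
      by (intro measurable_vimage_algebra2) (simp_all add: spG)
  qed simp
  note id_measurable = this
  show "sets (configuration_algebra E) \<subseteq> sigma_sets (configurations E) (finite_count_events E)"
  proof
    fix a assume a: "a \<in> sets (configuration_algebra E)"
    then have "a \<subseteq> space G" using sets.sets_into_space[OF a] by (simp add: spG space_configuration_algebra)
    then have "(\<lambda>\<xi>. \<xi>) -` a \<inter> space G = a" by auto
    with measurable_sets[OF id_measurable a]
    show "a \<in> sigma_sets (configurations E) (finite_count_events E)" unfolding setsG by simp
  qed
  have "finite_count_events E \<subseteq> sets (configuration_algebra E)"
  proof
    fix a assume "a \<in> finite_count_events E"
    then obtain F where F: "a = count_event E F" "finite F" "\<forall>p\<in>F. fst p \<in> sets (restrict_space borel E) \<and> precompact_in E (fst p)"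
      unfolding finite_count_events_def by blast
    have "a = {\<xi>\<in>configurations E. \<forall>p\<in>F. points (fst p) \<xi> = snd p}"
      by (simp add: F(1) count_event_def)
    also have "\<dots> \<in> sets (configuration_algebra E)"
      using F(3) by (intro sets_points_eq F(2)) blast
    finally show "a \<in> sets (configuration_algebra E)" .
  qed
  then show "sigma_sets (configurations E) (finite_count_events E) \<subseteq> sets (configuration_algebra E)"
    by (metis sets.sigma_sets_subset space_configuration_algebra)
qed

definition atom_index :: "('a set \<times> nat) set \<Rightarrow> 'a set set set" where
  "atom_index F = Pow (fst ` F) - {{}}"

text \<open>The points that lie in the members of \<open>J\<close> and in no other of the sets occurring in \<open>F\<close>. The union of the
  atoms with \<open>A \<in> J\<close> is \<open>A\<close>.\<close>

definition atom :: "('a set \<times> nat) set \<Rightarrow> 'a set set \<Rightarrow> 'a set" where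
  "atom F J = \<Inter>J - \<Union>(fst ` F - J)"

text \<open>The numbers of points in the atoms that are compatible with the constraints \<open>F\<close>.\<close>

definition atom_counts :: "('a set \<times> nat) set \<Rightarrow> ('a set set \<Rightarrow> nat) set" where
  "atom_counts F = {v \<in> PiE (atom_index F) (\<lambda>_. UNIV).
     \<forall>p\<in>F. (\<Sum>J\<in>{J\<in>atom_index F. fst p \<in> J}. v J) = snd p}"

text \<open>The sets in \<open>F\<close> may overlap, whereas moment identities are available for disjoint sets only. The
  decomposition is countable, so probabilities can be summed over it.\<close>

lemma count_event_by_atoms:
  fixes E :: "'a::polish_space set" and F :: "('a set \<times> nat) set"
  assumes F: "finite F"
    and Fp: "\<forall>p\<in>F. fst p \<in> sets (restrict_space borel E) \<and> precompact_in E (fst p)"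
  shows "finite (atom_index F)" "disjoint_family_on (atom F) (atom_index F)"
    and "\<And>J. J \<in> atom_index F \<Longrightarrow> atom F J \<in> sets (restrict_space borel E) \<and> precompact_in E (atom F J)"
    and "countable (atom_counts F)"
    and "count_event E F = (\<Union>v\<in>atom_counts F. {\<xi>\<in>configurations E. \<forall>J\<in>atom_index F. points (atom F J) \<xi> = v J})"
    and "disjoint_family_on (\<lambda>v. {\<xi>\<in>configurations E. \<forall>J\<in>atom_index F. points (atom F J) \<xi> = v J}) (atom_counts F)"
proof -
  show finI: "finite (atom_index F)" using F by (simp add: atom_index_def)
  show disj: "disjoint_family_on (atom F) (atom_index F)"
    unfolding disjoint_family_on_def
  proof (intro ballI impI)
    fix J K assume JK: "J \<in> (atom_index F)" "K \<in> (atom_index F)" "J \<noteq> K"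
    then obtain A where "A \<in> J \<and> A \<notin> K \<or> A \<in> K \<and> A \<notin> J" by blast
    then show "atom F J \<inter> atom F K = {}" using JK unfolding atom_def atom_index_def by blast
  qed
  show BJ: "atom F J \<in> sets (restrict_space borel E) \<and> precompact_in E (atom F J)" if J: "J \<in> (atom_index F)" for J
  proof
    have fin: "finite J" "J \<noteq> {}" "J \<subseteq> fst ` F"
      using J F by (auto simp: atom_index_def intro: finite_subset)
    have mem: "A \<in> sets (restrict_space borel E) \<and> precompact_in E A" if "A \<in> fst ` F" for A
      using that Fp by auto
    have "\<Inter>J \<in> sets (restrict_space borel E)"
      using fin mem sets.finite_INT[of J "\<lambda>A. A" "restrict_space borel E"] by auto
    moreover have "\<Union>(fst ` F - J) \<in> sets (restrict_space borel E)"
      using F mem by (intro sets.finite_Union) auto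
    ultimately show "atom F J \<in> sets (restrict_space borel E)" unfolding atom_def by blast
    obtain A where "A \<in> J" using fin by blast
    then have "precompact_in E A" "atom F J \<subseteq> A" using mem[of A] fin(3) by (auto simp: atom_def)
    then show "precompact_in E (atom F J)" by (rule precompact_in_subset)
  qed
  have "countable (PiE (atom_index F) (\<lambda>_. UNIV :: nat set))" by (intro countable_PiE finI) auto
  then show "countable (atom_counts F)" by (rule countable_subset[rotated]) (auto simp: atom_counts_def)
  have atoms: "points A \<xi> = (\<Sum>J\<in>{J\<in>(atom_index F). A \<in> J}. points (atom F J) \<xi>)"
    if \<xi>: "\<xi> \<in> configurations E" and A: "A \<in> fst ` F" for A \<xi>
  proof -
    have eq: "(\<Union>J\<in>{J\<in>(atom_index F). A \<in> J}. atom F J) = A"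
    proof (rule equalityI[rotated])
      show "A \<subseteq> (\<Union>J\<in>{J\<in>(atom_index F). A \<in> J}. atom F J)"
      proof
        fix x assume "x \<in> A"
        define J where "J = {D \<in> fst ` F. x \<in> D}"
        from A have "A \<in> J" using \<open>x \<in> A\<close> by (simp add: J_def)
        moreover have "J \<in> (atom_index F)" using \<open>A \<in> J\<close> by (auto simp: atom_index_def J_def)
        moreover have "x \<in> atom F J" by (auto simp: atom_def J_def)
        ultimately show "x \<in> (\<Union>J\<in>{J\<in>(atom_index F). A \<in> J}. atom F J)" by blast
      qed
    qed (auto simp: atom_def)
    have "points (\<Union>J\<in>{J\<in>(atom_index F). A \<in> J}. atom F J) \<xi> = (\<Sum>J\<in>{J\<in>(atom_index F). A \<in> J}. points (atom F J) \<xi>)"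
    proof (rule points_disjoint_union[OF \<xi>])
      show "disjoint_family_on (atom F) {J \<in> (atom_index F). A \<in> J}"
        using disj by (rule disjoint_family_on_mono[rotated]) auto
      show "precompact_in E (\<Union>J\<in>{J \<in> (atom_index F). A \<in> J}. atom F J)"
        unfolding eq using Fp A by auto
    qed (use BJ finI in auto)
    then show ?thesis using eq by simp
  qed
  show "count_event E F = (\<Union>v\<in>(atom_counts F). {\<xi>\<in>configurations E. \<forall>J\<in>(atom_index F). points (atom F J) \<xi> = v J})"
  proof (intro equalityI subsetI)
    fix \<xi> assume "\<xi> \<in> count_event E F"
    then have \<xi>: "\<xi> \<in> configurations E" "\<And>p. p \<in> F \<Longrightarrow> points (fst p) \<xi> = snd p"
      by (auto simp: count_event_def)
    define v where "v = restrict (\<lambda>J. points (atom F J) \<xi>) (atom_index F)"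
    have "v \<in> (atom_counts F)"
      unfolding atom_counts_def v_def
    proof (intro CollectI conjI ballI)
      fix p assume p: "p \<in> F"
      show "(\<Sum>J\<in>{J \<in> (atom_index F). fst p \<in> J}. restrict (\<lambda>J. points (atom F J) \<xi>) (atom_index F) J) = snd p"
        using atoms[OF \<xi>(1), of "fst p"] \<xi>(2)[OF p] p by simp
    qed auto
    moreover have "\<xi> \<in> {\<xi>\<in>configurations E. \<forall>J\<in>(atom_index F). points (atom F J) \<xi> = v J}"
      using \<xi>(1) by (simp add: v_def)
    ultimately show "\<xi> \<in> (\<Union>v\<in>(atom_counts F). {\<xi>\<in>configurations E. \<forall>J\<in>(atom_index F). points (atom F J) \<xi> = v J})"
      by blast
  next
    fix \<xi> assume "\<xi> \<in> (\<Union>v\<in>(atom_counts F). {\<xi>\<in>configurations E. \<forall>J\<in>(atom_index F). points (atom F J) \<xi> = v J})"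
    then obtain v where v: "v \<in> (atom_counts F)" "\<xi> \<in> configurations E" "\<And>J. J \<in> (atom_index F) \<Longrightarrow> points (atom F J) \<xi> = v J" by blast
    show "\<xi> \<in> count_event E F"
      unfolding count_event_def
    proof (intro CollectI conjI v(2) ballI)
      fix p assume p: "p \<in> F"
      have "(\<Sum>J\<in>{J\<in>(atom_index F). fst p \<in> J}. v J) = snd p" using v(1) p by (simp add: atom_counts_def)
      then show "points (fst p) \<xi> = snd p"
        using atoms[OF v(2), of "fst p"] v(3) p by simp
    qed
  qed
  show "disjoint_family_on (\<lambda>v. {\<xi>\<in>configurations E. \<forall>J\<in>(atom_index F). points (atom F J) \<xi> = v J}) (atom_counts F)"
    unfolding disjoint_family_on_def
  proof (intro ballI impI)
    fix v w assume vw: "v \<in> (atom_counts F)" "w \<in> (atom_counts F)" "v \<noteq> w"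
    then obtain J where "J \<in> (atom_index F)" "v J \<noteq> w J"
      unfolding atom_counts_def by (metis (no_types, lifting) PiE_ext mem_Collect_eq)
    then show "{\<xi>\<in>configurations E. \<forall>J\<in>(atom_index F). points (atom F J) \<xi> = v J} \<inter> {\<xi>\<in>configurations E. \<forall>J\<in>(atom_index F). points (atom F J) \<xi> = w J} = {}"
      by auto
  qed
qed

theorem law_eq_of_disjoint_counts:
  fixes E :: "'a::polish_space set"
  assumes C: "\<And>n::nat. compact (C n)" "incseq C" "(\<Union>n. C n) = E"
    and Q: "prob_space Q1" "prob_space Q2"
    and sQ: "sets Q1 = sets (configuration_algebra E)" "sets Q2 = sets (configuration_algebra E)"
    and eq: "\<And>(I::'a set set set) B v. finite I \<Longrightarrow> disjoint_family_on B I \<Longrightarrow>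
      (\<And>J. J \<in> I \<Longrightarrow> B J \<in> sets (restrict_space borel E) \<and> precompact_in E (B J)) \<Longrightarrow>
      emeasure Q1 {\<xi>\<in>configurations E. \<forall>J\<in>I. points (B J) \<xi> = v J} =
      emeasure Q2 {\<xi>\<in>configurations E. \<forall>J\<in>I. points (B J) \<xi> = v J}"
  shows "Q1 = Q2"
proof (rule measure_eqI_generator_eq[OF Int_stable_finite_count_events])
  show "finite_count_events E \<subseteq> Pow (configurations E)"
    by (auto simp: finite_count_events_def count_event_def)
  show "sets Q1 = sigma_sets (configurations E) (finite_count_events E)"
    "sets Q2 = sigma_sets (configurations E) (finite_count_events E)"
    using sets_configuration_algebra_generated[OF C] sQ by simp_all
  have "count_event E {} = configurations E" by (auto simp: count_event_def)
  then have "configurations E \<in> finite_count_events E"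
    unfolding finite_count_events_def by (intro CollectI exI[of _ "{}"]) auto
  then show "range (\<lambda>i::nat. configurations E) \<subseteq> finite_count_events E" by auto
  show "(\<Union>i::nat. configurations E) = configurations E" by simp
  show "emeasure Q1 (configurations E) \<noteq> \<infinity>"
    using prob_space.finite_measure[OF Q(1)] finite_measure.emeasure_finite by auto
  fix a assume "a \<in> finite_count_events E"
  then obtain F where a: "a = count_event E F" and F: "finite F"
    "\<forall>p\<in>F. fst p \<in> sets (restrict_space borel E) \<and> precompact_in E (fst p)"
    unfolding finite_count_events_def by blast
  note atom_facts = count_event_by_atoms[OF F]
  define S where "S v = {\<xi>\<in>configurations E. \<forall>J\<in>atom_index F. points (atom F J) \<xi> = v J}" for v
  have Sm: "S v \<in> sets (configuration_algebra E)" for v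
    unfolding S_def using atom_facts(3) by (intro sets_points_eq atom_facts(1)) blast
  have em: "emeasure Q a = (\<integral>\<^sup>+v. emeasure Q (S v) \<partial>count_space (atom_counts F))"
    if "sets Q = sets (configuration_algebra E)" for Q
    unfolding a atom_facts(5) S_def[symmetric]
    using atom_facts(4) atom_facts(6)[folded S_def] Sm that by (intro emeasure_UN_countable) auto
  show "emeasure Q1 a = emeasure Q2 a"
    unfolding em[OF sQ(1)] em[OF sQ(2)] S_def
    by (intro nn_integral_cong eq atom_facts(1,2,3))
qed

section \<open>Counts of a determinantal process\<close>

lemma falling_factorial_eq_binomial:
  "(\<Prod>i<n. real x - real i) = fact n * real (x choose n)"
  using gbinomial_prod_rev[of "real x" n] by (simp add: binomial_gbinomial lessThan_atLeast0)

lemma factorial_count_eq_binomial: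
  assumes "\<xi> \<in> configurations E"
    and "\<And>k. k < r \<Longrightarrow> \<Delta> k \<in> sets (restrict_space borel E) \<and> precompact_in E (\<Delta> k)"
  shows "factorial_count r \<Delta> n \<xi> = (\<Prod>k<r. fact (n k)) * (\<Prod>k<r. real (points (\<Delta> k) \<xi> choose n k))"
  unfolding factorial_count_def
  using assms by (simp add: measure_eq_points falling_factorial_eq_binomial prod.distrib)

text \<open>All matrices of the kernel are positive semidefinite. The quadratic form is required to be real,
  which contains the Hermitian symmetry.\<close>

definition positive_kernel :: "'a set \<Rightarrow> ('a \<Rightarrow> 'a \<Rightarrow> complex) \<Rightarrow> bool" where
  "positive_kernel E K \<longleftrightarrow> (\<forall>(n::nat) x v. (\<forall>i<n. x i \<in> E) \<longrightarrow>
     (\<exists>t\<ge>0. (\<Sum>i<n. \<Sum>j<n. cnj (v i) * K (x i) (x j) * v j) = complex_of_real t))"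

lemma kernel_det_bound:
  assumes K: "positive_kernel E K" and x: "\<And>i. i < l \<Longrightarrow> x i \<in> E" and B: "\<And>i. i < l \<Longrightarrow> cmod (K (x i) (x i)) \<le> B"
  shows "cmod (kernel_det K l x) \<le> B ^ l"
  unfolding kernel_det_def
proof (rule psd_det_bound)
  show "psd_mat l (Matrix.mat l l (\<lambda>(i, j). K (x i) (x j)))"
    using K x unfolding psd_mat_def positive_kernel_def by simp
qed (use B in simp)

lemma block_product_1: "block_product 1 (\<lambda>_. D) (\<lambda>_. l) = PiE {..<l} (\<lambda>_. D)"
  by (auto simp: block_product_def blocks_def intro!: PiE_cong)

lemma determinantal_measurable:
  assumes "determinantal E M X K \<mu>"
  shows "prob_space M" "X \<in> measurable M (configuration_algebra E)"
  using assms by (simp_all add: determinantal_def simple_point_process_def point_process_def)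

lemma determinantal_points_measurable:
  assumes "determinantal E M X K \<mu>" "A \<in> sets (restrict_space borel E)"
  shows "(\<lambda>\<omega>. points A (X \<omega>)) \<in> measurable M (count_space UNIV)"
  by (rule measurable_compose[OF determinantal_measurable(2)[OF assms(1)] measurable_points[OF assms(2)]])

lemma determinantal_configuration:
  "determinantal E M X K \<mu> \<Longrightarrow> \<omega> \<in> space M \<Longrightarrow> X \<omega> \<in> configurations E"
  using measurable_space[OF determinantal_measurable(2)] by (simp add: space_configuration_algebra)

lemma determinantal_moment_identity:
  assumes det: "determinantal E M X K \<mu>" and r: "r \<ge> 1"
    and \<Delta>: "\<forall>k<r. \<Delta> k \<in> sets (restrict_space borel E) \<and> precompact_in E (\<Delta> k)"
    and disj: "disjoint_family_on \<Delta> {..<r}" and n: "\<forall>k<r. n k \<ge> 1"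
    and l: "l = (\<Sum>k<r. n k)"
  shows "integrable M (\<lambda>\<omega>. factorial_count r \<Delta> n (X \<omega>))"
    and "set_integrable (\<Pi>\<^sub>M i\<in>{..<l}. \<mu>) (block_product r \<Delta> n) (kernel_det K l)"
    and "complex_of_real (\<integral>\<omega>. factorial_count r \<Delta> n (X \<omega>) \<partial>M) =
      (LINT x : block_product r \<Delta> n | (\<Pi>\<^sub>M i\<in>{..<l}. \<mu>). kernel_det K l x)"
  using det r \<Delta> disj n unfolding determinantal_def Let_def l by blast+

text \<open>The moment identity for a single set, with the determinant bounded by \<open>B\<^sup>l\<close>. The case \<open>l = 0\<close> is separate,
  since the identity is postulated for positive orders only.\<close>

lemma determinantal_binomial_moment_bound:
  fixes E :: "'a::polish_space set"
  assumes det: "determinantal E M X K \<mu>" and sf: "sigma_finite_measure \<mu>"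
    and K: "positive_kernel E K"
    and D: "D \<in> sets (restrict_space borel E)" "precompact_in E D"
    and B: "\<And>x. x \<in> D \<Longrightarrow> cmod (K x x) \<le> B" "B \<ge> 0"
  shows "integrable M (\<lambda>\<omega>. real (points D (X \<omega>) choose l))"
    and "(\<integral>\<omega>. real (points D (X \<omega>) choose l) \<partial>M) \<le> (B * measure \<mu> D) ^ l / fact l"
proof -
  interpret prob_space M by (rule determinantal_measurable[OF det])
  have "integrable M (\<lambda>\<omega>. real (points D (X \<omega>) choose l)) \<and>
      (\<integral>\<omega>. real (points D (X \<omega>) choose l) \<partial>M) \<le> (B * measure \<mu> D) ^ l / fact l"
  proof (cases "l = 0")
    case True then show ?thesis by simp
  next
    case False
    interpret product_sigma_finite "\<lambda>_::nat. \<mu>" by (simp add: product_sigma_finite_def sf)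
    define P where "P = (\<Pi>\<^sub>M i\<in>{..<l}. \<mu>)"
    define A where "A = PiE {..<l} (\<lambda>_. D)"
    have E1: "integrable M (\<lambda>\<omega>. factorial_count 1 (\<lambda>_. D) (\<lambda>_. l) (X \<omega>)) \<and>
           set_integrable P A (kernel_det K l) \<and>
           complex_of_real (\<integral>\<omega>. factorial_count 1 (\<lambda>_. D) (\<lambda>_. l) (X \<omega>) \<partial>M) =
             (LINT x : A | P. kernel_det K l x)"
      using determinantal_moment_identity[OF det, of 1 "\<lambda>_. D" "\<lambda>_. l" l] D False
      by (simp add: disjoint_family_on_def block_product_1[simplified] P_def A_def)
    have fc: "factorial_count 1 (\<lambda>_. D) (\<lambda>_. l) (X \<omega>) = fact l * real (points D (X \<omega>) choose l)" if "\<omega> \<in> space M" for \<omega>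
      using factorial_count_eq_binomial[OF determinantal_configuration[OF det that], of 1 "\<lambda>_. D" "\<lambda>_. l"] D by simp
    have int: "integrable M (\<lambda>\<omega>. fact l * real (points D (X \<omega>) choose l))"
      using E1 Bochner_Integration.integrable_cong[of M M "\<lambda>\<omega>. factorial_count 1 (\<lambda>_. D) (\<lambda>_. l) (X \<omega>)"
          "\<lambda>\<omega>. fact l * real (points D (X \<omega>) choose l)"] fc by simp
    then have int': "integrable M (\<lambda>\<omega>. real (points D (X \<omega>) choose l))" by simp
    have sets_\<mu>: "sets \<mu> = sets (restrict_space borel E)"
      using det by (simp add: determinantal_def radon_on_def)
    have DE: "D \<subseteq> E" using D(2) by (auto simp: precompact_in_def)
    have fin: "emeasure \<mu> D < \<infinity>"
    proof -
      obtain C where C: "compact C" "C \<subseteq> E" "D \<subseteq> C" using D(2) by (auto simp: precompact_in_def)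
      then have "emeasure \<mu> D \<le> emeasure \<mu> C"
        using compact_in_sets_restrict[of C E] sets_\<mu> by (intro emeasure_mono) auto
      also have "\<dots> < \<infinity>" using det C by (simp add: determinantal_def radon_on_def)
      finally show ?thesis .
    qed
    have AP: "A \<in> sets P" unfolding A_def P_def using D sets_\<mu> by (intro sets_PiM_I_finite) auto
    have "emeasure P A = (\<Prod>i<l. emeasure \<mu> D)"
      unfolding P_def A_def using D sets_\<mu> by (subst emeasure_PiM) auto
    also have "\<dots> = ennreal (measure \<mu> D ^ l)"
      using fin by (simp add: emeasure_eq_ennreal_measure ennreal_power)
    finally have emA: "emeasure P A = ennreal (measure \<mu> D ^ l)" .
    then have mA: "measure P A = measure \<mu> D ^ l" by (simp add: measure_def)
    have "(\<integral>\<omega>. fact l * real (points D (X \<omega>) choose l) \<partial>M) = (\<integral>\<omega>. factorial_count 1 (\<lambda>_. D) (\<lambda>_. l) (X \<omega>) \<partial>M)"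
      by (rule Bochner_Integration.integral_cong[OF refl fc[symmetric]])
    also have "\<dots> \<le> cmod (complex_of_real (\<integral>\<omega>. factorial_count 1 (\<lambda>_. D) (\<lambda>_. l) (X \<omega>) \<partial>M))"
      by simp
    also have "\<dots> = cmod (\<integral>x. indicator A x *\<^sub>R kernel_det K l x \<partial>P)"
      using E1 by (simp add: set_lebesgue_integral_def)
    also have "\<dots> \<le> (\<integral>x. norm (indicator A x *\<^sub>R kernel_det K l x) \<partial>P)"
      by (rule integral_norm_bound)
    also have "\<dots> \<le> (\<integral>x. indicator A x *\<^sub>R (B ^ l) \<partial>P)"
    proof (rule integral_mono)
      show "integrable P (\<lambda>x. norm (indicator A x *\<^sub>R kernel_det K l x))"
        using E1 unfolding set_integrable_def by (intro integrable_norm) blast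
      show "integrable P (\<lambda>x. indicator A x *\<^sub>R (B ^ l))"
        using AP emA by (intro integrable_scaleR_left integrable_real_indicator) simp_all
      show "norm (indicator A x *\<^sub>R kernel_det K l x) \<le> indicator A x *\<^sub>R (B ^ l)" for x
      proof (cases "x \<in> A")
        case True
        then have "x i \<in> D" if "i < l" for i using that by (auto simp: A_def)
        then have "cmod (kernel_det K l x) \<le> B ^ l"
          using DE B by (intro kernel_det_bound[OF K]) auto
        then show ?thesis using True by simp
      qed simp
    qed
    also have "\<dots> = (B * measure \<mu> D) ^ l"
      using AP emA mA by (simp add: power_mult_distrib)
    finally have "fact l * (\<integral>\<omega>. real (points D (X \<omega>) choose l) \<partial>M) \<le> (B * measure \<mu> D) ^ l"
      by simp
    then show ?thesis using int' by (simp add: field_simps)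
  qed
  then show "integrable M (\<lambda>\<omega>. real (points D (X \<omega>) choose l))"
    "(\<integral>\<omega>. real (points D (X \<omega>) choose l) \<partial>M) \<le> (B * measure \<mu> D) ^ l / fact l" by blast+
qed

text \<open>From \<open>3\<^sup>N = (\<Sum>l. 2\<^sup>l * (N choose l))\<close> and the factor \<open>1 / l!\<close> in the moment bound.\<close>

lemma determinantal_exponential_moment:
  fixes E :: "'a::polish_space set"
  assumes det: "determinantal E M X K \<mu>" and sf: "sigma_finite_measure \<mu>"
    and K: "positive_kernel E K"
    and D: "D \<in> sets (restrict_space borel E)" "precompact_in E D"
    and B: "\<And>x. x \<in> D \<Longrightarrow> cmod (K x x) \<le> B" "B \<ge> 0"
  shows "integrable M (\<lambda>\<omega>. 3 ^ points D (X \<omega>) :: real)"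
proof (rule integrableI_bounded)
  have pm [measurable]: "(\<lambda>\<omega>. f (points D (X \<omega>))) \<in> borel_measurable M" for f :: "nat \<Rightarrow> real"
    by (rule measurable_compose[OF determinantal_points_measurable[OF det D(1)]]) simp
  show "(\<lambda>\<omega>. 3 ^ points D (X \<omega>) :: real) \<in> borel_measurable M" by (rule pm)
  define C where "C = B * measure \<mu> D"
  note mb = determinantal_binomial_moment_bound[OF det sf K D B]
  have ser: "ennreal (3 ^ N) = (\<Sum>l. ennreal (2 ^ l * real (N choose l)))" for N
  proof -
    have s: "(\<lambda>l. 2 ^ l * real (N choose l)) sums (\<Sum>l\<le>N. 2 ^ l * real (N choose l))"
      by (rule sums_finite) (auto simp: binomial_eq_0)
    have "(\<Sum>l\<le>N. 2 ^ l * real (N choose l)) = (2 + 1) ^ N"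
      by (subst binomial_ring) (simp add: mult.commute)
    with s show ?thesis by (simp add: suminf_ennreal2 sums_iff)
  qed
  have "(\<integral>\<^sup>+\<omega>. ennreal (norm (3 ^ points D (X \<omega>) :: real)) \<partial>M) =
      (\<integral>\<^sup>+\<omega>. (\<Sum>l. ennreal (2 ^ l * real (points D (X \<omega>) choose l))) \<partial>M)"
    by (simp add: ser)
  also have "\<dots> = (\<Sum>l. \<integral>\<^sup>+\<omega>. ennreal (2 ^ l * real (points D (X \<omega>) choose l)) \<partial>M)"
    by (rule nn_integral_suminf) (rule measurable_compose[OF pm measurable_ennreal])
  also have "\<dots> \<le> (\<Sum>l. ennreal ((2 * C) ^ l / fact l))"
  proof (rule suminf_le)
    fix l
    have "(\<integral>\<^sup>+\<omega>. ennreal (2 ^ l * real (points D (X \<omega>) choose l)) \<partial>M) =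
        ennreal (2 ^ l * (\<integral>\<omega>. real (points D (X \<omega>) choose l) \<partial>M))"
      using mb(1)[of l] by (subst nn_integral_eq_integral) simp_all
    also have "\<dots> \<le> ennreal (2 ^ l * (C ^ l / fact l))"
      using mb(2)[of l] by (intro ennreal_leI mult_left_mono) (simp_all add: C_def)
    finally show "(\<integral>\<^sup>+\<omega>. ennreal (2 ^ l * real (points D (X \<omega>) choose l)) \<partial>M) \<le> ennreal ((2 * C) ^ l / fact l)"
      by (simp add: power_mult_distrib)
  qed simp_all
  also have "\<dots> = ennreal (exp (2 * C))"
  proof -
    have "C \<ge> 0" using B by (simp add: C_def)
    moreover have "(\<lambda>l. (2 * C) ^ l / fact l) sums exp (2 * C)"
      using exp_converges[of "2 * C"] by (simp add: divide_inverse mult.commute)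
    ultimately show ?thesis by (simp add: suminf_ennreal2 sums_iff)
  qed
  finally show "(\<integral>\<^sup>+\<omega>. ennreal (norm (3 ^ points D (X \<omega>) :: real)) \<partial>M) < \<infinity>"
    by (rule le_less_trans) simp
qed

text \<open>Indices of order 0 contribute the factor 1 and are dropped, because the moment identity is postulated
  for positive orders; the remaining ones are enumerated.\<close>

lemma determinantal_mixed_moments_eq:
  fixes E :: "'a::polish_space set" and \<Delta> :: "'i \<Rightarrow> 'a set"
  assumes X: "determinantal E M X K \<mu>" and Y: "determinantal E N Y K \<mu>"
    and I: "finite I" and disj: "disjoint_family_on \<Delta> I"
    and \<Delta>: "\<And>k. k \<in> I \<Longrightarrow> \<Delta> k \<in> sets (restrict_space borel E) \<and> precompact_in E (\<Delta> k)"
  shows "(\<integral>\<omega>. (\<Prod>k\<in>I. real (points (\<Delta> k) (X \<omega>) choose n k)) \<partial>M) =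
         (\<integral>\<omega>. (\<Prod>k\<in>I. real (points (\<Delta> k) (Y \<omega>) choose n k)) \<partial>N)"
proof -
  interpret M: prob_space M by (rule determinantal_measurable[OF X])
  interpret N: prob_space N by (rule determinantal_measurable[OF Y])
  define J where "J = {k\<in>I. n k \<ge> 1}"
  have drop: "(\<Prod>k\<in>I. real (p k choose n k)) = (\<Prod>k\<in>J. real (p k choose n k))" for p :: "'i \<Rightarrow> nat"
    by (rule prod.mono_neutral_right[OF I]) (auto simp: J_def not_le)
  show ?thesis
  proof (cases "J = {}")
    case True then show ?thesis unfolding drop by (simp add: M.prob_space N.prob_space)
  next
    case False
    define r where "r = card J"
    have finJ: "finite J" using I by (simp add: J_def)
    then have r: "r \<ge> 1" using False by (simp add: r_def Suc_le_eq card_gt_0_iff)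
    obtain e where e: "bij_betw e {..<r} J"
      using ex_bij_betw_nat_finite[OF finJ] by (auto simp: r_def lessThan_atLeast0)
    have eJ: "e k \<in> J" if "k < r" for k using e that by (auto simp: bij_betw_def)
    have 1: "\<forall>k<r. \<Delta> (e k) \<in> sets (restrict_space borel E) \<and> precompact_in E (\<Delta> (e k))"
      using \<Delta> eJ by (auto simp: J_def)
    have 2: "disjoint_family_on (\<lambda>k. \<Delta> (e k)) {..<r}"
      unfolding disjoint_family_on_def
    proof (intro ballI impI)
      fix a b assume "a \<in> {..<r}" "b \<in> {..<r}" "a \<noteq> b"
      then have "e a \<noteq> e b" "e a \<in> I" "e b \<in> I"
        using e eJ by (auto simp: bij_betw_def inj_on_def J_def)
      then show "\<Delta> (e a) \<inter> \<Delta> (e b) = {}" using disj by (simp add: disjoint_family_on_def)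
    qed
    have 3: "\<forall>k<r. 1 \<le> n (e k)" using eJ by (auto simp: J_def)
    define R where "R = (LINT x : block_product r (\<lambda>k. \<Delta> (e k)) (\<lambda>k. n (e k)) | (\<Pi>\<^sub>M i\<in>{..<\<Sum>k<r. n (e k)}. \<mu>).
        kernel_det K (\<Sum>k<r. n (e k)) x)"
    have moment: "complex_of_real ((\<Prod>k<r. fact (n (e k))) * (\<integral>\<omega>. (\<Prod>k\<in>J. real (points (\<Delta> k) (Z \<omega>) choose n k)) \<partial>L)) = R"
      if Z: "determinantal E L Z K \<mu>" for Z :: "'z \<Rightarrow> 'a measure" and L
    proof -
      have "complex_of_real (\<integral>\<omega>. factorial_count r (\<lambda>k. \<Delta> (e k)) (\<lambda>k. n (e k)) (Z \<omega>) \<partial>L) = R"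
        unfolding R_def by (rule determinantal_moment_identity(3)[OF Z r 1 2 3 refl])
      moreover have "factorial_count r (\<lambda>k. \<Delta> (e k)) (\<lambda>k. n (e k)) (Z \<omega>) =
          (\<Prod>k<r. fact (n (e k))) * (\<Prod>k\<in>J. real (points (\<Delta> k) (Z \<omega>) choose n k))" if "\<omega> \<in> space L" for \<omega>
        using factorial_count_eq_binomial[OF determinantal_configuration[OF Z that], of r "\<lambda>k. \<Delta> (e k)" "\<lambda>k. n (e k)"] 1
        by (simp add: prod.reindex_bij_betw[OF e, of "\<lambda>k. real (points (\<Delta> k) (Z \<omega>) choose n k)"])
      then have "(\<integral>\<omega>. factorial_count r (\<lambda>k. \<Delta> (e k)) (\<lambda>k. n (e k)) (Z \<omega>) \<partial>L) =
          (\<integral>\<omega>. (\<Prod>k<r. fact (n (e k))) * (\<Prod>k\<in>J. real (points (\<Delta> k) (Z \<omega>) choose n k)) \<partial>L)"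
        by (rule Bochner_Integration.integral_cong[OF refl])
      ultimately show ?thesis by simp
    qed
    have "(\<Prod>k<r. fact (n (e k)) :: real) \<noteq> 0" by simp
    moreover have "(\<Prod>k<r. fact (n (e k))) * (\<integral>\<omega>. (\<Prod>k\<in>J. real (points (\<Delta> k) (X \<omega>) choose n k)) \<partial>M) =
        (\<Prod>k<r. fact (n (e k))) * (\<integral>\<omega>. (\<Prod>k\<in>J. real (points (\<Delta> k) (Y \<omega>) choose n k)) \<partial>N)"
      using trans[OF moment[OF X] moment[OF Y, symmetric]] by (simp only: of_real_eq_iff)
    ultimately show ?thesis unfolding drop by (simp only: mult_cancel_left) blast
  qed
qed

text \<open>The kernel determines all mixed binomial moments of the counts in disjoint sets; because of the
  exponential moments these determine the joint laws of the counts, and these determine the law.\<close>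

theorem determinantal_law_unique:
  fixes E :: "'a::polish_space set"
  assumes X: "determinantal E M X K \<mu>" and Y: "determinantal E N Y K \<mu>"
    and sf: "sigma_finite_measure \<mu>" and K: "positive_kernel E K"
    and B: "\<And>D. precompact_in E D \<Longrightarrow> \<exists>B. \<forall>x\<in>D. cmod (K x x) \<le> B"
    and C: "\<And>n::nat. compact (C n)" "incseq C" "(\<Union>n. C n) = E"
  shows "distr M (configuration_algebra E) X = distr N (configuration_algebra E) Y"
proof (rule law_eq_of_disjoint_counts[OF C])
  show "prob_space (distr M (configuration_algebra E) X)" "prob_space (distr N (configuration_algebra E) Y)"
    using determinantal_measurable[OF X] determinantal_measurable[OF Y] by (auto intro: prob_space.prob_space_distr)
  fix I :: "'a set set set" and \<Delta> and v :: "'a set set \<Rightarrow> nat"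
  assume I: "finite I" and disj: "disjoint_family_on \<Delta> I"
    and \<Delta>: "\<And>J. J \<in> I \<Longrightarrow> \<Delta> J \<in> sets (restrict_space borel E) \<and> precompact_in E (\<Delta> J)"
  define U where "U = (\<Union>J\<in>I. \<Delta> J)"
  have U: "U \<in> sets (restrict_space borel E)" "precompact_in E U"
    unfolding U_def using \<Delta> I by (auto intro: precompact_in_UN)
  obtain b where b: "\<And>x. x \<in> U \<Longrightarrow> cmod (K x x) \<le> b" using B[OF U(2)] by blast
  have b': "cmod (K x x) \<le> max b 0" if "x \<in> U" for x using b[OF that] by simp
  have lim: "(\<lambda>L. \<Sum>n\<in>PiE I (\<lambda>_. {..L}). (\<Prod>k\<in>I. inversion_coeff (v k) (n k)) *
             (\<integral>\<omega>. (\<Prod>k\<in>I. real (points (\<Delta> k) (Z \<omega>) choose n k)) \<partial>Q))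
         \<longlonglongrightarrow> measure Q {\<omega>\<in>space Q. \<forall>k\<in>I. points (\<Delta> k) (Z \<omega>) = v k}"
    if Z: "determinantal E Q Z K \<mu>" for Q and Z :: "'z \<Rightarrow> 'a measure"
  proof (rule prob_eq_of_binomial_moments[OF determinantal_measurable(1)[OF Z] I])
    show "(\<lambda>\<omega>. points (\<Delta> k) (Z \<omega>)) \<in> measurable Q (count_space UNIV)" if "k \<in> I" for k
      using determinantal_points_measurable[OF Z] \<Delta>[OF that] by blast
    have "points U (Z \<omega>) = (\<Sum>k\<in>I. points (\<Delta> k) (Z \<omega>))" if "\<omega> \<in> space Q" for \<omega>
      unfolding U_def using \<Delta> U(2)[unfolded U_def]
      by (intro points_disjoint_union[OF determinantal_configuration[OF Z that] I _ _ disj]) auto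
    then have eq: "(3 ^ points U (Z \<omega>) :: real) = 3 ^ (\<Sum>k\<in>I. points (\<Delta> k) (Z \<omega>))" if "\<omega> \<in> space Q" for \<omega>
      using that by simp
    have "integrable Q (\<lambda>\<omega>. 3 ^ points U (Z \<omega>) :: real)"
      by (rule determinantal_exponential_moment[OF Z sf K U b']) simp_all
    then show "integrable Q (\<lambda>\<omega>. 3 ^ (\<Sum>k\<in>I. points (\<Delta> k) (Z \<omega>)) :: real)"
      using Bochner_Integration.integrable_cong[of Q Q "\<lambda>\<omega>. 3 ^ points U (Z \<omega>) :: real"
          "\<lambda>\<omega>. 3 ^ (\<Sum>k\<in>I. points (\<Delta> k) (Z \<omega>))"] eq by simp
  qed
  have mom: "(\<integral>\<omega>. (\<Prod>k\<in>I. real (points (\<Delta> k) (X \<omega>) choose n k)) \<partial>M) =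
      (\<integral>\<omega>. (\<Prod>k\<in>I. real (points (\<Delta> k) (Y \<omega>) choose n k)) \<partial>N)" for n
    by (rule determinantal_mixed_moments_eq[OF X Y I disj \<Delta>])
  have eqm: "measure M {\<omega>\<in>space M. \<forall>k\<in>I. points (\<Delta> k) (X \<omega>) = v k} =
      measure N {\<omega>\<in>space N. \<forall>k\<in>I. points (\<Delta> k) (Y \<omega>) = v k}"
    by (rule LIMSEQ_unique[OF lim[OF X, unfolded mom] lim[OF Y]])
  define S where "S = {\<xi>\<in>configurations E. \<forall>J\<in>I. points (\<Delta> J) \<xi> = v J}"
  have Sm: "S \<in> sets (configuration_algebra E)"
    unfolding S_def using \<Delta> by (intro sets_points_eq I) blast
  have em: "emeasure (distr Q (configuration_algebra E) Z) S =
      ennreal (measure Q {\<omega>\<in>space Q. \<forall>k\<in>I. points (\<Delta> k) (Z \<omega>) = v k})"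
    if Z: "determinantal E Q Z K \<mu>" for Q and Z :: "'z \<Rightarrow> 'a measure"
  proof -
    interpret prob_space Q by (rule determinantal_measurable[OF Z])
    have "Z -` S \<inter> space Q = {\<omega>\<in>space Q. \<forall>k\<in>I. points (\<Delta> k) (Z \<omega>) = v k}"
      using determinantal_configuration[OF Z] by (auto simp: S_def)
    then show ?thesis
      using emeasure_distr[OF determinantal_measurable(2)[OF Z] Sm] by (simp add: emeasure_eq_measure)
  qed
  show "emeasure (distr M (configuration_algebra E) X) {\<xi>\<in>configurations E. \<forall>J\<in>I. points (\<Delta> J) \<xi> = v J} =
      emeasure (distr N (configuration_algebra E) Y) {\<xi>\<in>configurations E. \<forall>J\<in>I. points (\<Delta> J) \<xi> = v J}"
    using em[OF X] em[OF Y] eqm by (simp add: S_def)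
qed simp_all

section \<open>The Hua--Pickrell and Bergman processes\<close>

text \<open>Expanding the kernel, the quadratic form becomes a series of squared absolute values with the positive
  coefficients \<open>(m + k) choose k\<close>.\<close>

lemma positive_kernel_bergman: "positive_kernel unit_disc (bergman_kernel m)"
  unfolding positive_kernel_def
proof (intro allI impI)
  fix n :: nat and x v :: "nat \<Rightarrow> complex"
  assume x: "\<forall>i<n. x i \<in> unit_disc"
  define c where "c k = real ((m + k) choose k)" for k
  define s where "s k = (\<Sum>i<n. cnj (v i) * x i ^ k)" for k
  define S where "S = (\<Sum>i<n. \<Sum>j<n. cnj (v i) * bergman_kernel m (x i) (x j) * v j)"
  have "(\<lambda>k. \<Sum>i<n. \<Sum>j<n. cnj (v i) * (of_real (c k) * (x i * cnj (x j)) ^ k) * v j) sums S"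
    unfolding S_def
  proof (intro sums_sum sums_mult sums_mult2)
    fix i j assume "i \<in> {..<n}" "j \<in> {..<n}"
    then have "cmod (x i) * cmod (x j) < 1 * 1" using x by (intro mult_strict_mono') auto
    then have "cmod (x i * cnj (x j)) < 1" by (simp add: norm_mult)
    from bergman_series[OF this, of m]
    show "(\<lambda>k. of_real (c k) * (x i * cnj (x j)) ^ k) sums bergman_kernel m (x i) (x j)"
      by (simp add: c_def bergman_kernel_def)
  qed
  also have "(\<lambda>k. \<Sum>i<n. \<Sum>j<n. cnj (v i) * (of_real (c k) * (x i * cnj (x j)) ^ k) * v j) =
      (\<lambda>k. of_real (c k * (cmod (s k))\<^sup>2))"
  proof
    fix k
    have "of_real (c k * (cmod (s k))\<^sup>2) = of_real (c k) * (s k * cnj (s k))"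
      by (simp only: of_real_mult complex_norm_square)
    also have "\<dots> = (\<Sum>i<n. \<Sum>j<n. cnj (v i) * (of_real (c k) * (x i * cnj (x j)) ^ k) * v j)"
      by (simp add: s_def sum_product sum_distrib_left power_mult_distrib mult_ac)
    finally show "(\<Sum>i<n. \<Sum>j<n. cnj (v i) * (of_real (c k) * (x i * cnj (x j)) ^ k) * v j) =
        of_real (c k * (cmod (s k))\<^sup>2)" by simp
  qed
  finally have S: "(\<lambda>k. complex_of_real (c k * (cmod (s k))\<^sup>2)) sums S" .
  have R: "(\<lambda>k. c k * (cmod (s k))\<^sup>2) sums Re S"
    using sums_Re[OF S] by simp
  have "S = of_real (Re S)"
    using sums_unique2[OF S sums_of_real[OF R]] .
  moreover have "Re S \<ge> 0"
    by (rule sums_le[OF _ sums_zero R]) (simp add: c_def)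
  ultimately show "\<exists>t\<ge>0. (\<Sum>i<n. \<Sum>j<n. cnj (v i) * bergman_kernel m (x i) (x j) * v j) = complex_of_real t"
    unfolding S_def[symmetric] by blast
qed

lemma bergman_kernel_diag_bounded:
  assumes "precompact_in unit_disc D"
  shows "\<exists>B. \<forall>x\<in>D. cmod (bergman_kernel m x x) \<le> B"
proof -
  obtain C where C: "compact C" "C \<subseteq> unit_disc" "D \<subseteq> C" using assms by (auto simp: precompact_in_def)
  have "continuous_on C (\<lambda>x. bergman_kernel m x x)"
    unfolding bergman_kernel_def
  proof (intro continuous_intros ballI)
    fix x assume "x \<in> C"
    then have "cmod x * cmod x < 1 * 1" using C by (intro mult_strict_mono') auto
    then have "x * cnj x \<noteq> 1" by (metis complex_mod_cnj norm_mult norm_one mult_1 less_irrefl)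
    then show "(1 - x * cnj x) ^ (m + 1) \<noteq> 0" by simp
  qed
  then have "bounded ((\<lambda>x. bergman_kernel m x x) ` C)"
    using C(1) by (intro compact_imp_bounded compact_continuous_image)
  then obtain B where "\<forall>y\<in>(\<lambda>x. bergman_kernel m x x) ` C. cmod y \<le> B" unfolding bounded_iff by blast
  then show ?thesis using C(3) by blast
qed

lemma radon_on_finite_measure:
  assumes "finite_measure \<mu>" "sets \<mu> = sets (restrict_space borel E)"
  shows "radon_on E \<mu>"
  using assms finite_measure.emeasure_finite[OF assms(1)] by (simp add: radon_on_def less_top)

lemma disc_exhaustion:
  fixes C :: "nat \<Rightarrow> complex set"
  defines "C \<equiv> \<lambda>n. cball 0 (1 - 1 / real (Suc n))"
  shows "compact (C n)" "incseq C" "(\<Union>n. C n) = unit_disc"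
proof -
  show "compact (C n)" by (simp add: C_def)
  show "incseq C"
    unfolding incseq_def C_def by (auto intro!: subset_cball simp: frac_le)
  show "(\<Union>n. C n) = unit_disc"
  proof (intro equalityI subsetI)
    fix z :: complex assume "z \<in> unit_disc"
    then have "0 < 1 - cmod z" by simp
    then obtain n where "inverse (real (Suc n)) < 1 - cmod z" using reals_Archimedean by blast
    then have "z \<in> C n" by (simp add: C_def inverse_eq_divide)
    then show "z \<in> (\<Union>n. C n)" by blast
  next
    fix z assume "z \<in> (\<Union>n. C n)"
    then obtain n where "cmod z \<le> 1 - 1 / real (Suc n)" by (auto simp: C_def)
    moreover have "1 / real (Suc n) > 0" by simp
    ultimately have "cmod z < 1" by linarith
    then show "z \<in> unit_disc" by simp
  qed
qed

text \<open>The limiting kernel differs from the Bergman kernel by the gauge factor \<open>h z * cnj (h w)\<close> with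
  \<open>h = sqrt (pi / m) * hp_weight \<delta>\<close>, and the reference measures differ by the density \<open>\<bar>h\<bar>\<^sup>2\<close>.\<close>

lemma determinantal_hp_iff_bergman:
  assumes m: "m \<ge> 1" and \<delta>: "Re \<delta> > -1/2"
  shows "determinantal unit_disc M X (hp_limit_kernel m \<delta>) (hp_measure m \<delta>) \<longleftrightarrow>
    determinantal unit_disc M X (bergman_kernel m) (bergman_measure m)"
proof -
  define h where "h z = complex_of_real (sqrt (pi / real m)) * hp_weight \<delta> z" for z
  have hsq: "(cmod (h z))\<^sup>2 = pi / real m * (cmod (hp_weight \<delta> z))\<^sup>2" for z
    by (simp add: h_def norm_mult power_mult_distrib)
  have h0: "h z \<noteq> 0" if "z \<in> unit_disc" for z
    using hp_weight_nonzero[OF that, of \<delta>] m by (simp add: h_def)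
  have hm: "h \<in> borel_measurable (restrict_space borel unit_disc)"
    unfolding h_def[abs_def]
    by (intro borel_measurable_continuous_on_restrict continuous_intros
          holomorphic_on_imp_continuous_on holomorphic_hp_weight)
  then have h\<beta> [measurable]: "h \<in> borel_measurable (bergman_measure m)"
    by (simp add: measurable_def sets_bergman_measure space_restrict_space)
  have hp: "hp_measure m \<delta> = density (bergman_measure m) (\<lambda>z. ennreal ((cmod (h z))\<^sup>2))"
    unfolding hp_measure_conv[OF m] hsq ..
  have berg: "bergman_measure m = density (hp_measure m \<delta>) (\<lambda>z. ennreal (1 / (cmod (h z))\<^sup>2))"
  proof -
    have "density (hp_measure m \<delta>) (\<lambda>z. ennreal (1 / (cmod (h z))\<^sup>2)) =
        density (bergman_measure m) (\<lambda>z. ennreal ((cmod (h z))\<^sup>2) * ennreal (1 / (cmod (h z))\<^sup>2))"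
      unfolding hp by (rule density_density_eq) measurable
    also have "\<dots> = density (bergman_measure m) (\<lambda>z. 1)"
    proof (rule density_cong)
      show "AE z in bergman_measure m. ennreal ((cmod (h z))\<^sup>2) * ennreal (1 / (cmod (h z))\<^sup>2) = 1"
        using h0 by (intro AE_I2) (simp add: ennreal_mult''[symmetric])
    qed measurable
    finally show ?thesis by (simp add: density_1)
  qed
  have fin_hp: "finite_measure (hp_measure m \<delta>)" by (rule finite_measure_hp[OF m \<delta>])
  have fin_b: "finite_measure (bergman_measure m)"
    by (rule prob_space.finite_measure[OF prob_space_bergman_measure[OF m]])
  note sf_hp = finite_measure.axioms(1)[OF fin_hp] and sf_b = finite_measure.axioms(1)[OF fin_b]
  note radon_hp = radon_on_finite_measure[OF fin_hp sets_hp_measure]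
    and radon_b = radon_on_finite_measure[OF fin_b sets_bergman_measure]
  have kernel: "bergman_kernel m z w = hp_limit_kernel m \<delta> z w * (h z * cnj (h w))"
    if z: "z \<in> unit_disc" and w: "w \<in> unit_disc" for z w
  proof -
    have "h z * cnj (h w) = (of_real (sqrt (pi / real m)) * of_real (sqrt (pi / real m))) *
        (hp_weight \<delta> z * cnj (hp_weight \<delta> w))"
      by (simp add: h_def mult_ac)
    also have "complex_of_real (sqrt (pi / real m)) * of_real (sqrt (pi / real m)) = of_real (pi / real m)"
      unfolding of_real_mult[symmetric] by (subst real_sqrt_mult_self) simp
    finally have hh: "h z * cnj (h w) = of_real (pi / real m) * (hp_weight \<delta> z * cnj (hp_weight \<delta> w))" .
    show ?thesis
      unfolding hp_limit_kernel_eq[OF m \<delta> z w] hh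
      using m hp_weight_nonzero[OF z, of \<delta>] hp_weight_nonzero[OF w, of \<delta>] by simp
  qed
  show ?thesis
  proof
    assume "determinantal unit_disc M X (hp_limit_kernel m \<delta>) (hp_measure m \<delta>)"
    then show "determinantal unit_disc M X (bergman_kernel m) (bergman_measure m)"
      by (rule determinantal_gauge[OF _ hm h0 kernel berg sf_hp sf_b radon_b])
  next
    assume D: "determinantal unit_disc M X (bergman_kernel m) (bergman_measure m)"
    show "determinantal unit_disc M X (hp_limit_kernel m \<delta>) (hp_measure m \<delta>)"
    proof (rule determinantal_gauge[OF D, where h = "\<lambda>z. 1 / h z"])
      show "(\<lambda>z. 1 / h z) \<in> borel_measurable (restrict_space borel unit_disc)"
        using hm by measurable
      show "hp_limit_kernel m \<delta> z w = bergman_kernel m z w * (1 / h z * cnj (1 / h w))"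
        if "z \<in> unit_disc" "w \<in> unit_disc" for z w
        using kernel[OF that] h0[OF that(1)] h0[OF that(2)] by simp
      show "hp_measure m \<delta> = density (bergman_measure m) (\<lambda>z. ennreal (1 / (cmod (1 / h z))\<^sup>2))"
        unfolding hp by (simp add: norm_divide power_divide)
    qed (use h0 sf_b sf_hp radon_hp in simp_all)
  qed
qed

theorem theorem1p2:
  fixes m :: nat and \<delta> :: complex
    and M :: "'v measure" and N :: "'w measure"
  assumes "m \<ge> 1" and "Re \<delta> > -1/2"
  shows "(\<forall>z\<in>unit_disc. \<forall>w\<in>unit_disc. convergent (\<lambda>n. hp_kernel m \<delta> n z w)) \<and>
    (\<forall>X. determinantal unit_disc M X (hp_limit_kernel m \<delta>) (hp_measure m \<delta>) \<longleftrightarrow>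
         determinantal unit_disc M X (bergman_kernel m) (bergman_measure m)) \<and>
    (\<forall>X Y. determinantal unit_disc M X (hp_limit_kernel m \<delta>) (hp_measure m \<delta>) \<longrightarrow>
           determinantal unit_disc N Y (bergman_kernel m) (bergman_measure m) \<longrightarrow>
           distr M (configuration_algebra unit_disc) X =
           distr N (configuration_algebra unit_disc) Y)"
proof (intro conjI ballI allI impI)
  fix z w assume "z \<in> unit_disc" "w \<in> unit_disc"
  from hp_kernel_tendsto[OF assms this] show "convergent (\<lambda>n. hp_kernel m \<delta> n z w)"
    by (rule convergentI)
next
  fix X
  show "determinantal unit_disc M X (hp_limit_kernel m \<delta>) (hp_measure m \<delta>) \<longleftrightarrow>
      determinantal unit_disc M X (bergman_kernel m) (bergman_measure m)"
    by (rule determinantal_hp_iff_bergman[OF assms])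
next
  fix X Y
  assume "determinantal unit_disc M X (hp_limit_kernel m \<delta>) (hp_measure m \<delta>)"
  then have X: "determinantal unit_disc M X (bergman_kernel m) (bergman_measure m)"
    by (simp add: determinantal_hp_iff_bergman[OF assms])
  assume Y: "determinantal unit_disc N Y (bergman_kernel m) (bergman_measure m)"
  have "sigma_finite_measure (bergman_measure m)"
    by (rule finite_measure.axioms(1)[OF prob_space.finite_measure[OF prob_space_bergman_measure[OF assms(1)]]])
  from determinantal_law_unique[OF X Y this positive_kernel_bergman bergman_kernel_diag_bounded disc_exhaustion]
  show "distr M (configuration_algebra unit_disc) X = distr N (configuration_algebra unit_disc) Y" .
qed

end
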